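(* Let $\Phi(t)=\sum_{n=1}^{\infty}\mu(n)e^{-nt}$ for $t>0$, where $\mu$ is the Möbius function. The following are equivalent: (i) the Riemann hypothesis holds; (ii) $\Phi\in L^p(0,\infty)$ for every real $p$ with $1\le p<2$; (iii) $\Phi\in L^{2-\varepsilon}(0,\infty)$ for every real $\varepsilon$ with $0<\varepsilon\le 1$.
   Context: $\mu$ is the Möbius function: $\mu(n)=0$ if $n$ is divisible by the square of a prime, and $\mu(n)=(-1)^k$ if $n$ is a product of $k$ distinct primes (so $\mu(1)=1$). The spaces $L^p(0,\infty)$ are taken with respect to Lebesgue measure. The Riemann hypothesis is the assertion that all nontrivial zeros of the Riemann zeta function $\zeta(s)$ lie on the line $\Re s=1/2$. *)

theory Defs
  imports "HOL-Complex_Analysis.Complex_Analysis" "HOL-Computational_Algebra.Squarefree"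
begin

definition moebius :: "nat \<Rightarrow> int" where
  "moebius n = (if squarefree n then (-1) ^ card (prime_factors n) else 0)"

definition mem_Lp :: "real \<Rightarrow> real set \<Rightarrow> (real \<Rightarrow> real) \<Rightarrow> bool" where
  "mem_Lp p S f \<longleftrightarrow> f \<in> borel_measurable (lebesgue_on S) \<and>
     integrable (lebesgue_on S) (\<lambda>t. \<bar>f t\<bar> powr p)"

text \<open>The value at the pole is pinned to 0 only to make the continuation unique as a total function.\<close>

definition is_zeta_continuation :: "(complex \<Rightarrow> complex) \<Rightarrow> bool" where
  "is_zeta_continuation f \<longleftrightarrow> f holomorphic_on (- {1}) \<and> f 1 = 0 \<and>
     (\<forall>s. Re s > 1 \<longrightarrow> (\<lambda>n. 1 / of_nat (Suc n) powr s) sums f s)"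

definition zeta :: "complex \<Rightarrow> complex" where
  "zeta = (THE f. is_zeta_continuation f)"

text \<open>The point 1 has to be excluded because of the convention \<open>zeta 1 = 0\<close>;
  the trivial zeros are the negative even integers.\<close>

definition Riemann_Hypothesis :: bool where
  "Riemann_Hypothesis \<longleftrightarrow>
     (\<forall>s. zeta s = 0 \<and> s \<noteq> 1 \<and> (\<nexists>k::nat. k \<ge> 1 \<and> s = - 2 * of_nat k) \<longrightarrow> Re s = 1 / 2)"

definition Phi :: "real \<Rightarrow> real" where
  "Phi t = (\<Sum>n. of_int (moebius (Suc n)) * exp (- real (Suc n) * t))"

text \<open>The following shows that the definite description in \<open>zeta_def\<close> is well defined.
  Taylor expansion of \<open>x powr (1 - s)\<close> at the positive integers, summed over all of them,
  expresses \<open>(s - 1) * zeta s\<close> through its values further to the right.\<close>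

definition zc :: "nat \<Rightarrow> complex \<Rightarrow> complex" where
  "zc i s = (\<Prod>j<i. 1 - s - of_nat j)"

definition zrem :: "nat \<Rightarrow> nat \<Rightarrow> complex \<Rightarrow> complex" where
  "zrem K n s = of_nat (Suc (Suc n)) powr (1 - s) -
     (\<Sum>i\<le>K. zc i s * of_nat (Suc n) powr (1 - s - of_nat i) / fact i)"

lemma zc_Suc: "zc (Suc i) s = zc i s * (1 - s - of_nat i)"
  by (simp add: zc_def)

lemma holomorphic_zc [holomorphic_intros]: "zc i holomorphic_on A"
  unfolding zc_def by (intro holomorphic_intros)

lemma holomorphic_zrem: "zrem K n holomorphic_on A"
  unfolding zrem_def[abs_def] by (intro holomorphic_intros) (auto simp del: of_nat_Suc)

lemma norm_zrem_le:
  assumes "Re s + real K \<ge> 0"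
  shows "norm (zrem K n s) \<le> norm (zc (Suc K) s) * real (Suc n) powr (- Re s - real K)"
proof -
  let ?S = "closed_segment (of_nat (Suc n)) (of_nat (Suc (Suc n))) :: complex set"
  let ?f = "\<lambda>i x. zc i s * x powr (1 - s - of_nat i)"
  have S: "x \<in> \<real> \<and> Re x \<ge> real (Suc n)" if "x \<in> ?S" for x
  proof -
    have "?S = complex_of_real ` closed_segment (real (Suc n)) (real (Suc (Suc n)))"
      by (metis closed_segment_of_real of_real_of_nat_eq)
    with that show ?thesis
      by (auto simp: closed_segment_eq_real_ivl split: if_splits)
  qed
  have "cmod (?f 0 (of_nat (Suc (Suc n))) - (\<Sum>i\<le>K. ?f i (of_nat (Suc n)) *
          (of_nat (Suc (Suc n)) - of_nat (Suc n)) ^ i / fact i))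
        \<le> (norm (zc (Suc K) s) * real (Suc n) powr (- Re s - real K)) *
           cmod (of_nat (Suc (Suc n)) - of_nat (Suc n)) ^ Suc K / fact K"
  proof (rule complex_Taylor[where S = ?S])
    fix i x assume x: "x \<in> ?S"
    have "x \<notin> \<real>\<^sub>\<le>\<^sub>0" using S[OF x] by (auto simp: complex_nonpos_Reals_iff)
    then show "(?f i has_field_derivative ?f (Suc i) x) (at x within ?S)"
      by (auto intro!: derivative_eq_intros simp: zc_Suc algebra_simps)
  next
    fix x assume x: "x \<in> ?S"
    obtain r where r: "x = of_real r" "r \<ge> real (Suc n)"
      using S[OF x] by (auto elim!: Reals_cases)
    have "norm (x powr (1 - s - of_nat (Suc K))) = r powr (- Re s - real K)"
      using r by (subst r(1), subst norm_powr_real_powr) auto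
    also have "\<dots> \<le> real (Suc n) powr (- Re s - real K)"
      using r assms by (intro powr_mono2') auto
    finally show "norm (?f (Suc K) x) \<le> norm (zc (Suc K) s) * real (Suc n) powr (- Re s - real K)"
      unfolding norm_mult by (intro mult_left_mono) auto
  qed auto
  also have "\<dots> = (norm (zc (Suc K) s) * real (Suc n) powr (- Re s - real K)) / fact K"
    by simp
  also have "\<dots> \<le> (norm (zc (Suc K) s) * real (Suc n) powr (- Re s - real K)) / 1"
    by (intro divide_left_mono) auto
  finally show ?thesis by (simp add: zrem_def zc_def)
qed

lemma summable_Suc_powr: "a < -1 \<Longrightarrow> summable (\<lambda>n. real (Suc n) powr a)"
  using summable_real_powr_iff[of a] summable_Suc_iff[of "\<lambda>n. real n powr a"] by simp

lemma norm_Suc_powr: "norm (of_nat (Suc n) powr s :: complex) = real (Suc n) powr Re s"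
  using norm_powr_real_powr[of "of_nat (Suc n)" s] by (simp del: of_nat_Suc)

lemma holomorphic_suminf_zrem:
  "(\<lambda>s. \<Sum>n. zrem K n s) holomorphic_on {s. Re s > 1 - real K}"
proof (rule holomorphic_uniform_sequence[where f = "\<lambda>N s. \<Sum>n<N. zrem K n s"])
  show "open {s. Re s > 1 - real K}" by (rule open_halfspace_Re_gt)
  show "(\<lambda>s. \<Sum>n<N. zrem K n s) holomorphic_on {s. Re s > 1 - real K}" for N
    by (intro holomorphic_intros holomorphic_zrem)
  fix x assume x: "x \<in> {s. Re s > 1 - real K}"
  define d where "d = (Re x + real K - 1) / 2"
  have d: "d > 0" using x by (simp add: d_def)
  have Re: "Re s + real K \<ge> 1 + d" if "s \<in> cball x d" for s
  proof -
    have "Re x - Re s \<le> d" using that complex_Re_le_cmod[of "x - s"] by (simp add: dist_norm)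
    then show ?thesis by (simp add: d_def field_simps)
  qed
  have "compact (zc (Suc K) ` cball x d)"
    by (intro compact_continuous_image holomorphic_on_imp_continuous_on holomorphic_zc) auto
  then have "bounded (zc (Suc K) ` cball x d)" by (rule compact_imp_bounded)
  then obtain B where "\<forall>y\<in>zc (Suc K) ` cball x d. norm y \<le> B"
    unfolding bounded_iff by blast
  then have B: "norm (zc (Suc K) s) \<le> B" if "s \<in> cball x d" for s
    using that by blast
  have "norm (zc (Suc K) x) \<le> B" using d by (intro B) auto
  then have B0: "B \<ge> 0" using norm_ge_zero order_trans by blast
  have "uniform_limit (cball x d) (\<lambda>N s. \<Sum>n<N. zrem K n s) (\<lambda>s. \<Sum>n. zrem K n s) sequentially"
  proof (rule Weierstrass_m_test)
    show "summable (\<lambda>n. B * real (Suc n) powr (-1 - d))"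
      using d by (intro summable_mult summable_Suc_powr) auto
    fix n s assume s: "s \<in> cball x d"
    have "norm (zrem K n s) \<le> norm (zc (Suc K) s) * real (Suc n) powr (- Re s - real K)"
      using Re[OF s] d by (intro norm_zrem_le) auto
    also have "\<dots> \<le> B * real (Suc n) powr (-1 - d)"
      using Re[OF s] B[OF s] B0 by (intro mult_mono powr_mono) auto
    finally show "norm (zrem K n s) \<le> B * real (Suc n) powr (-1 - d)" .
  qed
  moreover have "cball x d \<subseteq> {s. Re s > 1 - real K}"
  proof
    fix s assume "s \<in> cball x d"
    then show "s \<in> {s. Re s > 1 - real K}" using Re[of s] d by simp
  qed
  ultimately show "\<exists>d>0. cball x d \<subseteq> {s. Re s > 1 - real K} \<and>
      uniform_limit (cball x d) (\<lambda>N s. \<Sum>n<N. zrem K n s) (\<lambda>s. \<Sum>n. zrem K n s) sequentially"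
    using d by (intro exI[of _ d] conjI)
qed

definition dzeta :: "complex \<Rightarrow> complex" where
  "dzeta s = (\<Sum>n. 1 / of_nat (Suc n) powr s)"

lemma dzeta_sums:
  assumes "Re s > 1"
  shows "(\<lambda>n. 1 / of_nat (Suc n) powr s) sums dzeta s"
proof -
  have "norm (1 / of_nat (Suc n) powr s) = real (Suc n) powr (- Re s)" for n
    by (simp add: norm_divide norm_Suc_powr powr_minus_divide del: of_nat_Suc)
  then have "summable (\<lambda>n. norm (1 / of_nat (Suc n) powr s))"
    using summable_Suc_powr[of "- Re s"] assms by simp
  then show ?thesis unfolding dzeta_def by (rule summable_sums[OF summable_norm_cancel])
qed

lemma dzeta_rec:
  assumes s: "Re s > 1" and K: "K \<ge> 1"
  shows "(s - 1) * dzeta s =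
    1 - (\<Sum>i\<in>{2..K}. zc (i - 1) s / fact i * ((s + of_nat (i - 1) - 1) * dzeta (s + of_nat (i - 1))))
      + (\<Sum>n. zrem K n s)"
proof -
  define T where "T = (\<Sum>i\<in>{2..K}. zc (i - 1) s / fact i * ((s + of_nat (i - 1) - 1) * dzeta (s + of_nat (i - 1))))"
  have lim: "(\<lambda>n. of_nat (Suc n) powr (1 - s)) \<longlonglongrightarrow> (0 :: complex)"
  proof (rule tendsto_norm_zero_cancel)
    have "(\<lambda>n. real (Suc n) powr (1 - Re s)) \<longlonglongrightarrow> 0"
      by (intro tendsto_neg_powr filterlim_compose[OF filterlim_real_sequentially filterlim_Suc])
         (use s in auto)
    then show "(\<lambda>n. norm (of_nat (Suc n) powr (1 - s) :: complex)) \<longlonglongrightarrow> 0"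
      by (simp add: norm_Suc_powr del: of_nat_Suc)
  qed
  have tele: "(\<lambda>n. of_nat (Suc (Suc n)) powr (1 - s) - of_nat (Suc n) powr (1 - s)) sums (0 - 1 :: complex)"
    using telescope_sums[OF lim] by simp
  have term_sums: "(\<lambda>n. zc i s * of_nat (Suc n) powr (1 - s - of_nat i) / fact i) sums
                (zc i s / fact i * dzeta (s + of_nat (i - 1)))" if "i \<in> {1..K}" for i
  proof -
    have "1 - s - of_nat i = - (s + of_nat (i - 1))"
      using that by (simp add: of_nat_diff)
    then have "of_nat (Suc n) powr (1 - s - of_nat i) = 1 / of_nat (Suc n) powr (s + of_nat (i - 1))"
      for n by (simp only: powr_minus_divide)
    moreover have "(\<lambda>n. zc i s / fact i * (1 / of_nat (Suc n) powr (s + of_nat (i - 1)))) sums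
                (zc i s / fact i * dzeta (s + of_nat (i - 1)))"
      using s that by (intro sums_mult dzeta_sums) auto
    ultimately show ?thesis by (simp add: mult.commute del: of_nat_Suc)
  qed
  have split: "{..K} = insert 0 {1..K}" by auto
  have zr: "zrem K n s = (of_nat (Suc (Suc n)) powr (1 - s) - of_nat (Suc n) powr (1 - s)) -
     (\<Sum>i\<in>{1..K}. zc i s * of_nat (Suc n) powr (1 - s - of_nat i) / fact i)" for n
    unfolding zrem_def split by (subst sum.insert) (auto simp: zc_def)
  have "(\<lambda>n. zrem K n s) sums (0 - 1 - (\<Sum>i\<in>{1..K}. zc i s / fact i * dzeta (s + of_nat (i - 1))))"
    unfolding zr by (intro sums_diff[OF tele] sums_sum term_sums)
  then have "(\<Sum>n. zrem K n s) = -1 - (\<Sum>i\<in>{1..K}. zc i s / fact i * dzeta (s + of_nat (i - 1)))"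
    by (simp add: sums_iff)
  also have "{1..K} = insert 1 {2..K}" using K by auto
  also have "(\<Sum>i\<in>insert 1 {2..K}. zc i s / fact i * dzeta (s + of_nat (i - 1))) =
      (1 - s) * dzeta s + (\<Sum>i\<in>{2..K}. zc i s / fact i * dzeta (s + of_nat (i - 1)))"
    by (subst sum.insert) (auto simp: zc_def)
  also have "(\<Sum>i\<in>{2..K}. zc i s / fact i * dzeta (s + of_nat (i - 1))) =
     (\<Sum>i\<in>{2..K}. - (zc (i - 1) s / fact i * ((s + of_nat (i - 1) - 1) * dzeta (s + of_nat (i - 1)))))"
  proof (rule sum.cong[OF refl])
    fix i assume "i \<in> {2..K}"
    then obtain j where j: "i = Suc j" by (cases i) auto
    show "zc i s / fact i * dzeta (s + of_nat (i - 1)) =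
       - (zc (i - 1) s / fact i * ((s + of_nat (i - 1) - 1) * dzeta (s + of_nat (i - 1))))"
      unfolding j zc_Suc by (simp add: field_simps del: fact_Suc)
  qed
  finally have "(\<Sum>n. zrem K n s) = -1 - ((1 - s) * dzeta s + - T)"
    by (simp only: sum_negf T_def)
  then show ?thesis
    unfolding T_def[symmetric] by (simp add: algebra_simps)
qed

lemma zeta_ext_halfplane:
  "m > 0 \<Longrightarrow> \<exists>g. g holomorphic_on {s. Re s > 1 - real m} \<and>
     (\<forall>s. Re s > 1 \<longrightarrow> g s = (s - 1) * dzeta s)"
proof (induction m)
  case (Suc m)
  obtain g where g: "m > 0 \<Longrightarrow> g holomorphic_on {s. Re s > 1 - real m}"
      "m > 0 \<Longrightarrow> (\<forall>s. Re s > 1 \<longrightarrow> g s = (s - 1) * dzeta s)"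
    using Suc.IH by blast
  define h where "h s = 1 - (\<Sum>i\<in>{2..Suc m}. zc (i - 1) s / fact i * g (s + of_nat (i - 1)))
      + (\<Sum>n. zrem (Suc m) n s)" for s
  have "(\<lambda>s. g (s + of_nat (i - 1))) holomorphic_on {s. Re s > 1 - real (Suc m)}"
    if "i \<in> {2..Suc m}" for i
  proof -
    have "m > 0" using that by auto
    then have "g \<circ> (\<lambda>s. s + of_nat (i - 1)) holomorphic_on {s. Re s > 1 - real (Suc m)}"
      using that
      by (intro holomorphic_on_compose_gen[OF _ g(1)] holomorphic_intros) (auto simp: of_nat_diff)
    then show ?thesis by (simp add: o_def)
  qed
  then have "h holomorphic_on {s. Re s > 1 - real (Suc m)}"
    unfolding h_def[abs_def]
    by (intro holomorphic_intros holomorphic_suminf_zrem) auto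
  moreover have "h s = (s - 1) * dzeta s" if "Re s > 1" for s
  proof -
    have "g (s + of_nat (i - 1)) = (s + of_nat (i - 1) - 1) * dzeta (s + of_nat (i - 1))"
      if "i \<in> {2..Suc m}" for i
      using g(2) that \<open>Re s > 1\<close> by auto
    then show ?thesis
      unfolding h_def using dzeta_rec[OF that, of "Suc m"] by simp
  qed
  ultimately show ?case by blast
qed simp

lemma holomorphic_eq_from_halfplane:
  assumes "f holomorphic_on A" "g holomorphic_on A" "open A" "connected A"
    "{s. Re s > 1} \<subseteq> A" "\<And>s. Re s > 1 \<Longrightarrow> f s = g s" "s \<in> A"
  shows "f s = g s"
proof (rule analytic_continuation_open[of "{s. Re s > 1}" A f g])
  show "open {s. Re s > 1}" by (rule open_halfspace_Re_gt)
  show "{s. Re s > 1} \<noteq> {}" by (auto intro: exI[of _ 2])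
qed (use assms in auto)

theorem ex1_zeta_continuation: "\<exists>!f. is_zeta_continuation f"
proof (rule ex_ex1I)
  have "\<forall>m. \<exists>g. m > 0 \<longrightarrow> g holomorphic_on {s. Re s > 1 - real m} \<and>
      (\<forall>s. Re s > 1 \<longrightarrow> g s = (s - 1) * dzeta s)"
    using zeta_ext_halfplane by blast
  from choice[OF this] obtain g where g': "\<forall>m. m > 0 \<longrightarrow> g m holomorphic_on {s. Re s > 1 - real m} \<and>
      (\<forall>s. Re s > 1 \<longrightarrow> g m s = (s - 1) * dzeta s)" ..
  have g: "m > 0 \<Longrightarrow> g m holomorphic_on {s. Re s > 1 - real m}"
     "m > 0 \<Longrightarrow> Re s > 1 \<Longrightarrow> g m s = (s - 1) * dzeta s" for m s
    using g' by simp_all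
  define N where "N s = nat \<lceil>2 + \<bar>Re s\<bar>\<rceil>" for s
  have N: "N s > 0" "Re s > 1 - real (N s)" for s
    unfolding N_def by linarith+
  have eq: "g m s = g n s" if "m > 0" "m \<le> n" "Re s > 1 - real m" for m n s
  proof (rule holomorphic_eq_from_halfplane[of "g m" "{s. Re s > 1 - real m}" "g n" s])
    show "g m holomorphic_on {s. Re s > 1 - real m}" using that(1) by (rule g(1))
    have "n > 0" using that by simp
    then have "g n holomorphic_on {s. Re s > 1 - real n}" by (rule g(1))
    then show "g n holomorphic_on {s. Re s > 1 - real m}"
      by (rule holomorphic_on_subset) (use that in auto)
    show "open {s. Re s > 1 - real m}" by (rule open_halfspace_Re_gt)
    show "connected {s. Re s > 1 - real m}"
      by (intro convex_connected convex_halfspace_Re_gt)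
    show "{s. Re s > 1} \<subseteq> {s. Re s > 1 - real m}" by auto
    show "g m z = g n z" if "Re z > 1" for z
      using g(2)[OF \<open>m > 0\<close> that] g(2)[OF \<open>n > 0\<close> that] by simp
    show "s \<in> {s. Re s > 1 - real m}" using that by simp
  qed
  have eq': "g (N s) s = g m s" if "m > 0" "Re s > 1 - real m" for m s
  proof (cases "m \<le> N s")
    case True
    from eq[OF that(1) True that(2)] show ?thesis by simp
  next
    case False
    then show ?thesis using eq[OF N(1) _ N(2), of s m] by simp
  qed
  define f where "f s = (if s = 1 then 0 else g (N s) s / (s - 1))" for s
  have "f field_differentiable at s" if "s \<noteq> 1" for s
  proof -
    let ?A = "{z. Re z > 1 - real (N s)} - {1}"
    have "(\<lambda>z. g (N s) z / (z - 1)) holomorphic_on ?A"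
      by (intro holomorphic_on_divide holomorphic_on_diff holomorphic_on_ident holomorphic_on_const
          holomorphic_on_subset[OF g(1)[OF N(1)]]) auto
    then have "f holomorphic_on ?A"
    proof (rule holomorphic_transform)
      fix z assume z: "z \<in> ?A"
      then show "g (N s) z / (z - 1) = f z"
        using eq'[OF N(1), of s z] by (simp add: f_def)
    qed
    moreover have "open ?A" by (intro open_Diff open_halfspace_Re_gt) auto
    ultimately show ?thesis
      using that N(2)[of s] by (intro holomorphic_on_imp_differentiable_at[of f ?A]) auto
  qed
  then have "f holomorphic_on - {1}"
    unfolding holomorphic_on_def by (blast intro: field_differentiable_at_within)
  moreover have "f s = dzeta s" if "Re s > 1" for s
    using g(2)[OF N(1) that, of s] that by (auto simp: f_def)
  ultimately show "\<exists>f. is_zeta_continuation f"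
    unfolding is_zeta_continuation_def using dzeta_sums
    by (intro exI[of _ f] conjI allI impI) (simp_all add: f_def del: of_nat_Suc)
next
  fix f g assume fg: "is_zeta_continuation f" "is_zeta_continuation g"
  show "f = g"
  proof
    fix s
    show "f s = g s"
    proof (cases "s = 1")
      case False
      show ?thesis
      proof (rule holomorphic_eq_from_halfplane[of f "- {1}" g s])
        show "connected (- {1 :: complex})"
          by (simp add: connected_punctured_universe)
      qed (use fg False in \<open>auto simp: is_zeta_continuation_def intro: sums_unique2\<close>)
    qed (use fg in \<open>auto simp: is_zeta_continuation_def\<close>)
  qed
qed

corollary is_zeta_continuation_zeta: "is_zeta_continuation zeta"
  unfolding zeta_def by (rule theI'[OF ex1_zeta_continuation])

end

theory Submission
  imports Defs
begin

text \<open>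
  The Mellin transform of \<open>Phi\<close> is \<open>Gamma s / zeta s\<close> for real \<open>s > 1\<close>. If \<open>Phi\<close> lies in all
  \<open>L\<^sup>p\<close> with \<open>p < 2\<close>, Young's inequality makes this transform converge, hence holomorphic, on
  \<open>Re s > 1/2\<close>, so \<open>zeta\<close> has no zero there; the functional equation (Mellin transform of the partial
  fractions of \<open>coth\<close>) excludes nontrivial zeros with \<open>Re s < 1/2\<close>.

  Conversely, on the Riemann hypothesis the Borel--Caratheodory inequality applied to a logarithm of
  \<open>(s - 1) * zeta s\<close> bounds \<open>1 / zeta\<close> polynomially on \<open>Re s \<ge> a > 1/2\<close>. As \<open>Gamma\<close> decays faster than
  any power on vertical lines, the inverse Mellin integral of \<open>Gamma s / zeta s\<close> can be moved from
  \<open>Re s = 2\<close> to \<open>Re s = a\<close>, which gives \<open>Phi t = O(t powr -a)\<close> as \<open>t\<close> tends to 0.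
\<close>

section \<open>Zeta without its pole, and the Moebius series\<close>

text \<open>The value 1/2 comes from one exchange of exponents: \<open>t powr (-a)\<close> is
  p-integrable at 0 exactly when a * p < 1, and conversely p-integrability (p > 1) makes the Mellin
  transform converge to the right of 1/p. Letting p tend to 2 corresponds to a tending to 1/2. Large
  t cost nothing, as \<open>Phi\<close> decays like \<open>exp (-t)\<close>. Absence of zeros alone
  only makes 1/zeta holomorphic, whereas moving a contour also needs its growth along the horizontal
  sides. A logarithm turns the easy upper bound for |zeta| into an upper bound for a real part, and
  this controls the whole logarithm, hence 1/zeta. The exponent obtained is unspecified, but Gamma
  absorbs any power. \<open>Riemann_Hypothesis\<close> speaks of all zeros except the trivial ones,
  not only of those in the critical strip. The functional equation must therefore reach the whole
  left half-plane, and the point 0, where sin (pi * s / 2) vanishes without a zero of zeta, needs a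
  separate evaluation. Identities to be continued are written without poles (\<open>pzeta\<close>,
  \<open>rGamma\<close>), so that each can be checked on a real interval.\<close>

lemma zeta_sums: "Re s > 1 \<Longrightarrow> (\<lambda>n. 1 / of_nat (Suc n) powr s) sums zeta s"
  using is_zeta_continuation_zeta by (simp add: is_zeta_continuation_def del: of_nat_Suc)

lemma holomorphic_zeta: "zeta holomorphic_on - {1}"
  using is_zeta_continuation_zeta by (simp add: is_zeta_continuation_def)

text \<open>The value at 1 fills a removable singularity: zeta has residue 1 there, which
  \<open>zeta\<close> itself, pinned to 0 at 1, does not show.\<close>

definition pzeta :: "complex \<Rightarrow> complex" where
  "pzeta s = (if s = 1 then 1 else (s - 1) * zeta s)"

lemma pzeta_1 [simp]: "pzeta 1 = 1"
  by (simp add: pzeta_def)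

text \<open>The case \<open>K = 1\<close> of \<open>dzeta_rec\<close>, whose sum over
  \<open>{2..K}\<close> is empty, continued to Re s > 0. The series is holomorphic also at 1, and it
  gives the growth of \<open>pzeta\<close>.\<close>

lemma pzeta_eq_suminf_zrem:
  assumes "Re s > 0"
  shows "pzeta s = 1 + (\<Sum>n. zrem 1 n s)"
proof (cases "s = 1")
  case True
  \<comment> \<open>The remainder bound contains \<open>zc 2 1\<close>, whose first factor 1 - s
    vanishes at s = 1.\<close>
  have "zrem 1 n 1 = 0" for n
    using norm_zrem_le[of 1 1 n] by (simp add: zc_def)
  then show ?thesis using True by simp
next
  case False
  let ?A = "{s. Re s > 0} - {1::complex}"
  have "(s - 1) * zeta s = 1 + (\<Sum>n. zrem 1 n s)"
  proof (rule holomorphic_eq_from_halfplane[where A = ?A and f = "\<lambda>s. (s - 1) * zeta s"])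
    show "(\<lambda>s. (s - 1) * zeta s) holomorphic_on ?A"
      by (intro holomorphic_intros holomorphic_on_subset[OF holomorphic_zeta]) auto
    show "(\<lambda>s. 1 + (\<Sum>n. zrem 1 n s)) holomorphic_on ?A"
      by (intro holomorphic_intros holomorphic_on_subset[OF holomorphic_suminf_zrem[of 1]]) auto
    show "open ?A" by (intro open_Diff open_halfspace_Re_gt) auto
    show "connected ?A"
      by (intro connected_open_delete open_halfspace_Re_gt convex_connected convex_halfspace_Re_gt) auto
    fix z :: complex assume z: "Re z > 1"
    have "zeta z = dzeta z"
      using zeta_sums[OF z] dzeta_sums[OF z] by (rule sums_unique2)
    then show "(z - 1) * zeta z = 1 + (\<Sum>n. zrem 1 n z)"
      using dzeta_rec[OF z, of 1] by simp
  qed (use assms False in auto)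
  then show ?thesis using False by (simp add: pzeta_def)
qed

text \<open>Two open sets cover the plane: Re s > 0, where the series takes care of the point 1, and
  the complement of 1, where \<open>zeta\<close> is holomorphic.\<close>

lemma holomorphic_pzeta: "pzeta holomorphic_on A"
proof -
  have "pzeta holomorphic_on ({s. Re s > 0} \<union> - {1})"
  proof (rule holomorphic_on_Un)
    have "(\<lambda>s. 1 + (\<Sum>n. zrem 1 n s)) holomorphic_on {s. Re s > 0}"
      by (intro holomorphic_intros holomorphic_on_subset[OF holomorphic_suminf_zrem[of 1]]) auto
    then show "pzeta holomorphic_on {s. Re s > 0}"
      by (rule holomorphic_transform) (simp add: pzeta_eq_suminf_zrem)
    have "(\<lambda>s. (s - 1) * zeta s) holomorphic_on - {1}"
      by (intro holomorphic_intros holomorphic_zeta)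
    then show "pzeta holomorphic_on - {1}"
      by (rule holomorphic_transform) (auto simp: pzeta_def)
  qed (auto simp: open_halfspace_Re_gt)
  then show ?thesis by (rule holomorphic_on_subset) auto
qed

lemma holomorphic_pzeta' [holomorphic_intros]:
  "f holomorphic_on A \<Longrightarrow> (\<lambda>s. pzeta (f s)) holomorphic_on A"
  using holomorphic_on_compose[of f A pzeta, OF _ holomorphic_pzeta] by (simp add: o_def)

text \<open>The square comes from \<open>zc 2 s\<close>, which is (1 - s) * (-s), in the remainder
  estimate. The abscissa 1/4 is a choice in (0, 1/2): positive for convergence of the dominating
  series, small enough to cover Re s > 1/2.\<close>

lemma norm_pzeta_le:
  obtains C where "C > 0" "\<And>s. Re s \<ge> 1/4 \<Longrightarrow> norm (pzeta s) \<le> C * (1 + norm s) ^ 2"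
proof -
  define S where "S = (\<Sum>n. real (Suc n) powr (-5/4))"
  have sm: "summable (\<lambda>n. real (Suc n) powr (-5/4))"
    by (rule summable_Suc_powr) simp
  have S0: "S \<ge> 0" unfolding S_def by (intro suminf_nonneg sm) auto
  show thesis
  proof (rule that[of "1 + S"])
    show "1 + S > 0" using S0 by simp
    fix s :: complex assume s: "Re s \<ge> 1/4"
    let ?c = "norm (zc 2 s)"
    have le: "norm (zrem 1 n s) \<le> ?c * real (Suc n) powr (-5/4)" for n
    proof -
      have "norm (zrem 1 n s) \<le> ?c * real (Suc n) powr (- Re s - 1)"
        using norm_zrem_le[of s 1 n] s by (simp add: numeral_2_eq_2)
      also have "\<dots> \<le> ?c * real (Suc n) powr (-5/4)"
        using s by (intro mult_left_mono powr_mono) auto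
      finally show ?thesis .
    qed
    have "norm (\<Sum>n. zrem 1 n s) \<le> (\<Sum>n. ?c * real (Suc n) powr (-5/4))"
      using le sm by (intro norm_suminf_le summable_mult)
    also have "\<dots> = ?c * S" unfolding S_def by (intro suminf_mult sm)
    finally have "norm (pzeta s) \<le> 1 + ?c * S"
      using norm_triangle_ineq[of 1 "\<Sum>n. zrem 1 n s"] s by (simp add: pzeta_eq_suminf_zrem)
    moreover have "?c \<le> (1 + norm s) * (1 + norm s)"
    proof -
      have "?c = norm (1 - s) * norm s"
        by (simp add: zc_def numeral_2_eq_2 norm_mult)
      also have "\<dots> \<le> (1 + norm s) * (1 + norm s)"
        using norm_triangle_ineq4[of 1 s] by (intro mult_mono) auto
      finally show ?thesis .
    qed
    then have "?c * S \<le> S * (1 + norm s) ^ 2"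
      using S0 by (simp add: power2_eq_square mult.commute mult_left_mono)
    moreover have "1 \<le> (1 + norm s) ^ 2" by (rule one_le_power) auto
    ultimately show "norm (pzeta s) \<le> (1 + S) * (1 + norm s) ^ 2"
      unfolding distrib_right mult_1 by linarith
  qed
qed

section \<open>The Moebius function and the Dirichlet series of 1/zeta\<close>

lemma abs_moebius_le: "\<bar>moebius n\<bar> \<le> 1"
  by (simp add: moebius_def power_abs)

text \<open>Adjoining a fixed element pairs the subsets without it with those containing it, with
  opposite signs.\<close>

lemma sum_Pow_minus_one_power_card:
  "finite P \<Longrightarrow> (\<Sum>Q\<in>Pow P. (-1) ^ card Q) = (if P = {} then 1 else (0::int))"
proof (induction P rule: finite_induct)
  case (insert x P)
  have "(\<Sum>Q\<in>Pow (insert x P). (-1) ^ card Q) =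
     (\<Sum>Q\<in>Pow P. (-1) ^ card Q) + (\<Sum>Q\<in>insert x ` Pow P. (-1::int) ^ card Q)"
    unfolding Pow_insert using insert by (intro sum.union_disjoint) auto
  also have "(\<Sum>Q\<in>insert x ` Pow P. (-1) ^ card Q) = (\<Sum>Q\<in>Pow P. (-1::int) ^ card (insert x Q))"
    using insert by (subst sum.reindex) (auto simp: inj_on_def)
  also have "\<dots> = (\<Sum>Q\<in>Pow P. - ((-1) ^ card Q))"
  proof (rule sum.cong[OF refl])
    fix Q assume "Q \<in> Pow P"
    then have "x \<notin> Q" "finite Q" using insert finite_subset by auto
    then show "(-1::int) ^ card (insert x Q) = - ((-1) ^ card Q)" by simp
  qed
  finally show ?case by (simp add: sum_negf)
qed simp

text \<open>Only squarefree divisors contribute, and taking products identifies them with the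
  subsets of the set of prime factors, so an alternating sum over a power set remains.\<close>

lemma sum_moebius_divisors:
  assumes "n > 0"
  shows "(\<Sum>d | d dvd n. moebius d) = (if n = 1 then 1 else 0)"
proof -
  define P where "P = prime_factors n"
  have fin: "finite P" by (simp add: P_def)
  have "(\<Sum>d | d dvd n. moebius d) = (\<Sum>d | d dvd n \<and> squarefree d. (-1) ^ card (prime_factors d))"
    using assms by (intro sum.mono_neutral_cong_right) (auto simp: moebius_def)
  also have "\<dots> = (\<Sum>Q\<in>Pow P. (-1) ^ card Q)"
  proof (rule sum.reindex_bij_witness[of _ "\<lambda>Q. \<Prod>Q" "prime_factors"])
    fix d assume d: "d \<in> {d. d dvd n \<and> squarefree d}"
    then have "d \<noteq> 0" using assms by auto
    show "\<Prod>(prime_factors d) = d"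
    proof -
      have "\<Prod>(prime_factors d) = (\<Prod>p\<in>prime_factors d. p ^ multiplicity p d)"
        using d \<open>d \<noteq> 0\<close> by (intro prod.cong) (auto simp: squarefree_factorial_semiring')
      also have "\<dots> = d" using \<open>d \<noteq> 0\<close> by (simp add: prod_prime_factors)
      finally show ?thesis .
    qed
    show "prime_factors d \<in> Pow P" using d assms \<open>d \<noteq> 0\<close>
      by (auto simp: P_def in_prime_factors_iff)
  next
    fix Q assume Q: "Q \<in> Pow P"
    have pr: "prime p" if "p \<in> Q" for p using Q that by (auto simp: P_def)
    have finQ: "finite Q" using Q fin finite_subset by auto
    have "prime_factors (prod (\<lambda>x. x) Q) = \<Union> ((prime_factors \<circ> (\<lambda>x. x)) ` Q)"
      using finQ pr[of 0] by (intro prime_factors_prod) auto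
    also have "\<dots> = Q" using pr by (auto simp: prime_prime_factors)
    finally show "prime_factors (\<Prod>Q) = Q" .
    have "\<Prod>Q dvd \<Prod>P"
      using Q fin by (intro prod_dvd_prod_subset) auto
    also have "\<dots> dvd (\<Prod>p\<in>P. p ^ multiplicity p n)"
      using assms by (intro prod_dvd_prod) (auto simp: P_def prime_factors_multiplicity dvd_power)
    also have "\<dots> = n" using assms by (simp add: prod_prime_factors P_def)
    finally have "\<Prod>Q dvd n" .
    moreover have "squarefree (\<Prod>Q)"
      using pr by (intro squarefree_prod_coprime) (auto intro: primes_coprime squarefree_prime)
    ultimately show "\<Prod>Q \<in> {d. d dvd n \<and> squarefree d}" by simp
  qed auto
  also have "\<dots> = (if P = {} then 1 else 0)"
    using fin by (rule sum_Pow_minus_one_power_card)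
  also have "P = {} \<longleftrightarrow> n = 1"
    using assms by (auto simp: P_def prime_factorization_empty_iff)
  finally show ?thesis .
qed

lemma summable_norm_moebius_powr:
  assumes "Re s > 1"
  shows "summable (\<lambda>n. norm (of_int (moebius (Suc n)) / of_nat (Suc n) powr s :: complex))"
proof (rule summable_comparison_test)
  show "summable (\<lambda>n. real (Suc n) powr (- Re s))"
    using assms by (intro summable_Suc_powr) auto
  have "real_of_int \<bar>moebius (Suc n)\<bar> \<le> 1" for n
    using abs_moebius_le[of "Suc n"] by linarith
  then show "\<exists>N. \<forall>n\<ge>N. norm (norm (of_int (moebius (Suc n)) / of_nat (Suc n) powr s :: complex))
      \<le> real (Suc n) powr (- Re s)"
    by (auto simp: norm_divide norm_Suc_powr powr_minus_divide divide_right_mono simp del: of_nat_Suc)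
qed

text \<open>Absolute convergence permits regrouping the product of the two series by n = d * k. The
  inner sums are divisor sums of \<open>moebius\<close>, so only n = 1 survives and the product is
  1, which also rules out a zero.\<close>

theorem moebius_sums_inverse_zeta:
  assumes s: "Re s > 1"
  shows "zeta s \<noteq> 0"
    and "(\<lambda>n. of_int (moebius (Suc n)) / of_nat (Suc n) powr s) sums (1 / zeta s)"
proof -
  define u where "u n = (of_int (moebius (Suc n)) / of_nat (Suc n) powr s :: complex)" for n
  define v where "v n = (1 / of_nat (Suc n) powr s :: complex)" for n
  define D where "D = suminf u"
  have norm_v: "norm (v n) = real (Suc n) powr (- Re s)" for n
    by (simp add: v_def norm_divide norm_Suc_powr powr_minus_divide del: of_nat_Suc)
  have sv: "summable (\<lambda>n. norm (v n))"
    unfolding norm_v using s by (intro summable_Suc_powr) auto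
  have su: "summable (\<lambda>n. norm (u n))"
    unfolding u_def using s by (rule summable_norm_moebius_powr)
  have usums: "u sums D"
    unfolding D_def by (rule summable_sums[OF summable_norm_cancel[OF su]])
  have v: "(v has_sum zeta s) UNIV"
    using sv zeta_sums[OF s] unfolding v_def by (rule norm_summable_imp_has_sum)
  have u: "(u has_sum D) UNIV"
    using su usums by (rule norm_summable_imp_has_sum)
  have absv: "(\<lambda>n. norm (v n)) summable_on UNIV" and absu: "(\<lambda>n. norm (u n)) summable_on UNIV"
    using sv su by (auto simp: summable_on_UNIV_nonneg_real_iff)
  have "((\<lambda>(d, k). u d * v k) has_sum (D * zeta s)) (UNIV \<times> UNIV)"
  proof (rule has_sum_SigmaI)
    show "((\<lambda>k. case (d, k) of (d, k) \<Rightarrow> u d * v k) has_sum (u d * zeta s)) UNIV" for d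
      using v by (simp add: has_sum_cmult_right)
    show "((\<lambda>d. u d * zeta s) has_sum (D * zeta s)) UNIV"
      using u by (rule has_sum_cmult_left)
    have "(\<lambda>x. norm (case x of (d, k) \<Rightarrow> u d * v k)) summable_on (UNIV \<times> UNIV)"
      unfolding Infinite_Sum.abs_summable_on_Sigma_iff
      using absv absu by (auto simp: norm_mult infsum_cmult_right' abs_mult infsum_nonneg summable_on_cmult_right summable_on_cmult_left)
    then show "(\<lambda>(d, k). u d * v k) summable_on (UNIV \<times> UNIV)"
      by (rule abs_summable_summable)
  qed
  also have "?this \<longleftrightarrow> ((\<lambda>(n, d). of_int (moebius d) / of_nat (Suc n) powr s) has_sum (D * zeta s))
      (SIGMA n:UNIV. {d. d dvd Suc n})"
  \<comment> \<open>Series index n stands for the integer n + 1. In the target pairs the first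
    component keeps this shift, while the second is the divisor itself.\<close>
  proof (rule has_sum_reindex_bij_witness[where j = "\<lambda>(d, k). (Suc d * Suc k - 1, Suc d)"
      and i = "\<lambda>(n, d). (d - 1, Suc n div d - 1)"])
    fix a :: "nat \<times> nat"
    obtain d k where a: "a = (d, k)" by force
    have m: "Suc (Suc d * Suc k - 1) = Suc d * Suc k" by simp
    have q: "Suc d * Suc k div Suc d = Suc k"
      by (rule nonzero_mult_div_cancel_left) simp
    have "of_nat (Suc d * Suc k) powr s = (of_nat (Suc d) powr s * of_nat (Suc k) powr s :: complex)"
      unfolding of_nat_mult by (subst powr_times_real) (auto simp del: of_nat_Suc)
    then show "(case case a of (d, k) \<Rightarrow> (Suc d * Suc k - 1, Suc d) of
             (n, d) \<Rightarrow> of_int (moebius d) / of_nat (Suc n) powr s) = (case a of (d, k) \<Rightarrow> u d * v k)"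
      unfolding a prod.case m u_def v_def by simp
    show "(case case a of (d, k) \<Rightarrow> (Suc d * Suc k - 1, Suc d) of (n, d) \<Rightarrow> (d - 1, Suc n div d - 1)) = a"
      unfolding a prod.case m q by simp
    show "(case a of (d, k) \<Rightarrow> (Suc d * Suc k - 1, Suc d)) \<in> (SIGMA n:UNIV. {d. d dvd Suc n})"
      unfolding a prod.case mem_Sigma_iff m by (simp del: mult_Suc mult_Suc_right)
  next
    fix b assume b: "b \<in> (SIGMA n:UNIV. {d. d dvd Suc n})"
    then obtain n d where nd: "b = (n, d)" "d dvd Suc n" by auto
    then obtain k where k: "Suc n = d * k" by (auto elim: dvdE)
    then have "d > 0" "k > 0" by (auto intro!: Nat.gr0I)
    then show "(case case b of (n, d) \<Rightarrow> (d - 1, Suc n div d - 1) of (d, k) \<Rightarrow> (Suc d * Suc k - 1, Suc d)) = b"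
      unfolding nd prod.case using k by simp
  qed auto
  finally have "((\<lambda>n. if n = 0 then 1 else 0) has_sum (D * zeta s)) (UNIV :: nat set)"
  proof (rule has_sum_SigmaD)
    fix n :: nat
    have "((\<lambda>d. of_int (moebius d) / of_nat (Suc n) powr s) has_sum
        (\<Sum>d | d dvd Suc n. of_int (moebius d) / of_nat (Suc n) powr s :: complex)) {d. d dvd Suc n}"
      by (intro has_sum_finite) auto
    also have "(\<Sum>d | d dvd Suc n. of_int (moebius d) / of_nat (Suc n) powr s) =
        (of_int (\<Sum>d | d dvd Suc n. moebius d) / of_nat (Suc n) powr s :: complex)"
      by (simp add: sum_divide_distrib)
    also have "\<dots> = (if n = 0 then 1 else 0)"
      by (simp add: sum_moebius_divisors)
    finally show "((\<lambda>d. case (n, d) of (n, d) \<Rightarrow> of_int (moebius d) / of_nat (Suc n) powr s) has_sum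
        (if n = 0 then 1 else 0 :: complex)) {d. d dvd Suc n}" by simp
  qed
  then have "(\<lambda>n. if n = 0 then 1 else 0) sums (D * zeta s)"
    by (rule has_sum_imp_sums)
  then have 1: "D * zeta s = 1"
    using sums_single[of 0 "\<lambda>_. 1 :: complex"] sums_unique2 by (metis (mono_tags, lifting))
  then show nz: "zeta s \<noteq> 0" by auto
  show "(\<lambda>n. of_int (moebius (Suc n)) / of_nat (Suc n) powr s) sums (1 / zeta s)"
    using usums 1 nz unfolding u_def by (metis nonzero_eq_divide_eq)
qed

section \<open>Mellin transforms\<close>

lemma norm_exp_minus_1_le: "norm (exp z - 1 :: complex) \<le> norm z * exp (norm z)"
proof -
  have "norm (exp z - exp 0) \<le> exp (norm z) * norm (z - 0)"
  proof (rule field_differentiable_bound[where S = "cball 0 (norm z)" and f' = exp])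
    show "(exp has_field_derivative exp w) (at w within cball 0 (norm z))" for w :: complex
      by (auto intro!: derivative_eq_intros)
    show "norm (exp w) \<le> exp (norm z)" if "w \<in> cball 0 (norm z)" for w :: complex
      using that complex_Re_le_cmod[of w] by (simp add: norm_exp_eq_Re)
  qed auto
  then show ?thesis by (simp add: mult.commute)
qed

text \<open>The logarithm produced by differentiating in s is paid for by doubling the exponent
  \<open>d\<close>, through u \<le> exp u at u = d * |ln t|. The two powers cover t > 1 and t <
  1.\<close>

lemma abs_ln_mult_exp_abs_ln_le:
  assumes "t > 0" "d > 0"
  shows "\<bar>ln t\<bar> * exp (d * \<bar>ln t\<bar>) \<le> (t powr (2 * d) + t powr (- 2 * d)) / (d::real)"
proof -
  have "d * \<bar>ln t\<bar> \<le> exp (d * \<bar>ln t\<bar>)"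
    using exp_ge_add_one_self[of "d * \<bar>ln t\<bar>"] by linarith
  then have "d * \<bar>ln t\<bar> * exp (d * \<bar>ln t\<bar>) \<le> exp (d * \<bar>ln t\<bar>) * exp (d * \<bar>ln t\<bar>)"
    by (intro mult_right_mono) auto
  also have "\<dots> = exp (2 * d * \<bar>ln t\<bar>)" by (simp add: exp_add[symmetric])
  also have "\<dots> \<le> t powr (2 * d) + t powr (- 2 * d)"
    using assms by (cases "ln t \<ge> 0") (auto simp: powr_def)
  finally show ?thesis using assms by (simp add: field_simps)
qed

definition mellin :: "(real \<Rightarrow> real) \<Rightarrow> complex \<Rightarrow> complex" where
  "mellin f s = (LBINT t:{0<..}. of_real (f t) * of_real t powr (s - 1))"

text \<open>Absolute convergence depends only on the real part of the argument, so it is a condition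
  on one real abscissa.\<close>

definition mellin_conv :: "(real \<Rightarrow> real) \<Rightarrow> real \<Rightarrow> bool" where
  "mellin_conv f x \<longleftrightarrow> set_integrable lborel {0<..} (\<lambda>t. f t * t powr (x - 1))"

lemma borel_measurable_powr_real_complex [measurable]:
  "(\<lambda>t. complex_of_real t powr s) \<in> borel_measurable borel"
  unfolding powr_def by measurable

lemma mellin_integrable:
  assumes [measurable]: "f \<in> borel_measurable borel" and "mellin_conv f (Re s)"
  shows "set_integrable lborel {0<..} (\<lambda>t. complex_of_real (f t) * of_real t powr (s - 1))"
proof (rule set_integrable_bound)
  show "set_integrable lborel {0<..} (\<lambda>t. f t * t powr (Re s - 1))"
    using assms by (simp add: mellin_conv_def)
  show "set_borel_measurable lborel {0<..} (\<lambda>t. complex_of_real (f t) * of_real t powr (s - 1))"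
    unfolding set_borel_measurable_def by measurable
qed (auto simp: norm_mult norm_powr_real_powr abs_mult)

text \<open>Differentiation under the integral sign: dominated convergence of difference quotients,
  the dominating function being built from the integrands at the abscissas
  \<open>Re s + 2 * d\<close> and \<open>Re s - 2 * d\<close>.\<close>

lemma mellin_has_field_derivative:
  assumes [measurable]: "f \<in> borel_measurable borel"
    and d: "d > 0" and conv: "\<And>x. \<bar>x - Re s\<bar> \<le> 2 * d \<Longrightarrow> mellin_conv f x"
  shows "(mellin f has_field_derivative
     (LBINT t:{0<..}. of_real (f t) * (of_real t powr (s - 1) * of_real (ln t)))) (at s)"
proof -
  define F where "F z t = indicator {0<..} t *\<^sub>R (complex_of_real (f t) * of_real t powr (z - 1))" for z t
  define G where "G t = indicator {0<..} t *\<^sub>R (complex_of_real (f t) * (of_real t powr (s - 1) * of_real (ln t)))" for t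
  \<comment> \<open>Both summands have the sign of \<open>f t\<close>, so the norm of
    \<open>W t\<close> is the sum of their absolute values.\<close>
  define W where "W t = (indicator {0<..} t *\<^sub>R (f t * t powr (Re s + 2 * d - 1))) / d
      + (indicator {0<..} t *\<^sub>R (f t * t powr (Re s - 2 * d - 1))) / d" for t
  have int_F: "integrable lborel (F z)" if "z \<in> ball s d" for z
  proof -
    have "\<bar>Re z - Re s\<bar> \<le> d" using that abs_Re_le_cmod[of "s - z"] by (auto simp: dist_norm)
    then have "mellin_conv f (Re z)" using d by (intro conv) auto
    then show ?thesis using mellin_integrable[of f z] unfolding F_def set_integrable_def by simp
  qed
  have int_W: "integrable lborel W"
    unfolding W_def using conv[of "Re s + 2 * d"] conv[of "Re s - 2 * d"] d
    by (intro Bochner_Integration.integrable_add integrable_divide)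
       (auto simp: mellin_conv_def set_integrable_def)
  have [measurable]: "F z \<in> borel_measurable borel" "G \<in> borel_measurable borel" for z
    unfolding F_def[abs_def] G_def[abs_def] by measurable
  have M: "mellin f z = integral\<^sup>L lborel (F z)" for z
    by (simp add: mellin_def F_def[abs_def] set_lebesgue_integral_def)
  have bound: "norm ((F z t - F s t) / (z - s)) \<le> norm (W t)" if z: "z \<in> ball s d - {s}" for z t
  proof (cases "t > 0")
    case True
    have nz: "norm (z - s) \<le> d" "norm (z - s) > 0" using z by (auto simp: dist_norm norm_minus_commute)
    let ?L = "(z - s) * of_real (ln t)"
    have "of_real t powr (z - 1) = of_real t powr (s - 1) * exp ?L"
      using True by (auto simp: powr_def exp_add[symmetric] Ln_of_real algebra_simps)
    then have eq: "F z t - F s t = of_real (f t) * of_real t powr (s - 1) * (exp ?L - 1)"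
      using True by (simp add: F_def algebra_simps)
    have "norm (exp ?L - 1) \<le> norm ?L * exp (norm ?L)" by (rule norm_exp_minus_1_le)
    also have "\<dots> = norm (z - s) * (\<bar>ln t\<bar> * exp (norm (z - s) * \<bar>ln t\<bar>))"
      by (simp add: norm_mult)
    also have "\<dots> \<le> norm (z - s) * (\<bar>ln t\<bar> * exp (d * \<bar>ln t\<bar>))"
      using nz by (intro mult_left_mono) (auto intro!: mult_right_mono)
    also have "\<dots> \<le> norm (z - s) * ((t powr (2 * d) + t powr (- 2 * d)) / d)"
      using True d by (intro mult_left_mono abs_ln_mult_exp_abs_ln_le) auto
    finally have "norm (exp ?L - 1) / norm (z - s) \<le> (t powr (2 * d) + t powr (- 2 * d)) / d"
      using nz by (subst pos_divide_le_eq) (simp_all add: mult.commute)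
    then have "\<bar>f t\<bar> * t powr (Re s - 1) * (norm (exp ?L - 1) / norm (z - s)) \<le>
       \<bar>f t\<bar> * t powr (Re s - 1) * ((t powr (2 * d) + t powr (- 2 * d)) / d)"
      by (intro mult_left_mono) auto
    also have "\<dots> = (\<bar>f t\<bar> * t powr (Re s + 2 * d - 1) + \<bar>f t\<bar> * t powr (Re s - 2 * d - 1)) / d"
    proof -
      have "t powr (Re s + 2 * d - 1) = t powr (Re s - 1) * t powr (2 * d)"
        "t powr (Re s - 2 * d - 1) = t powr (Re s - 1) * t powr (- 2 * d)"
        by (simp_all add: powr_add[symmetric] algebra_simps)
      then show ?thesis by (simp add: algebra_simps add_divide_distrib)
    qed
    also have "\<dots> = \<bar>f t * t powr (Re s + 2 * d - 1) + f t * t powr (Re s - 2 * d - 1)\<bar> / d"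
      by (simp add: distrib_left[symmetric] abs_mult)
    also have "\<dots> = norm (W t)"
      using True d by (simp add: W_def add_divide_distrib[symmetric])
    finally show ?thesis
      using True unfolding eq by (simp add: norm_mult norm_divide norm_powr_real_powr)
  qed (simp add: F_def)
  have "((\<lambda>z. (mellin f z - mellin f s) / (z - s)) \<longlongrightarrow> integral\<^sup>L lborel G) (at s within ball s d)"
    unfolding tendsto_at_iff_sequentially comp_def
  proof safe
    fix X assume X: "\<forall>i. X i \<in> ball s d - {s}" "X \<longlonglongrightarrow> s"
    have "(\<lambda>n. integral\<^sup>L lborel (\<lambda>t. (F (X n) t - F s t) / (X n - s))) \<longlonglongrightarrow> integral\<^sup>L lborel G"
    proof (rule integral_dominated_convergence)
      show "integrable lborel (\<lambda>t. norm (W t))" using int_W by (rule integrable_norm)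
      show "AE t in lborel. (\<lambda>n. (F (X n) t - F s t) / (X n - s)) \<longlonglongrightarrow> G t"
      proof (rule AE_I2)
        fix t :: real
        have "((\<lambda>z. F z t) has_field_derivative G t) (at s within ball s d)"
        proof (cases "t > 0")
          case True
          then show ?thesis unfolding F_def G_def powr_def
            by (auto intro!: derivative_eq_intros simp: Ln_of_real mult_ac)
        qed (simp add: F_def G_def)
        then show "(\<lambda>n. (F (X n) t - F s t) / (X n - s)) \<longlonglongrightarrow> G t"
          unfolding has_field_derivative_iff tendsto_at_iff_sequentially comp_def using X by blast
      qed
      show "AE t in lborel. norm ((F (X n) t - F s t) / (X n - s)) \<le> norm (W t)" for n
        using bound X by (intro AE_I2) blast
    qed auto
    moreover have "integral\<^sup>L lborel (\<lambda>t. (F (X n) t - F s t) / (X n - s)) =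
        (mellin f (X n) - mellin f s) / (X n - s)" for n
    proof -
      have "integral\<^sup>L lborel (\<lambda>t. F (X n) t - F s t) = mellin f (X n) - mellin f s"
        unfolding M using X d by (intro Bochner_Integration.integral_diff int_F) auto
      then show ?thesis by simp
    qed
    ultimately show "(\<lambda>n. (mellin f (X n) - mellin f s) / (X n - s)) \<longlonglongrightarrow> integral\<^sup>L lborel G"
      by (simp only:)
  qed
  then have "(mellin f has_field_derivative integral\<^sup>L lborel G) (at s within ball s d)"
    by (simp add: has_field_derivative_iff)
  then have "(mellin f has_field_derivative integral\<^sup>L lborel G) (at s)"
    using d by (simp add: at_within_open[of s "ball s d"])
  then show ?thesis by (simp add: G_def[abs_def] set_lebesgue_integral_def)
qed

lemma holomorphic_mellin:
  assumes f: "f \<in> borel_measurable borel" and X: "open X" and conv: "\<And>x. x \<in> X \<Longrightarrow> mellin_conv f x"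
  shows "mellin f holomorphic_on {s. Re s \<in> X}"
  unfolding holomorphic_on_def
proof safe
  fix s assume s: "Re s \<in> X"
  with X obtain e where e: "e > 0" "cball (Re s) e \<subseteq> X" by (meson open_contains_cball)
  have "(mellin f has_field_derivative
     (LBINT t:{0<..}. of_real (f t) * (of_real t powr (s - 1) * of_real (ln t)))) (at s)"
    using e by (intro mellin_has_field_derivative[OF f, of "e/2"] conv) (auto simp: dist_real_def)
  then show "mellin f field_differentiable at s within {s. Re s \<in> X}"
    using field_differentiable_def field_differentiable_at_within by blast
qed

lemma mellin_of_real:
  "mellin f (of_real x) = of_real (LBINT t:{0<..}. f t * t powr (x - 1))"
proof -
  have "mellin f (of_real x) = (LBINT t:{0<..}. complex_of_real (f t * t powr (x - 1)))"
    unfolding mellin_def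
    by (intro set_lebesgue_integral_cong) (auto simp: powr_of_real[symmetric])
  then show ?thesis by (simp only: set_integral_complex_of_real)
qed

section \<open>Gamma integrals and partial fractions of the hyperbolic cotangent\<close>

text \<open>For nonnegative integrands, integrability and value are read off together from one
  computation with extended reals, where series and iterated integrals can be exchanged
  freely.\<close>

lemma nn_integral_imp_set_integral:
  fixes f :: "real \<Rightarrow> real"
  assumes [measurable]: "f \<in> borel_measurable borel" "A \<in> sets borel"
    and "\<And>t. t \<in> A \<Longrightarrow> f t \<ge> 0" and "r \<ge> 0"
    and "(\<integral>\<^sup>+t. ennreal (indicator A t * f t) \<partial>lborel) = ennreal r"
  shows "set_integrable lborel A f" "(LBINT t:A. f t) = r"
proof -
  have "integrable lborel (\<lambda>t. indicator A t *\<^sub>R f t) \<and> integral\<^sup>L lborel (\<lambda>t. indicator A t *\<^sub>R f t) = r"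
    using assms by (subst nn_integral_eq_integrable[symmetric]) (auto simp: indicator_def)
  then show "set_integrable lborel A f" "(LBINT t:A. f t) = r"
    by (auto simp: set_integrable_def set_lebesgue_integral_def)
qed

lemma nn_integral_sums:
  fixes f :: "nat \<Rightarrow> real \<Rightarrow> real"
  assumes [measurable]: "\<And>n. f n \<in> borel_measurable borel" "A \<in> sets borel"
    and nonneg: "\<And>n t. t \<in> A \<Longrightarrow> f n t \<ge> 0" and F: "\<And>t. t \<in> A \<Longrightarrow> (\<lambda>n. f n t) sums F t"
    and a: "\<And>n. (\<integral>\<^sup>+t. ennreal (indicator A t * f n t) \<partial>lborel) = ennreal (a n)"
    and "\<And>n. a n \<ge> 0" and S: "a sums S"
  shows "(\<integral>\<^sup>+t. ennreal (indicator A t * F t) \<partial>lborel) = ennreal S"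
proof -
  have "(\<integral>\<^sup>+t. ennreal (indicator A t * F t) \<partial>lborel) =
      (\<integral>\<^sup>+t. (\<Sum>n. ennreal (indicator A t * f n t)) \<partial>lborel)"
  proof (rule nn_integral_cong)
    fix t
    have "(\<lambda>n. indicator A t * f n t) sums (indicator A t * F t)"
      using F[of t] by (cases "t \<in> A") auto
    then show "ennreal (indicator A t * F t) = (\<Sum>n. ennreal (indicator A t * f n t))"
      using nonneg by (subst suminf_ennreal_eq) (auto simp: indicator_def)
  qed
  also have "\<dots> = (\<Sum>n. ennreal (a n))"
    by (subst nn_integral_suminf) (auto simp: a)
  also have "\<dots> = ennreal S"
    using assms by (intro suminf_ennreal_eq) auto
  finally show ?thesis .
qed

lemma has_integral_Gamma_scaled:
  assumes "s > 0" "a > (0::real)"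
  shows "((\<lambda>t. t powr (s - 1) * exp (- a * t)) has_integral Gamma s * a powr (- s)) {0<..}"
proof -
  let ?h = "\<lambda>t. t powr (s - 1) / exp t"
  have "(?h has_integral Gamma s) {0<..}"
  proof -
    have "((\<lambda>t. if t \<in> {0<..} then ?h t else 0) has_integral Gamma s) {0..}"
      by (rule has_integral_spike[OF _ _ Gamma_integral_real[OF assms(1)], of "{0}"]) auto
    then show ?thesis by (subst (asm) has_integral_restrict) auto
  qed
  then have h: "?h absolutely_integrable_on {0<..} \<and> integral {0<..} ?h = Gamma s"
    using nonnegative_absolutely_integrable_1[of ?h "{0<..}"] by (auto simp: has_integral_iff)
  have im: "(\<lambda>t. a * t) ` {0<..} = {0<..}"
    using assms by (auto intro!: image_eqI[of _ _ "_ / a"])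
  have "(\<lambda>t. \<bar>a\<bar> * ?h (a * t)) absolutely_integrable_on {0<..} \<and>
     integral {0<..} (\<lambda>t. \<bar>a\<bar> * ?h (a * t)) = Gamma s"
    using assms h
    by (subst has_absolute_integral_change_of_variables_1'[where g = "\<lambda>t. a * t" and g' = "\<lambda>_. a"])
       (auto intro!: derivative_eq_intros inj_onI simp: im)
  then have "((\<lambda>t. \<bar>a\<bar> * ?h (a * t)) has_integral Gamma s) {0<..}"
    using set_lebesgue_integral_eq_integral(1) by (auto simp: has_integral_iff)
  then have "((\<lambda>t. \<bar>a\<bar> * ?h (a * t) * a powr (- s)) has_integral Gamma s * a powr (- s)) {0<..}"
    by (rule has_integral_mult_left)
  then show ?thesis
  proof (rule has_integral_eq[rotated])
    fix t :: real assume "t \<in> {0<..}"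
    then have "\<bar>a\<bar> * ?h (a * t) * a powr (- s) = (a powr 1 * a powr (s - 1) * a powr (-s)) * t powr (s - 1) * exp (- a * t)"
      using assms by (simp add: powr_mult exp_minus field_simps)
    also have "a powr 1 * a powr (s - 1) * a powr (-s) = 1"
      unfolding powr_add[symmetric] using assms by simp
    finally show "\<bar>a\<bar> * ?h (a * t) * a powr (- s) = t powr (s - 1) * exp (- a * t)" by simp
  qed
qed

lemma nn_integral_Gamma_scaled:
  assumes "s > 0" "a > (0::real)"
  shows "(\<integral>\<^sup>+t. ennreal (indicator {0<..} t * (t powr (s - 1) * exp (- a * t))) \<partial>lborel) = ennreal (Gamma s * a powr (- s))"
  using nn_integral_has_integral_lebesgue[OF _ has_integral_Gamma_scaled[OF assms]] by simp

text \<open>Substitution of t^2 for t in the scaled Gamma integral at b = (s + 1) / 2.\<close>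

lemma nn_integral_Gamma_square:
  assumes "s > -1" "a > (0::real)"
  shows "(\<integral>\<^sup>+t. ennreal (indicator {0<..} t * (2 * t powr s * exp (- a * t\<^sup>2))) \<partial>lborel) =
    ennreal (Gamma ((s + 1) / 2) * a powr (- (s + 1) / 2))"
proof -
  define b where "b = (s + 1) / 2"
  have b: "b > 0" using assms by (simp add: b_def)
  let ?h = "\<lambda>t. t powr (b - 1) * exp (- a * t)"
  have h: "?h absolutely_integrable_on {0<..} \<and> integral {0<..} ?h = Gamma b * a powr (- b)"
    using has_integral_Gamma_scaled[OF b assms(2)] nonnegative_absolutely_integrable_1[of ?h "{0<..}"]
    by (auto simp: has_integral_iff)
  have im: "(\<lambda>t. t\<^sup>2) ` {0<..} = {(0::real)<..}"
    by (auto intro!: image_eqI[of _ _ "sqrt _"])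
  have "(\<lambda>t. \<bar>2 * t\<bar> * ?h (t\<^sup>2)) absolutely_integrable_on {0<..} \<and>
     integral {0<..} (\<lambda>t. \<bar>2 * t\<bar> * ?h (t\<^sup>2)) = Gamma b * a powr (- b)"
    using assms h
    by (subst has_absolute_integral_change_of_variables_1'[where g = "\<lambda>t. t\<^sup>2" and g' = "\<lambda>t. 2 * t"])
       (auto intro!: derivative_eq_intros inj_onI simp: im)
  then have "((\<lambda>t. \<bar>2 * t\<bar> * ?h (t\<^sup>2)) has_integral Gamma b * a powr (- b)) {0<..}"
    using set_lebesgue_integral_eq_integral(1) by (auto simp: has_integral_iff)
  then have "((\<lambda>t. 2 * t powr s * exp (- a * t\<^sup>2)) has_integral Gamma b * a powr (- b)) {0<..}"
  proof (rule has_integral_eq[rotated])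
    fix t :: real assume t: "t \<in> {0<..}"
    have "t powr s = t powr 1 * (t powr 2) powr (b - 1)"
      using t by (simp only: powr_powr powr_add[symmetric]) (simp add: b_def field_simps)
    then show "\<bar>2 * t\<bar> * ?h (t\<^sup>2) = 2 * t powr s * exp (- a * t\<^sup>2)"
      using t by (simp add: powr_numeral)
  qed
  from nn_integral_has_integral_lebesgue[OF _ this] show ?thesis by (simp add: b_def minus_divide_left)
qed

text \<open>Write 1 / (t^2 + c^2) as the integral of exp (-v * (t^2 + c^2)) over v > 0 and exchange
  the integrals: integrating over t gives the first Gamma factor, integrating over v the
  second.\<close>

lemma nn_integral_powr_div_square:
  assumes s: "-1 < s" "s < (1::real)" and c: "c > 0"
  shows "(\<integral>\<^sup>+t. ennreal (indicator {0<..} t * (2 * t powr s / (t\<^sup>2 + c\<^sup>2))) \<partial>lborel) =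
    ennreal (Gamma ((1 + s) / 2) * Gamma ((1 - s) / 2) * c powr (s - 1))"
proof -
  let ?I = "indicator {0<..} :: real \<Rightarrow> real"
  have "(\<integral>\<^sup>+t. ennreal (?I t * (2 * t powr s / (t\<^sup>2 + c\<^sup>2))) \<partial>lborel) =
    (\<integral>\<^sup>+t. (\<integral>\<^sup>+v. ennreal (?I t * ?I v * (2 * t powr s * exp (- v * (t\<^sup>2 + c\<^sup>2)))) \<partial>lborel) \<partial>lborel)"
  proof (rule nn_integral_cong)
    fix t :: real
    have "(\<integral>\<^sup>+v. ennreal (?I t * ?I v * (2 * t powr s * exp (- v * (t\<^sup>2 + c\<^sup>2)))) \<partial>lborel) =
      (\<integral>\<^sup>+v. ennreal (?I t * (2 * t powr s)) * ennreal (?I v * (v powr (1 - 1) * exp (- (t\<^sup>2 + c\<^sup>2) * v))) \<partial>lborel)"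
      by (intro nn_integral_cong) (auto simp: ennreal_mult'[symmetric] indicator_def algebra_simps)
    also have "\<dots> = ennreal (?I t * (2 * t powr s)) * ennreal (Gamma 1 * (t\<^sup>2 + c\<^sup>2) powr (-1))"
      using c by (subst nn_integral_cmult, measurable, subst nn_integral_Gamma_scaled)
        (auto intro: add_nonneg_pos)
    also have "\<dots> = ennreal (?I t * (2 * t powr s / (t\<^sup>2 + c\<^sup>2)))"
      using c by (subst ennreal_mult'[symmetric]) (auto simp: powr_minus_divide indicator_def)
    finally show "ennreal (?I t * (2 * t powr s / (t\<^sup>2 + c\<^sup>2))) =
        (\<integral>\<^sup>+v. ennreal (?I t * ?I v * (2 * t powr s * exp (- v * (t\<^sup>2 + c\<^sup>2)))) \<partial>lborel)" by simp
  qed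
  also have "\<dots> = (\<integral>\<^sup>+v. (\<integral>\<^sup>+t. ennreal (?I t * ?I v * (2 * t powr s * exp (- v * (t\<^sup>2 + c\<^sup>2)))) \<partial>lborel) \<partial>lborel)"
    by (rule lborel_pair.Fubini') measurable
  also have "\<dots> = (\<integral>\<^sup>+v. ennreal (Gamma ((1 + s) / 2)) * ennreal (?I v * (v powr ((1 - s) / 2 - 1) * exp (- c\<^sup>2 * v))) \<partial>lborel)"
  proof (rule nn_integral_cong)
    fix v :: real
    show "(\<integral>\<^sup>+t. ennreal (?I t * ?I v * (2 * t powr s * exp (- v * (t\<^sup>2 + c\<^sup>2)))) \<partial>lborel) =
      ennreal (Gamma ((1 + s) / 2)) * ennreal (?I v * (v powr ((1 - s) / 2 - 1) * exp (- c\<^sup>2 * v)))"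
    proof (cases "v > 0")
      case True
      have "(\<integral>\<^sup>+t. ennreal (?I t * ?I v * (2 * t powr s * exp (- v * (t\<^sup>2 + c\<^sup>2)))) \<partial>lborel) =
        (\<integral>\<^sup>+t. ennreal (exp (- c\<^sup>2 * v)) * ennreal (?I t * (2 * t powr s * exp (- v * t\<^sup>2))) \<partial>lborel)"
        using True by (intro nn_integral_cong)
          (auto simp: ennreal_mult'[symmetric] indicator_def exp_add[symmetric] algebra_simps)
      also have "\<dots> = ennreal (exp (- c\<^sup>2 * v)) * ennreal (Gamma ((s + 1) / 2) * v powr (- (s + 1) / 2))"
        using True s by (subst nn_integral_cmult, measurable, subst nn_integral_Gamma_square) auto
      also have "- (s + 1) / 2 = (1 - s) / 2 - 1" by (simp add: field_simps)
      finally show ?thesis using True s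
        by (simp add: ennreal_mult'[symmetric] Gamma_real_pos mult_ac add.commute)
    qed simp
  qed
  also have "\<dots> = ennreal (Gamma ((1 + s) / 2)) * ennreal (Gamma ((1 - s) / 2) * (c\<^sup>2) powr (- ((1 - s) / 2)))"
    using s c by (subst nn_integral_cmult, measurable, subst nn_integral_Gamma_scaled) auto
  also have "(c\<^sup>2) powr (- ((1 - s) / 2)) = c powr (s - 1)"
  proof -
    have e: "2 * - ((1 - s) / 2) = s - 1" by (simp add: field_simps)
    have "c powr 2 = c\<^sup>2" using c by (simp add: powr_numeral)
    then show ?thesis using powr_powr[of c 2 "- ((1 - s) / 2)"] unfolding e by simp
  qed
  also have "ennreal (Gamma ((1 + s) / 2)) * ennreal (Gamma ((1 - s) / 2) * c powr (s - 1)) =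
     ennreal (Gamma ((1 + s) / 2) * Gamma ((1 - s) / 2) * c powr (s - 1))"
    using s by (subst ennreal_mult'[symmetric]) (auto simp: Gamma_real_pos less_imp_le mult.assoc)
  finally show ?thesis .
qed

text \<open>Differentiate the reflection formula for \<open>rGamma\<close>, both sides of which are
  entire, and divide by the sine.\<close>

lemma Digamma_reflection_complex:
  fixes z :: complex
  assumes "z \<notin> \<int>"
  shows "Digamma (1 - z) - Digamma z = of_real pi * cot (of_real pi * z)"
proof -
  have nz: "z \<notin> \<int>\<^sub>\<le>\<^sub>0" "1 - z \<notin> \<int>\<^sub>\<le>\<^sub>0"
    using assms by (auto dest!: nonpos_Ints_Int)
  have s: "sin (of_real pi * z) \<noteq> 0"
    using assms sin_eq_0 [of "of_real pi * z"] by (auto elim!: Ints_cases)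
  have "((\<lambda>z. rGamma z * rGamma (1 - z)) has_field_derivative
      rGamma z * rGamma (1 - z) * (Digamma (1 - z) - Digamma z)) (at z)"
    using nz by (auto intro!: derivative_eq_intros simp: algebra_simps)
  moreover have "((\<lambda>z. sin (of_real pi * z) / of_real pi) has_field_derivative cos (of_real pi * z)) (at z)"
    by (auto intro!: derivative_eq_intros)
  ultimately have "rGamma z * rGamma (1 - z) * (Digamma (1 - z) - Digamma z) = cos (of_real pi * z)"
    unfolding rGamma_reflection_complex by (rule DERIV_unique)
  then show ?thesis using s by (simp add: rGamma_reflection_complex cot_def field_simps)
qed

text \<open>Up to the factor 1 / (2 * pi) the series is i * (Digamma (1 - z) - Digamma (1 + z)) at z
  = i * x / (2 * pi). Reflection turns this into a cotangent at an imaginary point. The limit is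
  coth (x / 2) / 2 - 1 / x.\<close>

lemma coth_partial_fractions:
  assumes x: "x > (0::real)"
  shows "(\<lambda>n. 2 * x / (x\<^sup>2 + (2 * pi * real (Suc n))\<^sup>2)) sums (1 / (exp x - 1) - 1 / x + 1 / 2)"
proof -
  define y where "y = x / (2 * pi)"
  define z where "z = \<i> * of_real y"
  have y: "y > 0" using x by (simp add: y_def)
  have z: "z \<notin> \<int>" "z \<noteq> 0" using y by (auto simp: z_def complex_is_Int_iff)
  have z1: "1 - z \<noteq> 0" "1 + z \<noteq> 0" using y by (auto simp: z_def complex_eq_iff)
  have dg: "(\<lambda>n. inverse (of_nat (Suc n)) - inverse (u + of_nat n)) sums (Digamma u + euler_mascheroni)"
    if "u \<noteq> 0" for u :: complex
    using summable_sums[OF summable_Digamma[OF that]] by (simp add: Digamma_def)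
  have "(\<lambda>n. \<i> * ((inverse (of_nat (Suc n)) - inverse (1 - z + of_nat n)) -
          (inverse (of_nat (Suc n)) - inverse (1 + z + of_nat n)))) sums
        (\<i> * ((Digamma (1 - z) + euler_mascheroni) - (Digamma (1 + z) + euler_mascheroni)))"
    by (intro sums_mult sums_diff dg z1)
  also have "(Digamma (1 - z) + euler_mascheroni) - (Digamma (1 + z) + euler_mascheroni) =
      of_real pi * cot (of_real pi * z) - 1 / z"
    using Digamma_reflection_complex[OF z(1)] Digamma_plus1[OF z(2)] by (simp add: algebra_simps)
  also have "\<i> * (of_real pi * cot (of_real pi * z) - 1 / z) =
      of_real (pi * ((exp x + 1) / (exp x - 1)) - 2 * pi / x)"
  proof -
    have ex: "exp (complex_of_real x) = exp (of_real (x/2)) * exp (of_real (x/2))"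
      by (simp add: exp_add[symmetric] flip: of_real_add)
    have pz: "of_real pi * z = \<i> * of_real (x / 2)" by (simp add: z_def y_def)
    have "exp (of_real x) \<noteq> (1::complex)" using x by (simp add: exp_of_real)
    have ct: "cot (of_real pi * z) = - \<i> * ((exp (of_real x) + 1) / (exp (of_real x) - 1))"
    proof -
      define E where "E = exp (complex_of_real (x / 2))"
      have E: "E \<noteq> 0" "exp (complex_of_real x) = E\<^sup>2"
        unfolding ex by (simp_all add: E_def power2_eq_square)
      have "\<i> * (of_real pi * z) = - of_real (x / 2)" unfolding pz by simp
      then have cs: "cos (of_real pi * z) = (1 / E + E) / 2" "sin (of_real pi * z) = (1 / E - E) / (2 * \<i>)"
        by (simp_all add: cos_exp_eq sin_exp_eq E_def exp_minus inverse_eq_divide)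
      have "(A / 2) / (B / (2 * \<i>)) = \<i> * (A / B)" for A B
        by (cases "B = 0") (auto simp: field_simps)
      then have "cot (of_real pi * z) = \<i> * ((1 / E + E) / (1 / E - E))"
        by (simp only: cot_def cs)
      also have "1 / E + E = (E\<^sup>2 + 1) / E"
        using E(1) by (simp add: field_simps power2_eq_square)
      also have "1 / E - E = - (E\<^sup>2 - 1) / E"
        using E(1) by (simp add: field_simps power2_eq_square)
      also have "\<i> * ((E\<^sup>2 + 1) / E / (- (E\<^sup>2 - 1) / E)) = - \<i> * ((E\<^sup>2 + 1) / (E\<^sup>2 - 1))"
        using E(1) by (simp del: minus_diff_eq add: minus_divide_left[symmetric])
      finally show ?thesis unfolding E(2) .
    qed
    have iz: "1 / z = - \<i> * of_real (2 * pi / x)"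
      using x by (simp add: z_def y_def field_simps)
    show ?thesis unfolding ct iz by (simp add: exp_of_real algebra_simps)
  qed
  also have "(\<lambda>n. \<i> * ((inverse (of_nat (Suc n)) - inverse (1 - z + of_nat n)) -
          (inverse (of_nat (Suc n)) - inverse (1 + z + of_nat n)))) =
       (\<lambda>n. of_real (2 * y / ((real (Suc n))\<^sup>2 + y\<^sup>2)))"
  proof
    fix n
    define N where "N = complex_of_nat (Suc n)"
    have ne: "N + z \<noteq> 0" "N - z \<noteq> 0" by (auto simp: N_def z_def complex_eq_iff)
    have "(N + z) * (N - z) = of_real ((real (Suc n))\<^sup>2 + y\<^sup>2)"
      by (simp add: N_def z_def algebra_simps power2_eq_square)
    moreover have "\<i> * (- 2 * z) = of_real (2 * y)" by (simp add: z_def complex_eq_iff)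
    ultimately have "of_real (2 * y / ((real (Suc n))\<^sup>2 + y\<^sup>2)) = \<i> * (- 2 * z) / ((N + z) * (N - z))"
      by (simp only: of_real_divide)
    also have "\<dots> = \<i> * (inverse (N + z) - inverse (N - z))"
      using ne by (simp add: field_simps)
    also have "\<dots> = \<i> * ((inverse (of_nat (Suc n)) - inverse (1 - z + of_nat n)) -
          (inverse (of_nat (Suc n)) - inverse (1 + z + of_nat n)))"
      by (simp add: N_def algebra_simps)
    finally show "\<i> * ((inverse (of_nat (Suc n)) - inverse (1 - z + of_nat n)) -
          (inverse (of_nat (Suc n)) - inverse (1 + z + of_nat n))) =
       of_real (2 * y / ((real (Suc n))\<^sup>2 + y\<^sup>2))" ..
  qed
  finally have "(\<lambda>n. 2 * y / ((real (Suc n))\<^sup>2 + y\<^sup>2)) sums (pi * ((exp x + 1) / (exp x - 1)) - 2 * pi / x)"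
    unfolding sums_of_real_iff .
  then have "(\<lambda>n. 2 * y / ((real (Suc n))\<^sup>2 + y\<^sup>2) / (2 * pi)) sums
      ((pi * ((exp x + 1) / (exp x - 1)) - 2 * pi / x) / (2 * pi))"
    by (rule sums_divide)
  also have "(pi * ((exp x + 1) / (exp x - 1)) - 2 * pi / x) / (2 * pi) = 1 / (exp x - 1) - 1 / x + 1 / 2"
    using x by (simp add: field_simps)
  also have "(\<lambda>n. 2 * y / ((real (Suc n))\<^sup>2 + y\<^sup>2) / (2 * pi)) = (\<lambda>n. 2 * x / (x\<^sup>2 + (2 * pi * real (Suc n))\<^sup>2))"
  proof
    fix n
    define D where "D = x\<^sup>2 + (2 * pi * real (Suc n))\<^sup>2"
    have D: "D > 0" using x by (simp add: D_def add_pos_nonneg)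
    have "(real (Suc n))\<^sup>2 + y\<^sup>2 = D / (2 * pi)\<^sup>2"
      by (simp add: y_def D_def field_simps power2_eq_square)
    then show "2 * y / ((real (Suc n))\<^sup>2 + y\<^sup>2) / (2 * pi) = 2 * x / (x\<^sup>2 + (2 * pi * real (Suc n))\<^sup>2)"
      using D unfolding D_def[symmetric] by (simp add: y_def power2_eq_square field_simps)
  qed
  finally show ?thesis .
qed

section \<open>The functional equation\<close>

text \<open>The midpoint of the interval is an accumulation point of it, so formulas obtained from
  real integrals need checking at real arguments only.\<close>

lemma holomorphic_eq_from_real_interval:
  assumes "f holomorphic_on A" "g holomorphic_on A" "open A" "connected A"
    and "a < b" and sub: "complex_of_real ` {a<..<b} \<subseteq> A"
    and eq: "\<And>x. a < x \<Longrightarrow> x < b \<Longrightarrow> f (of_real x) = g (of_real x)" and "z \<in> A"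
  shows "f z = g z"
proof -
  define c where "c = (a + b) / 2"
  have c: "a < c" "c < b" using assms by (auto simp: c_def)
  have "f z - g z = 0"
  proof (rule analytic_continuation[where f = "\<lambda>z. f z - g z" and S = A
        and U = "complex_of_real ` {a<..<b}" and \<xi> = "of_real c"])
    show "(\<lambda>z. f z - g z) holomorphic_on A" using assms by (intro holomorphic_intros)
    show "of_real c \<in> A" using sub c by auto
    show "of_real c islimpt complex_of_real ` {a<..<b}"
      unfolding islimpt_approachable
    proof safe
      fix e :: real assume e: "e > 0"
      define x where "x = c + min (e / 2) ((b - c) / 2)"
      have "min (e / 2) ((b - c) / 2) > 0" "min (e / 2) ((b - c) / 2) < e" "min (e / 2) ((b - c) / 2) < b - c"
        using e c by (auto simp: min_def)
      then have x: "x > c" "x < b" "\<bar>x - c\<bar> < e" by (auto simp: x_def)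
      moreover have "dist (complex_of_real x) (of_real c) = \<bar>x - c\<bar>"
        by (simp add: dist_norm flip: of_real_diff)
      ultimately show "\<exists>x'\<in>complex_of_real ` {a<..<b}. x' \<noteq> of_real c \<and> dist x' (of_real c) < e"
        using c by (intro bexI[of _ "of_real x"]) auto
    qed
  qed (use assms in auto)
  then show ?thesis by simp
qed

definition real_zeta :: "real \<Rightarrow> real" where
  "real_zeta x = (\<Sum>n. real (Suc n) powr (- x))"

lemma real_zeta_sums: "x > 1 \<Longrightarrow> (\<lambda>n. real (Suc n) powr (- x)) sums real_zeta x"
  unfolding real_zeta_def by (intro summable_sums summable_Suc_powr) auto

lemma zeta_of_real:
  assumes "x > 1"
  shows "zeta (of_real x) = of_real (real_zeta x)"
proof (rule sums_unique2)
  show "(\<lambda>n. 1 / of_nat (Suc n) powr complex_of_real x) sums zeta (of_real x)"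
    using assms by (intro zeta_sums) auto
  have "1 / of_nat (Suc n) powr complex_of_real x = of_real (real (Suc n) powr (- x))" for n
    using powr_of_real[of "real (Suc n)" x] by (simp add: powr_minus_divide del: of_nat_Suc)
  then show "(\<lambda>n. 1 / of_nat (Suc n) powr complex_of_real x) sums of_real (real_zeta x)"
    using real_zeta_sums[OF assms] by (simp add: sums_of_real_iff del: of_nat_Suc)
qed

lemma exp_minus_Suc_sums:
  assumes "t > (0::real)"
  shows "(\<lambda>n. exp (- real (Suc n) * t)) sums (1 / (exp t - 1))"
proof -
  have "(\<lambda>n. exp (- t) * exp (- t) ^ n) sums (exp (- t) * (1 / (1 - exp (- t))))"
    using assms by (intro sums_mult geometric_sums) auto
  also have "exp (- t) * (1 / (1 - exp (- t))) = 1 / (exp t - 1)"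
    using assms by (simp add: exp_minus field_simps)
  also have "(\<lambda>n. exp (- t) * exp (- t) ^ n) = (\<lambda>n. exp (- real (Suc n) * t))"
    by (simp add: exp_of_nat_mult[symmetric] exp_add[symmetric] algebra_simps)
  finally show ?thesis .
qed

lemma nn_integral_zeta:
  assumes "x > 1"
  shows "(\<integral>\<^sup>+t. ennreal (indicator {0<..} t * (t powr (x - 1) / (exp t - 1))) \<partial>lborel) =
    ennreal (Gamma x * real_zeta x)"
proof (rule nn_integral_sums)
  show "(\<integral>\<^sup>+t. ennreal (indicator {0<..} t * (t powr (x - 1) * exp (- real (Suc n) * t))) \<partial>lborel) =
     ennreal (Gamma x * real (Suc n) powr (- x))" for n
    using assms by (intro nn_integral_Gamma_scaled) auto
  show "(\<lambda>n. t powr (x - 1) * exp (- real (Suc n) * t)) sums (t powr (x - 1) / (exp t - 1))"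
    if "t \<in> {0<..}" for t
    using sums_mult[OF exp_minus_Suc_sums[of t], of "t powr (x - 1)"] that by simp
  show "(\<lambda>n. Gamma x * real (Suc n) powr (- x)) sums (Gamma x * real_zeta x)"
    using assms by (intro sums_mult real_zeta_sums)
qed (use assms in \<open>auto simp: Gamma_real_pos less_imp_le\<close>)

lemma Gamma_reflection_half:
  fixes s :: real
  assumes "-1 < s" "s < 1"
  shows "Gamma ((1 + s) / 2) * Gamma ((1 - s) / 2) = pi / cos (pi * s / 2)"
proof -
  have "Gamma (complex_of_real ((1 + s) / 2)) * Gamma (1 - complex_of_real ((1 + s) / 2)) =
     of_real pi / sin (of_real pi * of_real ((1 + s) / 2))"
    by (rule Gamma_reflection_complex)
  also have "1 - complex_of_real ((1 + s) / 2) = of_real ((1 - s) / 2)"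
    by (simp add: field_simps)
  also have "sin (of_real pi * of_real ((1 + s) / 2)) = complex_of_real (sin (pi / 2 + pi * s / 2))"
    unfolding of_real_mult[symmetric] sin_of_real by (simp add: field_simps)
  finally show ?thesis
    unfolding Gamma_complex_of_real of_real_mult[symmetric] of_real_divide[symmetric] of_real_eq_iff
    by (simp add: sin_add)
qed

text \<open>Integrate the partial fractions termwise: the n-th term (n \<ge> 1) gives a constant
  times (2 * pi * n) to the power s - 1, and these powers sum to zeta at 1 - s. This reflected
  argument is the source of the functional equation.\<close>

lemma nn_integral_bose_remainder:
  assumes "-1 < s" "s < 0"
  shows "(\<integral>\<^sup>+t. ennreal (indicator {0<..} t * ((1 / (exp t - 1) - 1 / t + 1 / 2) * t powr (s - 1))) \<partial>lborel) =
    ennreal (pi / cos (pi * s / 2) * (2 * pi) powr (s - 1) * real_zeta (1 - s))"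
proof (rule nn_integral_sums)
  let ?c = "\<lambda>n. 2 * pi * real (Suc n)"
  show "(\<integral>\<^sup>+t. ennreal (indicator {0<..} t * (2 * t powr s / (t\<^sup>2 + (?c n)\<^sup>2))) \<partial>lborel) =
     ennreal (pi / cos (pi * s / 2) * (?c n) powr (s - 1))" for n
    using assms nn_integral_powr_div_square[of s "?c n"] by (simp add: Gamma_reflection_half)
  show "(\<lambda>n. 2 * t powr s / (t\<^sup>2 + (?c n)\<^sup>2)) sums ((1 / (exp t - 1) - 1 / t + 1 / 2) * t powr (s - 1))"
    if t: "t \<in> {0<..}" for t
  proof -
    have "t * t powr (s - 1) = t powr s"
      using t powr_add[of t 1 "s - 1"] by simp
    then have eq: "2 * t / (t\<^sup>2 + (?c n)\<^sup>2) * t powr (s - 1) = 2 * t powr s / (t\<^sup>2 + (?c n)\<^sup>2)" for n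
      by simp
    have "t > 0" using t by simp
    from sums_mult2[OF coth_partial_fractions[OF this], of "t powr (s - 1)"] show ?thesis
      unfolding eq .
  qed
  have "(\<lambda>n. pi / cos (pi * s / 2) * (2 * pi) powr (s - 1) * real (Suc n) powr (- (1 - s))) sums
      (pi / cos (pi * s / 2) * (2 * pi) powr (s - 1) * real_zeta (1 - s))"
    using assms by (intro sums_mult real_zeta_sums) auto
  then show "(\<lambda>n. pi / cos (pi * s / 2) * (?c n) powr (s - 1)) sums
      (pi / cos (pi * s / 2) * (2 * pi) powr (s - 1) * real_zeta (1 - s))"
    by (subst powr_mult) (simp_all add: mult.assoc del: of_nat_Suc)
  have "0 < cos (pi * s / 2)"
  proof (rule cos_gt_zero_pi)
    have "pi * (-1) < pi * s" "pi * s < pi * 1"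
      using assms pi_gt_zero by (intro mult_strict_left_mono; simp)+
    then show "- (pi / 2) < pi * s / 2" "pi * s / 2 < pi / 2" by auto
  qed
  then show "0 \<le> pi / cos (pi * s / 2) * (?c n) powr (s - 1)" for n by simp
qed auto

text \<open>The singular part at 0 is cut off so that a single Mellin transform converges on \<open>Re s > -1\<close>;
  it yields \<open>Gamma s * zeta s\<close> on both sides of the poles at 0 and 1.\<close>

definition bose_cut :: "real \<Rightarrow> real" where
  "bose_cut t = 1 / (exp t - 1) - (if t < 1 then 1 / t - 1 / 2 else 0)"

lemma borel_measurable_bose_cut [measurable]: "bose_cut \<in> borel_measurable borel"
  unfolding bose_cut_def[abs_def] by measurable

lemma set_integral_powr_unit:
  fixes a :: real
  assumes "a > -1"
  shows "set_integrable lborel {0<..} (\<lambda>t. if t < 1 then t powr a else 0)"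
    and "(LBINT t:{0<..}. if t < 1 then t powr a else 0) = 1 / (a + 1)"
proof -
  have "((\<lambda>t. if t \<in> {0<..} then if t < 1 then t powr a else 0 else 0) has_integral 1 powr (a + 1) / (a + 1)) {0..1}"
    by (rule has_integral_spike[OF _ _ has_integral_powr_from_0[OF assms], of "{0, 1}"]) auto
  then have "((\<lambda>t. if t \<in> {0..1} then if t \<in> {0<..} then if t < 1 then t powr a else 0 else 0 else 0)
      has_integral 1 powr (a + 1) / (a + 1)) UNIV"
    by (subst has_integral_restrict_UNIV)
  also have "(\<lambda>t. if t \<in> {0..1} then if t \<in> {0<..} then if t < 1 then t powr a else 0 else 0 else 0) =
    (\<lambda>t. if t \<in> {0<..} then if t < 1 then t powr a else 0 else 0)" by auto
  finally have *: "((\<lambda>t. if t < 1 then t powr a else 0) has_integral 1 / (a + 1)) {0<..}"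
    by (simp only: has_integral_restrict_UNIV powr_one_eq_one)
  have "(\<integral>\<^sup>+t. ennreal (indicator {0<..} t * (if t < 1 then t powr a else 0)) \<partial>lborel) = ennreal (1 / (a + 1))"
    by (rule nn_integral_has_integral_lebesgue[OF _ *]) auto
  then show "set_integrable lborel {0<..} (\<lambda>t. if t < 1 then t powr a else 0)"
    "(LBINT t:{0<..}. if t < 1 then t powr a else 0) = 1 / (a + 1)"
    using assms by (intro nn_integral_imp_set_integral; auto)+
qed

lemma set_integral_powr_infinity:
  fixes a :: real
  assumes "a < -1"
  shows "set_integrable lborel {0<..} (\<lambda>t. if t < 1 then 0 else t powr a)"
    and "(LBINT t:{0<..}. if t < 1 then 0 else t powr a) = - 1 / (a + 1)"
proof -
  have "((\<lambda>t. t powr a) has_integral - (1 powr (a + 1)) / (a + 1)) {1..}"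
    using assms by (intro has_integral_powr_to_inf) auto
  then have "((\<lambda>t. if t \<in> {1..} then t powr a else 0) has_integral - (1 powr (a + 1)) / (a + 1)) UNIV"
    by (subst has_integral_restrict_UNIV)
  also have "(\<lambda>t. if t \<in> {1..} then t powr a else 0) =
    (\<lambda>t::real. if t \<in> {0<..} then if t < 1 then 0 else t powr a else 0)" by auto
  finally have *: "((\<lambda>t. if t < 1 then 0 else t powr a) has_integral - 1 / (a + 1)) {0<..}"
    by (simp only: has_integral_restrict_UNIV powr_one_eq_one)
  have "(\<integral>\<^sup>+t. ennreal (indicator {0<..} t * (if t < 1 then 0 else t powr a)) \<partial>lborel) = ennreal (- 1 / (a + 1))"
    by (rule nn_integral_has_integral_lebesgue[OF _ *]) auto
  then show "set_integrable lborel {0<..} (\<lambda>t. if t < 1 then 0 else t powr a)"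
    "(LBINT t:{0<..}. if t < 1 then 0 else t powr a) = - 1 / (a + 1)"
    using assms by (intro nn_integral_imp_set_integral; auto simp: field_simps)+
qed

lemma bose_remainder_nonneg:
  assumes "t > (0::real)"
  shows "1 / (exp t - 1) - 1 / t + 1 / 2 \<ge> 0"
proof (rule sums_le[OF _ sums_zero coth_partial_fractions[OF assms]])
  show "0 \<le> 2 * t / (t\<^sup>2 + (2 * pi * real (Suc n))\<^sup>2)" for n
    using assms by (intro divide_nonneg_nonneg add_nonneg_nonneg) auto
qed

lemma real_zeta_nonneg: "x > 1 \<Longrightarrow> real_zeta x \<ge> 0"
  by (rule sums_le[OF _ sums_zero real_zeta_sums]) auto

lemma set_integral_zeta:
  assumes "x > 1"
  shows "set_integrable lborel {0<..} (\<lambda>t. t powr (x - 1) / (exp t - 1))"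
    and "(LBINT t:{0<..}. t powr (x - 1) / (exp t - 1)) = Gamma x * real_zeta x"
  using assms nn_integral_zeta[OF assms]
  by (intro nn_integral_imp_set_integral; auto simp: Gamma_real_pos less_imp_le real_zeta_nonneg)+

lemma set_integral_bose_remainder:
  assumes "-1 < s" "s < 0"
  shows "set_integrable lborel {0<..} (\<lambda>t. (1 / (exp t - 1) - 1 / t + 1 / 2) * t powr (s - 1))"
    and "(LBINT t:{0<..}. (1 / (exp t - 1) - 1 / t + 1 / 2) * t powr (s - 1)) =
           pi / cos (pi * s / 2) * (2 * pi) powr (s - 1) * real_zeta (1 - s)"
proof -
  have "pi / cos (pi * s / 2) > 0"
    using assms by (subst Gamma_reflection_half[symmetric]) (auto simp: Gamma_real_pos)
  then have "pi / cos (pi * s / 2) * (2 * pi) powr (s - 1) * real_zeta (1 - s) \<ge> 0"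
    using assms real_zeta_nonneg[of "1 - s"] by (intro mult_nonneg_nonneg) auto
  then show "set_integrable lborel {0<..} (\<lambda>t. (1 / (exp t - 1) - 1 / t + 1 / 2) * t powr (s - 1))"
    "(LBINT t:{0<..}. (1 / (exp t - 1) - 1 / t + 1 / 2) * t powr (s - 1)) =
           pi / cos (pi * s / 2) * (2 * pi) powr (s - 1) * real_zeta (1 - s)"
    using nn_integral_bose_remainder[OF assms]
    by (intro nn_integral_imp_set_integral; auto simp: bose_remainder_nonneg)+
qed

text \<open>On (0, 1) \<open>bose_cut\<close> is the partial fraction remainder, from 1 on it is 1 /
  (exp t - 1). Each piece is dominated by an integrand already known to be integrable.\<close>

lemma mellin_conv_bose_cut:
  assumes "x > -1"
  shows "mellin_conv bose_cut x"
proof -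
  \<comment> \<open>The clamps place \<open>a\<close> in (-1, 0) and \<open>b\<close> above 1, where
    the two known integrals converge, with \<open>x\<close> between them.\<close>
  define a b where "a = min x (-1/2)" and "b = max x 2"
  have ab: "-1 < a" "a < 0" "a \<le> x" "b > 1" "x \<le> b" using assms by (auto simp: a_def b_def)
  show ?thesis unfolding mellin_conv_def
  proof (rule set_integrable_bound[OF set_integral_add(1)])
    show "set_integrable lborel {0<..} (\<lambda>t. (1 / (exp t - 1) - 1 / t + 1 / 2) * t powr (a - 1))"
      using ab by (intro set_integral_bose_remainder)
    show "set_integrable lborel {0<..} (\<lambda>t. t powr (b - 1) / (exp t - 1))"
      using ab by (intro set_integral_zeta)
    show "set_borel_measurable lborel {0<..} (\<lambda>t. bose_cut t * t powr (x - 1))"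
      unfolding set_borel_measurable_def by measurable
    show "AE t\<in>{0<..} in lborel. norm (bose_cut t * t powr (x - 1)) \<le>
       norm ((1 / (exp t - 1) - 1 / t + 1 / 2) * t powr (a - 1) + t powr (b - 1) / (exp t - 1))"
    proof (intro AE_I2 impI)
      fix t :: real assume "t \<in> {0<..}"
      then have t: "t > 0" by simp
      define w where "w = 1 / (exp t - 1) - 1 / t + 1 / 2"
      have w: "w \<ge> 0" unfolding w_def by (rule bose_remainder_nonneg[OF t])
      have e: "1 / (exp t - 1) \<ge> 0" using t by simp
      have "\<bar>bose_cut t\<bar> * t powr (x - 1) \<le> w * t powr (a - 1) + (1 / (exp t - 1)) * t powr (b - 1)"
      proof (cases "t < 1")
        case True
        then have "bose_cut t = w" by (simp add: bose_cut_def w_def)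
        moreover have "w * t powr (x - 1) \<le> w * t powr (a - 1)"
          using True t ab w by (intro mult_left_mono powr_mono') auto
        moreover have "(1 / (exp t - 1)) * t powr (b - 1) \<ge> 0" using e by (intro mult_nonneg_nonneg) auto
        ultimately show ?thesis using w by simp
      next
        case False
        then have "bose_cut t = 1 / (exp t - 1)" by (simp add: bose_cut_def)
        moreover have "(1 / (exp t - 1)) * t powr (x - 1) \<le> (1 / (exp t - 1)) * t powr (b - 1)"
          using False ab e by (intro mult_left_mono powr_mono) auto
        moreover have "w * t powr (a - 1) \<ge> 0" using w by (intro mult_nonneg_nonneg) auto
        ultimately show ?thesis using e by simp
      qed
      then show "norm (bose_cut t * t powr (x - 1)) \<le>
       norm ((1 / (exp t - 1) - 1 / t + 1 / 2) * t powr (a - 1) + t powr (b - 1) / (exp t - 1))"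
        unfolding w_def[symmetric] by (simp add: abs_mult)
    qed
  qed
qed

lemma mellin_bose_cut_gt_1:
  assumes "x > 1"
  shows "mellin bose_cut (of_real x) = of_real (Gamma x * real_zeta x - 1 / (x - 1) + 1 / (2 * x))"
proof -
  have "(LBINT t:{0<..}. bose_cut t * t powr (x - 1)) =
    (LBINT t:{0<..}. t powr (x - 1) / (exp t - 1) - ((if t < 1 then t powr (x - 2) else 0) -
        1 / 2 * (if t < 1 then t powr (x - 1) else 0)))"
  proof (rule set_lebesgue_integral_cong)
    show "\<forall>t. t \<in> {0<..} \<longrightarrow> bose_cut t * t powr (x - 1) = t powr (x - 1) / (exp t - 1) -
        ((if t < 1 then t powr (x - 2) else 0) - 1 / 2 * (if t < 1 then t powr (x - 1) else 0))"
    proof (intro allI impI)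
      fix t :: real assume "t \<in> {0<..}"
      then have "t powr (x - 1) / t = t powr (x - 2)"
        using powr_diff[of t "x - 1" 1] by (simp add: algebra_simps)
      then show "bose_cut t * t powr (x - 1) = t powr (x - 1) / (exp t - 1) -
        ((if t < 1 then t powr (x - 2) else 0) - 1 / 2 * (if t < 1 then t powr (x - 1) else 0))"
        by (simp add: bose_cut_def algebra_simps)
    qed
  qed simp
  also have "\<dots> = Gamma x * real_zeta x - (1 / (x - 2 + 1) - 1 / 2 * (1 / (x - 1 + 1)))"
    using assms set_integral_powr_unit[of "x - 2"] set_integral_powr_unit[of "x - 1"] set_integral_zeta[OF assms]
    by (simp add: set_integral_diff)
  finally show ?thesis by (simp add: mellin_of_real)
qed

text \<open>For x > 1 the term 1 / t - 1 / 2 is subtracted over (0, 1); here it is added back over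
  (1, infinity). Both contribute the same rational function -1 / (x - 1) + 1 / (2 * x), which lets
  continuation join the two formulas.\<close>

lemma mellin_bose_cut_neg:
  assumes "-1 < x" "x < 0"
  shows "mellin bose_cut (of_real x) =
    of_real (pi / cos (pi * x / 2) * (2 * pi) powr (x - 1) * real_zeta (1 - x) - 1 / (x - 1) + 1 / (2 * x))"
proof -
  have "(LBINT t:{0<..}. bose_cut t * t powr (x - 1)) =
    (LBINT t:{0<..}. (1 / (exp t - 1) - 1 / t + 1 / 2) * t powr (x - 1) + ((if t < 1 then 0 else t powr (x - 2)) -
        1 / 2 * (if t < 1 then 0 else t powr (x - 1))))"
  proof (rule set_lebesgue_integral_cong)
    show "\<forall>t. t \<in> {0<..} \<longrightarrow> bose_cut t * t powr (x - 1) = (1 / (exp t - 1) - 1 / t + 1 / 2) * t powr (x - 1) +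
        ((if t < 1 then 0 else t powr (x - 2)) - 1 / 2 * (if t < 1 then 0 else t powr (x - 1)))"
    proof (intro allI impI)
      fix t :: real assume "t \<in> {0<..}"
      then have "t powr (x - 1) / t = t powr (x - 2)"
        using powr_diff[of t "x - 1" 1] by (simp add: algebra_simps)
      then show "bose_cut t * t powr (x - 1) = (1 / (exp t - 1) - 1 / t + 1 / 2) * t powr (x - 1) +
        ((if t < 1 then 0 else t powr (x - 2)) - 1 / 2 * (if t < 1 then 0 else t powr (x - 1)))"
        by (simp add: bose_cut_def algebra_simps)
    qed
  qed simp
  also have "\<dots> = pi / cos (pi * x / 2) * (2 * pi) powr (x - 1) * real_zeta (1 - x) +
      (- 1 / (x - 2 + 1) - 1 / 2 * (- 1 / (x - 1 + 1)))"
    using assms set_integral_powr_infinity[of "x - 2"] set_integral_powr_infinity[of "x - 1"]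
      set_integral_bose_remainder[OF assms]
    by (simp add: set_integral_diff set_integral_add)
  finally show ?thesis by (simp add: mellin_of_real)
qed

text \<open>The factor s * (s - 1) clears the rational terms and \<open>rGamma\<close> stands in for
  division by Gamma, so both sides are holomorphic on Re s > -1 and can be compared on (1,
  2).\<close>

lemma pzeta_conv_mellin_bose_cut:
  assumes "Re s > -1"
  shows "s * pzeta s = rGamma s * (s * (s - 1) * mellin bose_cut s + s - (s - 1) / 2)"
proof (rule holomorphic_eq_from_real_interval[where A = "{s. Re s \<in> {-1<..}}" and a = 1 and b = 2
      and f = "\<lambda>s. s * pzeta s"
      and g = "\<lambda>s. rGamma s * (s * (s - 1) * mellin bose_cut s + s - (s - 1) / 2)"])
  show "(\<lambda>s. rGamma s * (s * (s - 1) * mellin bose_cut s + s - (s - 1) / 2)) holomorphic_on {s. Re s \<in> {-1<..}}"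
    by (intro holomorphic_intros holomorphic_mellin mellin_conv_bose_cut) auto
  show "open {s. Re s \<in> {-1<..}}" "connected {s. Re s \<in> {-1<..}}"
    by (auto simp: open_halfspace_Re_gt convex_connected convex_halfspace_Re_gt)
  fix x :: real assume x: "1 < x" "x < 2"
  have 1: "rGamma (complex_of_real x) * of_real (Gamma x) = 1"
  proof -
    have "Gamma x > 0" using x by (intro Gamma_real_pos) auto
    then show ?thesis by (simp add: rGamma_inverse_Gamma Gamma_complex_of_real)
  qed
  have 2: "pzeta (of_real x) = (of_real x - 1) * of_real (real_zeta x)"
    using x by (simp add: pzeta_def zeta_of_real)
  have 3: "of_real x * (of_real x - 1) * mellin bose_cut (of_real x) + of_real x - (of_real x - 1) / 2 =
    complex_of_real (x * (x - 1) * Gamma x * real_zeta x)"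
  proof -
    define M where "M = Gamma x * real_zeta x - 1 / (x - 1) + 1 / (2 * x)"
    have "x * (x - 1) * Gamma x * real_zeta x = x * (x - 1) * M + x - (x - 1) / 2"
      using x by (simp add: M_def field_simps)
    moreover have "mellin bose_cut (of_real x) = of_real M"
      unfolding M_def by (rule mellin_bose_cut_gt_1[OF x(1)])
    ultimately show ?thesis by simp
  qed
  have "rGamma (complex_of_real x) * of_real (x * (x - 1) * Gamma x * real_zeta x) =
     (rGamma (complex_of_real x) * of_real (Gamma x)) * (of_real x * (of_real x - 1) * of_real (real_zeta x))"
    by (simp add: mult_ac)
  then show "of_real x * pzeta (of_real x) = rGamma (of_real x) *
     (of_real x * (of_real x - 1) * mellin bose_cut (of_real x) + of_real x - (of_real x - 1) / 2)"
    unfolding 1 2 3 by simp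
qed (use assms in \<open>auto intro!: holomorphic_intros\<close>)

text \<open>With the cosine multiplied out and \<open>rGamma\<close> used, both sides are entire. It
  suffices to compare them on (-1, 0), where the previous identity and
  \<open>mellin_bose_cut_neg\<close> are both available.\<close>

theorem pzeta_functional_equation:
  "pzeta s * s * cos (of_real pi * s / 2) =
     - (s - 1) * rGamma s * of_real pi * of_real (2 * pi) powr (s - 1) * pzeta (1 - s)"
proof (rule holomorphic_eq_from_real_interval[where A = UNIV and a = "-1" and b = 0
      and f = "\<lambda>s. pzeta s * s * cos (of_real pi * s / 2)"
      and g = "\<lambda>s. - (s - 1) * rGamma s * of_real pi * of_real (2 * pi) powr (s - 1) * pzeta (1 - s)"])
  fix x :: real assume x: "-1 < x" "x < 0"
  define z where "z = complex_of_real x"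
  define R where "R = pi / cos (pi * x / 2) * (2 * pi) powr (x - 1) * real_zeta (1 - x)"
  have "pi / cos (pi * x / 2) > 0"
    using x by (subst Gamma_reflection_half[symmetric]) (auto simp: Gamma_real_pos)
  then have cos: "cos (pi * x / 2) \<noteq> 0" by auto
  define M where "M = R - 1 / (x - 1) + 1 / (2 * x)"
  have "x * (x - 1) * R = x * (x - 1) * M + x - (x - 1) / 2"
    using x by (simp add: M_def field_simps)
  moreover have "mellin bose_cut z = of_real M"
    unfolding M_def R_def z_def by (rule mellin_bose_cut_neg[OF x])
  ultimately have "z * (z - 1) * mellin bose_cut z + z - (z - 1) / 2 = complex_of_real (x * (x - 1) * R)"
    by (simp add: z_def)
  with pzeta_conv_mellin_bose_cut[of z] have "z * pzeta z = rGamma z * (z * (z - 1) * of_real R)"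
    using x by (simp add: z_def)
  then have 1: "pzeta z = rGamma z * (z - 1) * of_real R" using x by (simp add: z_def)
  have 2: "pzeta (1 - z) = - z * of_real (real_zeta (1 - x))"
    using x zeta_of_real[of "1 - x"] by (simp add: pzeta_def z_def)
  have 3: "of_real (2 * pi) powr (z - 1) = complex_of_real ((2 * pi) powr (x - 1))"
    using powr_of_real[of "2 * pi" "x - 1"] by (simp add: z_def)
  have 4: "cos (of_real pi * z / 2) = complex_of_real (cos (pi * x / 2))"
  proof -
    have "of_real pi * z / 2 = of_real (pi * x / 2)" by (simp add: z_def)
    then show ?thesis by (simp only: cos_of_real)
  qed
  have "R * cos (pi * x / 2) = pi * (2 * pi) powr (x - 1) * real_zeta (1 - x)"
    using cos by (simp add: R_def)
  then have 5: "of_real R * complex_of_real (cos (pi * x / 2)) =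
     of_real pi * of_real ((2 * pi) powr (x - 1)) * of_real (real_zeta (1 - x))"
    by (simp only: flip: of_real_mult)
  have "pzeta z * z * cos (of_real pi * z / 2) = rGamma z * (z - 1) * z * (of_real R * complex_of_real (cos (pi * x / 2)))"
    unfolding 1 4 by (simp add: mult_ac)
  also have "\<dots> = - (z - 1) * rGamma z * of_real pi * of_real (2 * pi) powr (z - 1) * pzeta (1 - z)"
    unfolding 2 3 5 by (simp add: algebra_simps)
  finally show "pzeta (of_real x) * of_real x * cos (of_real pi * of_real x / 2) =
     - (of_real x - 1) * rGamma (of_real x) * of_real pi * of_real (2 * pi) powr (of_real x - 1) * pzeta (1 - of_real x)"
    by (simp only: z_def)
qed (auto intro!: holomorphic_intros)

section \<open>Mellin inversion of the exponential function\<close>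

lemma norm_Gamma_le_Gamma_Re:
  assumes "Re s > 0"
  shows "norm (Gamma s) \<le> Gamma (Re s)"
proof -
  note A = Gamma_integral_complex[OF assms] and B = Gamma_integral_real[OF assms]
  have "norm (integral {0..} (\<lambda>t. complex_of_real t powr (s - 1) / of_real (exp t))) \<le>
      integral {0..} (\<lambda>t. t powr (Re s - 1) / exp t)"
    using A B by (intro integral_norm_bound_integral)
      (auto simp: has_integral_iff norm_divide norm_powr_real_powr)
  then show ?thesis using A B by (simp add: has_integral_iff)
qed

text \<open>Each use of \<open>Gamma (s + 1) = s * Gamma s\<close> gains one power of |s| and moves
  the strip by 1, hence the induction for varying \<open>a\<close> and \<open>b\<close>. Starting
  from boundedness on strips, this takes the place of Stirling's formula.\<close>

lemma norm_Gamma_mult_power_le: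
  assumes "0 < a" "a \<le> b"
  obtains C where "C > 0" "\<And>s. a \<le> Re s \<Longrightarrow> Re s \<le> b \<Longrightarrow> norm (Gamma s) * (1 + norm s) ^ m \<le> C"
proof -
  have "\<exists>C>0. \<forall>s. a \<le> Re s \<longrightarrow> Re s \<le> b \<longrightarrow> norm (Gamma s) * (1 + norm s) ^ m \<le> C"
    using assms
  proof (induction m arbitrary: a b)
    case 0
    have "continuous_on {a..b} (Gamma :: real \<Rightarrow> real)"
      using 0 by (intro continuous_intros) (auto elim!: nonpos_Ints_cases)
    then have "bounded (Gamma ` {a..b} :: real set)"
      by (intro compact_imp_bounded compact_continuous_image) auto
    then obtain C where C: "C > 0" "\<forall>y\<in>Gamma ` {a..b}. norm (y::real) \<le> C"
      unfolding bounded_pos by blast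
    have "norm (Gamma s) \<le> C" if "a \<le> Re s" "Re s \<le> b" for s
    proof -
      have "norm (Gamma s) \<le> Gamma (Re s)" using that 0 by (intro norm_Gamma_le_Gamma_Re) auto
      also have "\<dots> \<le> norm (Gamma (Re s))" by simp
      also have "\<dots> \<le> C" using C that by auto
      finally show ?thesis .
    qed
    then show ?case using C by auto
  next
    case (Suc m)
    have "\<exists>C>0. \<forall>s. a + 1 \<le> Re s \<longrightarrow> Re s \<le> b + 1 \<longrightarrow> norm (Gamma s) * (1 + norm s) ^ m \<le> C"
      using Suc.prems by (intro Suc.IH) auto
    then obtain C where C: "C > 0"
      "\<And>s. a + 1 \<le> Re s \<Longrightarrow> Re s \<le> b + 1 \<Longrightarrow> norm (Gamma s) * (1 + norm s) ^ m \<le> C"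
      by blast
    have "norm (Gamma s) * (1 + norm s) ^ Suc m \<le> (1 + 1 / a) * C" if s: "a \<le> Re s" "Re s \<le> b" for s
    proof -
      have "Re s > 0" using s Suc by auto
      then have "s \<notin> \<int>\<^sub>\<le>\<^sub>0" by (auto elim!: nonpos_Ints_cases)
      then have G: "Gamma (s + 1) = s * Gamma s" by (rule Gamma_plus1)
      have "a \<le> norm s" using s complex_Re_le_cmod[of s] by linarith
      \<comment> \<open>Since |s| \<ge> a, the summand 1 is at most |s| / a.\<close>
      then have 1: "1 + norm s \<le> (1 + 1 / a) * norm s"
        using Suc.prems by (simp add: field_simps)
      have "norm s \<le> norm (s + 1)"
        using \<open>Re s > 0\<close> unfolding cmod_def by (intro real_sqrt_le_mono) (auto simp: power2_eq_square algebra_simps)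
      then have 2: "(1 + norm s) ^ m \<le> (1 + norm (s + 1)) ^ m"
        by (intro power_mono) auto
      have "norm (Gamma s) * (1 + norm s) ^ Suc m = (1 + norm s) * (norm (Gamma s) * (1 + norm s) ^ m)" by simp
      also have "\<dots> \<le> ((1 + 1 / a) * norm s) * (norm (Gamma s) * (1 + norm (s + 1)) ^ m)"
        using 1 2 Suc.prems by (intro mult_mono) (auto intro!: mult_nonneg_nonneg)
      also have "\<dots> = (1 + 1 / a) * (norm (Gamma (s + 1)) * (1 + norm (s + 1)) ^ m)"
        by (simp add: G norm_mult)
      also have "\<dots> \<le> (1 + 1 / a) * C"
        using s Suc.prems by (intro mult_left_mono C) auto
      finally show ?thesis .
    qed
    moreover have "(1 + 1 / a) * C > 0" using C Suc.prems by (intro mult_pos_pos add_pos_pos) auto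
    ultimately show ?case by blast
  qed
  with that show thesis by blast
qed

lemma integrable_inverse_1_plus_square: "integrable lborel (\<lambda>y::real. 1 / (1 + y\<^sup>2))"
proof -
  have "set_integrable lborel (einterval (-\<infinity>) \<infinity>) (\<lambda>y::real. 1 / (1 + y\<^sup>2))"
  proof (rule interval_integral_FTC_nonneg)
    show "((arctan \<circ> real_of_ereal) \<longlongrightarrow> - (pi / 2)) (at_right (-\<infinity>))"
      "((arctan \<circ> real_of_ereal) \<longlongrightarrow> pi / 2) (at_left \<infinity>)"
      by (simp_all add: ereal_tendsto_simps tendsto_arctan_at_top tendsto_arctan_at_bot)
    show "DERIV arctan x :> 1 / (1 + x\<^sup>2)" for x
      using DERIV_arctan[of x] by (simp add: inverse_eq_divide)
    show "isCont (\<lambda>y. 1 / (1 + y\<^sup>2)) x" for x :: real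
      by (intro continuous_intros) (simp add: add_nonneg_eq_0_iff)
  qed auto
  then show ?thesis by (simp add: set_integrable_def)
qed

section \<open>Integrals along vertical lines and shifts of the contour\<close>

lemma integrable_vertical_line:
  fixes F :: "complex \<Rightarrow> complex"
  assumes "continuous_on {s. Re s = c} F"
    and bound: "\<And>y. norm (F (Complex c y)) \<le> C / (1 + y\<^sup>2)"
  shows "integrable lborel (\<lambda>y. F (Complex c y))"
proof (rule Bochner_Integration.integrable_bound)
  show "integrable lborel (\<lambda>y. C * (1 / (1 + y\<^sup>2)))"
    by (intro integrable_mult_right integrable_inverse_1_plus_square)
  have "continuous_on UNIV (\<lambda>y. F (Complex c y))"
    by (rule continuous_on_compose2[OF assms(1)]) (auto simp: Complex_eq intro!: continuous_intros)
  then show "(\<lambda>y. F (Complex c y)) \<in> borel_measurable lborel"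
    by (simp add: borel_measurable_continuous_onI)
  have "norm (F (Complex c y)) \<le> \<bar>C / (1 + y\<^sup>2)\<bar>" for y
    using bound[of y] by linarith
  then show "AE y in lborel. norm (F (Complex c y)) \<le> norm (C * (1 / (1 + y\<^sup>2)))"
    by (intro AE_I2) simp
qed

lemma tendsto_integral_symmetric:
  fixes f :: "real \<Rightarrow> complex"
  assumes "integrable lborel f"
  shows "(\<lambda>n. integral {- real n..real n} f) \<longlonglongrightarrow> integral\<^sup>L lborel f"
proof -
  have [measurable]: "f \<in> borel_measurable borel"
    using borel_measurable_integrable[OF assms] by simp
  have "(\<lambda>n. LBINT y. indicator {- real n..real n} y *\<^sub>R f y) \<longlonglongrightarrow> integral\<^sup>L lborel f"
  proof (rule integral_dominated_convergence)
    show "integrable lborel (\<lambda>y. norm (f y))" using assms by (rule integrable_norm)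
    show "AE y in lborel. (\<lambda>n. indicator {- real n..real n} y *\<^sub>R f y) \<longlonglongrightarrow> f y"
    proof (intro AE_I2 tendsto_eventually)
      fix y :: real
      show "\<forall>\<^sub>F n in sequentially. indicator {- real n..real n} y *\<^sub>R f y = f y"
        using eventually_ge_at_top[of "nat \<lceil>\<bar>y\<bar>\<rceil>"]
      proof eventually_elim
        case (elim n)
        then have "\<bar>y\<bar> \<le> real n" by linarith
        then show ?case by (simp add: indicator_def abs_le_iff)
      qed
    qed
  qed (auto simp: indicator_def)
  moreover have "(LBINT y. indicator {- real n..real n} y *\<^sub>R f y) = integral {- real n..real n} f" for n
  proof -
    have "set_integrable lborel {- real n..real n} f"
      using assms unfolding set_integrable_def by (intro integrable_mult_indicator) auto
    then show ?thesis
      using set_borel_integral_eq_integral(2) by (simp add: set_lebesgue_integral_def)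
  qed
  ultimately show ?thesis by simp
qed

text \<open>The integral over the rectangle stays \<open>K\<close> as its height grows, while the
  horizontal sides vanish by quadratic decay. Asking for decay at |Im s| \<ge> 1 only leaves room
  for a pole on the real axis.\<close>

lemma vertical_line_integrals_diff:
  fixes F :: "complex \<Rightarrow> complex"
  assumes "a < b"
    and rect: "\<And>T. T \<ge> 1 \<Longrightarrow> (F has_contour_integral K) (rectpath (Complex a (- T)) (Complex b T))"
    and int_a: "integrable lborel (\<lambda>y. F (Complex a y))" and int_b: "integrable lborel (\<lambda>y. F (Complex b y))"
    and bound: "\<And>s. a \<le> Re s \<Longrightarrow> Re s \<le> b \<Longrightarrow> \<bar>Im s\<bar> \<ge> 1 \<Longrightarrow> norm (F s) \<le> C / (1 + (Im s)\<^sup>2)"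
  shows "\<i> * ((\<integral>y. F (Complex b y) \<partial>lborel) - (\<integral>y. F (Complex a y) \<partial>lborel)) = K"
proof -
  \<comment> \<open>For \<open>n \<ge> 1\<close> this is the contribution of the two horizontal
    sides, at heights \<open>n\<close> and \<open>-n\<close>.\<close>
  define R where "R n = K - \<i> * (integral {- real n..real n} (\<lambda>y. F (Complex b y)) -
      integral {- real n..real n} (\<lambda>y. F (Complex a y)))" for n
  have "R \<longlonglongrightarrow> K - \<i> * ((\<integral>y. F (Complex b y) \<partial>lborel) - (\<integral>y. F (Complex a y) \<partial>lborel))"
    unfolding R_def by (intro tendsto_intros tendsto_integral_symmetric int_a int_b)
  moreover have "R \<longlonglongrightarrow> 0"
  proof (rule Lim_null_comparison)
    show "\<forall>\<^sub>F n in sequentially. norm (R n) \<le> 2 * (C / (1 + (real n)\<^sup>2) * (b - a))"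
      using eventually_ge_at_top[of 1]
    proof eventually_elim
      case (elim n)
      define T where "T = real n"
      have T: "T \<ge> 1" using elim by (simp add: T_def)
      define a1 a2 a3 a4 where "a1 = Complex a (- T)" and "a2 = Complex b (- T)" and
        "a3 = Complex b T" and "a4 = Complex a T"
      have rp: "rectpath a1 a3 = linepath a1 a2 +++ linepath a2 a3 +++ linepath a3 a4 +++ linepath a4 a1"
        by (simp add: rectpath_def Let_def a1_def a2_def a3_def a4_def)
      have hc: "(F has_contour_integral K) (rectpath a1 a3)"
        unfolding a1_def a3_def by (rule rect[OF T])
      then have "F contour_integrable_on (rectpath a1 a3)"
        by (auto simp: contour_integrable_on_def)
      then have ci: "F contour_integrable_on (linepath a1 a2)" "F contour_integrable_on (linepath a2 a3)"
        "F contour_integrable_on (linepath a3 a4)" "F contour_integrable_on (linepath a4 a1)"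
        unfolding rp by simp_all
      have "K = contour_integral (rectpath a1 a3) F" using hc by (simp add: contour_integral_unique)
      also have "\<dots> = contour_integral (linepath a1 a2) F + (contour_integral (linepath a2 a3) F +
          (contour_integral (linepath a3 a4) F + contour_integral (linepath a4 a1) F))"
        using ci unfolding rp by (simp add: contour_integral_join)
      also have "contour_integral (linepath a2 a3) F = \<i> * integral {- T..T} (\<lambda>y. F (Complex b y))"
        by (rule contour_integral_linepath_same_Re) (use T in \<open>auto simp: a2_def a3_def\<close>)
      also have "contour_integral (linepath a4 a1) F = - (\<i> * integral {- T..T} (\<lambda>y. F (Complex a y)))"
      proof -
        have "contour_integral (reversepath (linepath a1 a4)) F = - contour_integral (linepath a1 a4) F"
          by (rule contour_integral_reversepath) simp
        moreover have "contour_integral (linepath a1 a4) F = \<i> * integral {- T..T} (\<lambda>y. F (Complex a y))"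
          by (rule contour_integral_linepath_same_Re) (use T in \<open>auto simp: a1_def a4_def\<close>)
        ultimately show ?thesis by simp
      qed
      finally have Req: "R n = contour_integral (linepath a1 a2) F + contour_integral (linepath a3 a4) F"
        by (simp add: R_def T_def algebra_simps)
      have le: "norm (F s) \<le> C / (1 + T\<^sup>2)" if "s \<in> closed_segment a1 a2 \<union> closed_segment a3 a4" for s
      proof -
        have "a \<le> Re s" "Re s \<le> b" "\<bar>Im s\<bar> = T"
          using that T \<open>a < b\<close>
          by (auto simp: a1_def a2_def a3_def a4_def closed_segment_same_Im closed_segment_eq_real_ivl split: if_splits)
        then show ?thesis using bound[of s] T by (metis power2_abs)
      qed
      have "0 \<le> C / (1 + T\<^sup>2)"
        using le[of a1] norm_ge_zero order_trans by blast
      then have "norm (contour_integral (linepath a1 a2) F) \<le> C / (1 + T\<^sup>2) * norm (a2 - a1)"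
        "norm (contour_integral (linepath a3 a4) F) \<le> C / (1 + T\<^sup>2) * norm (a4 - a3)"
        using le ci by (intro contour_integral_bound_linepath; auto)+
      moreover have "norm (a2 - a1) = b - a" "norm (a4 - a3) = b - a"
        using \<open>a < b\<close> by (auto simp: a1_def a2_def a3_def a4_def cmod_def)
      ultimately show ?case
        unfolding Req T_def[symmetric]
        using norm_triangle_ineq[of "contour_integral (linepath a1 a2) F" "contour_integral (linepath a3 a4) F"]
        by simp
    qed
    have "(\<lambda>n. inverse (1 + (real n)\<^sup>2)) \<longlonglongrightarrow> 0"
      by (intro tendsto_inverse_0_at_top filterlim_tendsto_add_at_top[OF tendsto_const] filterlim_pow_at_top filterlim_real_sequentially) auto
    then have "(\<lambda>n. 2 * (C * inverse (1 + (real n)\<^sup>2) * (b - a))) \<longlonglongrightarrow> 2 * (C * 0 * (b - a))"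
      by (intro tendsto_intros)
    then show "(\<lambda>n. 2 * (C / (1 + (real n)\<^sup>2) * (b - a))) \<longlonglongrightarrow> 0"
      by (simp add: divide_inverse)
  qed
  ultimately have "K - \<i> * ((\<integral>y. F (Complex b y) \<partial>lborel) - (\<integral>y. F (Complex a y) \<partial>lborel)) = 0"
    by (rule LIMSEQ_unique)
  then show ?thesis by simp
qed

lemma path_image_rectpath_strip:
  assumes "a < b" "T > 0"
  shows "path_image (rectpath (Complex a (- T)) (Complex b T)) \<subseteq> {s. a \<le> Re s \<and> Re s \<le> b} - {s. a < Re s \<and> Re s < b \<and> \<bar>Im s\<bar> < T}"
  using assms path_image_rectpath_cbox_minus_box[of "Complex a (- T)" "Complex b T"]
  by (auto simp: in_cbox_complex_iff in_box_complex_iff)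

lemma vertical_line_shift:
  fixes F :: "complex \<Rightarrow> complex"
  assumes "a < b" "open S" "convex S" "F holomorphic_on S" and strip: "{s. a \<le> Re s \<and> Re s \<le> b} \<subseteq> S"
    and bound: "\<And>s. a \<le> Re s \<Longrightarrow> Re s \<le> b \<Longrightarrow> norm (F s) \<le> C / (1 + (Im s)\<^sup>2)"
  shows "(\<integral>y. F (Complex a y) \<partial>lborel) = (\<integral>y. F (Complex b y) \<partial>lborel)"
    and "integrable lborel (\<lambda>y. F (Complex a y))"
proof -
  have cont: "continuous_on {s. Re s = c} F" if "a \<le> c" "c \<le> b" for c
    by (rule continuous_on_subset[OF holomorphic_on_imp_continuous_on[OF assms(4)]]) (use that strip in auto)
  have int: "integrable lborel (\<lambda>y. F (Complex c y))" if "a \<le> c" "c \<le> b" for c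
    by (rule integrable_vertical_line[OF cont[OF that], of C]) (use that bound[of "Complex c _"] in auto)
  show "integrable lborel (\<lambda>y. F (Complex a y))" using assms by (intro int) auto
  have "\<i> * ((\<integral>y. F (Complex b y) \<partial>lborel) - (\<integral>y. F (Complex a y) \<partial>lborel)) = 0"
  proof (rule vertical_line_integrals_diff)
    fix T :: real assume "T \<ge> 1"
    then show "(F has_contour_integral 0) (rectpath (Complex a (- T)) (Complex b T))"
      using path_image_rectpath_strip[of a b T] assms
      by (intro Cauchy_theorem_convex_simple[OF assms(4,3)]) auto
  qed (use assms int in auto)
  then show "(\<integral>y. F (Complex a y) \<partial>lborel) = (\<integral>y. F (Complex b y) \<partial>lborel)" by simp
qed

text \<open>Cauchy's integral formula for \<open>f\<close> gives the value over the rectangle. The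
  estimate is required only away from the pole: on the two vertical lines and at height at least
  1.\<close>

lemma vertical_line_shift_pole:
  fixes f :: "complex \<Rightarrow> complex" and p :: real
  assumes "a < p" "p < b" "open S" "convex S" "f holomorphic_on S"
    and strip: "{s. a \<le> Re s \<and> Re s \<le> b} \<subseteq> S"
    and bound: "\<And>s. a \<le> Re s \<Longrightarrow> Re s \<le> b \<Longrightarrow> \<bar>Im s\<bar> \<ge> 1 \<or> Re s = a \<or> Re s = b \<Longrightarrow>
                   norm (f s / (s - of_real p)) \<le> C / (1 + (Im s)\<^sup>2)"
  defines "F \<equiv> \<lambda>s. f s / (s - of_real p)"
  shows "(\<integral>y. F (Complex b y) \<partial>lborel) - (\<integral>y. F (Complex a y) \<partial>lborel) = 2 * of_real pi * f (of_real p)"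
    and "integrable lborel (\<lambda>y. F (Complex a y))" and "integrable lborel (\<lambda>y. F (Complex b y))"
proof -
  have "F holomorphic_on (S - {of_real p})"
    unfolding F_def using assms(5) by (intro holomorphic_intros holomorphic_on_subset[OF assms(5)]) auto
  then have contF: "continuous_on (S - {of_real p}) F" by (rule holomorphic_on_imp_continuous_on)
  have int: "integrable lborel (\<lambda>y. F (Complex c y))" if "c = a \<or> c = b" for c
  proof (rule integrable_vertical_line[of _ _ C])
    show "continuous_on {s. Re s = c} F"
      by (rule continuous_on_subset[OF contF]) (use that strip assms(1,2) in auto)
    show "norm (F (Complex c y)) \<le> C / (1 + y\<^sup>2)" for y
      using that bound[of "Complex c y"] assms(1,2) by (auto simp: F_def)
  qed
  then show int_ab: "integrable lborel (\<lambda>y. F (Complex a y))" "integrable lborel (\<lambda>y. F (Complex b y))" by auto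
  have "\<i> * ((\<integral>y. F (Complex b y) \<partial>lborel) - (\<integral>y. F (Complex a y) \<partial>lborel)) = 2 * pi * \<i> * f (of_real p)"
  proof (rule vertical_line_integrals_diff[of a b F _ C])
    fix T :: real assume T: "T \<ge> 1"
    let ?g = "rectpath (Complex a (- T)) (Complex b T)"
    have "winding_number ?g (of_real p) = 1"
      using assms(1,2) T by (intro winding_number_rectpath) (auto simp: in_box_complex_iff)
    moreover have "((\<lambda>w. f w / (w - of_real p)) has_contour_integral
         2 * pi * \<i> * winding_number ?g (of_real p) * f (of_real p)) ?g"
      using path_image_rectpath_strip[of a b T] strip assms(1,2) T
      by (intro Cauchy_integral_formula_convex_simple[OF assms(4,5)])
         (auto simp: interior_open[OF assms(3)])
    ultimately show "(F has_contour_integral 2 * pi * \<i> * f (of_real p)) ?g"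
      by (simp add: F_def)
  qed (use assms int_ab in \<open>auto simp: F_def\<close>)
  then show "(\<integral>y. F (Complex b y) \<partial>lborel) - (\<integral>y. F (Complex a y) \<partial>lborel) = 2 * of_real pi * f (of_real p)"
    by (simp add: mult_ac)
qed

section \<open>Inverse Mellin integral of Gamma and the residues at its poles\<close>

lemma notin_nonpos_Ints_Re:
  assumes "\<And>j::nat. Re s \<noteq> - real j"
  shows "s \<notin> \<int>\<^sub>\<le>\<^sub>0"
proof
  assume "s \<in> \<int>\<^sub>\<le>\<^sub>0"
  then obtain n where "s = - of_nat n" by (elim nonpos_Ints_cases')
  then show False using assms[of n] by simp
qed

text \<open>Parity. It keeps the lines at half-integral abscissas off the poles of Gamma.\<close>

lemma half_plus_of_nat_neq: "1 / 2 + real N \<noteq> real j"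
proof
  assume "1 / 2 + real N = real j"
  then have "real (2 * N + 1) = real (2 * j)" by simp
  then have "2 * N + 1 = 2 * j" unfolding of_nat_eq_iff .
  then show False by presburger
qed

text \<open>The Mellin inversion integral along Re s = c, taken in y = Im s and without the
  normalisation 1 / (2 * pi), whence the factors 2 * pi in its values.\<close>

definition Gamma_line :: "real \<Rightarrow> real \<Rightarrow> complex" where
  "Gamma_line x c = (\<integral>y. Gamma (Complex c y) * of_real x powr (- Complex c y) \<partial>lborel)"

text \<open>The modulus \<open>x powr (- Re s)\<close> is monotone in Re s, in a direction depending
  on whether x > 1. Adding the values at both ends covers the two cases.\<close>

lemma norm_powr_minus_le:
  assumes "x > (0::real)" "a \<le> Re s" "Re s \<le> b"
  shows "norm (of_real x powr (- s)) \<le> x powr (- a) + x powr (- b)"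
proof -
  have "norm (of_real x powr (- s)) = x powr (- Re s)"
    using assms by (subst norm_powr_real_powr) auto
  also have "\<dots> \<le> x powr (- a) + x powr (- b)"
  proof (cases "x \<ge> 1")
    case True
    then have "x powr (- Re s) \<le> x powr (- a)" using assms by (intro powr_mono) auto
    moreover have "0 \<le> x powr (- b)" by simp
    ultimately show ?thesis by linarith
  next
    case False
    then have "x powr (- Re s) \<le> x powr (- b)" using assms by (intro powr_mono') auto
    moreover have "0 \<le> x powr (- a)" by simp
    ultimately show ?thesis by linarith
  qed
  finally show ?thesis .
qed

lemma norm_Gamma_le_strip:
  assumes "0 < a" "a \<le> b"
  obtains C where "C > 0" "\<And>s. a \<le> Re s \<Longrightarrow> Re s \<le> b \<Longrightarrow> norm (Gamma s) \<le> C / (1 + (Im s)\<^sup>2)"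
proof -
  obtain C where C: "C > 0" "\<And>s. a \<le> Re s \<Longrightarrow> Re s \<le> b \<Longrightarrow> norm (Gamma s) * (1 + norm s) ^ 2 \<le> C"
    using norm_Gamma_mult_power_le[OF assms, of 2] by blast
  have "norm (Gamma s) \<le> C / (1 + (Im s)\<^sup>2)" if s: "a \<le> Re s" "Re s \<le> b" for s
  proof -
    have "\<bar>Im s\<bar>\<^sup>2 \<le> (norm s)\<^sup>2" by (intro power_mono abs_Im_le_cmod) auto
    moreover have "(1 + norm s)\<^sup>2 = 1 + (norm s)\<^sup>2 + 2 * norm s"
      by (simp add: power2_eq_square algebra_simps)
    ultimately have "1 + (Im s)\<^sup>2 \<le> (1 + norm s)\<^sup>2"
      using norm_ge_zero[of s] unfolding power2_abs by linarith
    then have "norm (Gamma s) * (1 + (Im s)\<^sup>2) \<le> norm (Gamma s) * (1 + norm s)\<^sup>2"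
      by (intro mult_left_mono) auto
    also have "\<dots> \<le> C" using C s by auto
    finally show ?thesis by (simp add: pos_le_divide_eq add_pos_nonneg)
  qed
  with C that show thesis by blast
qed

lemma Gamma_line_shift:
  assumes "0 < a" "a < b" "x > 0"
  shows "Gamma_line x a = Gamma_line x b"
    and "integrable lborel (\<lambda>y. Gamma (Complex a y) * of_real x powr (- Complex a y))"
proof -
  obtain C where C: "C > 0" "\<And>s. a \<le> Re s \<Longrightarrow> Re s \<le> b \<Longrightarrow> norm (Gamma s) \<le> C / (1 + (Im s)\<^sup>2)"
    using norm_Gamma_le_strip[of a b] assms by auto
  let ?F = "\<lambda>s. Gamma s * of_real x powr (- s)"
  have hol: "?F holomorphic_on {s. Re s > 0}"
    using assms by (intro holomorphic_intros) (auto elim!: nonpos_Ints_cases)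
  have bd: "norm (?F s) \<le> C * (x powr (- a) + x powr (- b)) / (1 + (Im s)\<^sup>2)" if "a \<le> Re s" "Re s \<le> b" for s
  proof -
    have "norm (?F s) \<le> C / (1 + (Im s)\<^sup>2) * (x powr (- a) + x powr (- b))"
      unfolding norm_mult using C assms that by (intro mult_mono norm_powr_minus_le) auto
    then show ?thesis by simp
  qed
  show "Gamma_line x a = Gamma_line x b"
    unfolding Gamma_line_def
    by (rule vertical_line_shift(1)[OF assms(2) open_halfspace_Re_gt convex_halfspace_Re_gt hol _ bd])
       (use assms in auto)
  show "integrable lborel (\<lambda>y. Gamma (Complex a y) * of_real x powr (- Complex a y))"
    by (rule vertical_line_shift(2)[OF assms(2) open_halfspace_Re_gt convex_halfspace_Re_gt hol _ bd])
       (use assms in auto)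
qed

text \<open>Write Gamma s as Gamma (s + N + 1) divided by s * ... * (s + N): the last factor is the
  pole at -N, the others are kept in \<open>f\<close>. On the strip the shifted argument has real
  part in [1/2, 3/2], where the decay of Gamma is known.\<close>

lemma Gamma_line_residue:
  assumes "x > 0"
  shows "Gamma_line x (1 / 2 - real N) = Gamma_line x (- 1 / 2 - real N) + 2 * of_real pi * (of_real ((- x) ^ N / fact N))"
    and Gamma_line_integrable_half:
      "integrable lborel (\<lambda>y. Gamma (Complex (- 1 / 2 - real N) y) * of_real x powr (- Complex (- 1 / 2 - real N) y))"
proof -
  define a b where "a = - 1 / 2 - real N" and "b = 1 / 2 - real N"
  \<comment> \<open>The widest open strip around -N that avoids the neighbouring poles -N - 1 and 1
    - N.\<close>
  define S where "S = {s. Re s > - 1 - real N} \<inter> {s. Re s < 1 - real N}"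
  define f where "f s = Gamma (s + of_nat (Suc N)) * of_real x powr (- s) / pochhammer s N" for s :: complex
  obtain C where C: "C > 0" "\<And>s. 1 / 2 \<le> Re s \<Longrightarrow> Re s \<le> 3 / 2 \<Longrightarrow> norm (Gamma s) \<le> C / (1 + (Im s)\<^sup>2)"
    using norm_Gamma_le_strip[of "1/2" "3/2"] by auto
  have poch: "pochhammer s N \<noteq> 0" if "s \<in> S" for s
    unfolding pochhammer_eq_0_iff using that by (auto simp: S_def)
  have G: "Gamma s = Gamma (s + of_nat (Suc N)) / pochhammer s (Suc N)" if "s \<notin> \<int>\<^sub>\<le>\<^sub>0" for s
  proof -
    have "Gamma s \<noteq> 0" using that by (simp add: Gamma_eq_zero_iff)
    moreover have "pochhammer s (Suc N) \<noteq> 0"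
      unfolding pochhammer_eq_0_iff using that by auto
    moreover have "pochhammer s (Suc N) * Gamma s = Gamma (s + of_nat (Suc N))"
      unfolding pochhammer_Gamma[OF that, of "Suc N"] using \<open>Gamma s \<noteq> 0\<close> by (simp del: of_nat_Suc)
    ultimately show ?thesis by (metis nonzero_mult_div_cancel_left)
  qed
  have F: "f s / (s - of_real (- real N)) = Gamma s * of_real x powr (- s)" if "s \<notin> \<int>\<^sub>\<le>\<^sub>0" for s
    unfolding G[OF that] f_def pochhammer_Suc by (simp add: mult_ac add_ac)
  have nn: "Complex a y \<notin> \<int>\<^sub>\<le>\<^sub>0" "Complex b y \<notin> \<int>\<^sub>\<le>\<^sub>0" for y
  proof -
    have "- 1 / 2 - real N \<noteq> - real j" "1 / 2 - real N \<noteq> - real j" for j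
      using half_plus_of_nat_neq[of N j] half_plus_of_nat_neq[of j N] by linarith+
    then show "Complex a y \<notin> \<int>\<^sub>\<le>\<^sub>0" "Complex b y \<notin> \<int>\<^sub>\<le>\<^sub>0"
      unfolding a_def b_def by (intro notin_nonpos_Ints_Re; simp)+
  qed
  \<comment> \<open>Half-integral abscissas are at distance at least 1/2 from every integer. This is
    the origin of the constant \<open>(1 / 2) ^ Suc N\<close> below.\<close>
  have half: "1 / 2 \<le> norm (s + of_nat j)" if "\<bar>Im s\<bar> \<ge> 1 \<or> Re s = a \<or> Re s = b" "j \<le> N" for s :: complex and j
  proof (cases "\<bar>Im s\<bar> \<ge> 1")
    case True
    then show ?thesis using abs_Im_le_cmod[of "s + of_nat j"] by simp
  next
    case False
    then have "\<bar>Re (s + of_nat j)\<bar> \<ge> 1 / 2"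
      using that by (cases "j = N") (auto simp: a_def b_def)
    then show ?thesis using abs_Re_le_cmod[of "s + of_nat j"] by linarith
  qed
  have bound: "norm (f s / (s - of_real (- real N))) \<le> (C * (x powr (- a) + x powr (- b)) / (1 / 2) ^ Suc N) / (1 + (Im s)\<^sup>2)"
    if s: "a \<le> Re s" "Re s \<le> b" "\<bar>Im s\<bar> \<ge> 1 \<or> Re s = a \<or> Re s = b" for s
  proof -
    have "(1 / 2) ^ Suc N = (\<Prod>j<Suc N. 1 / 2 :: real)" by simp
    also have "\<dots> \<le> (\<Prod>j<Suc N. norm (s + of_nat j))"
      using half s(3) by (intro prod_mono) auto
    also have "\<dots> = norm (pochhammer s (Suc N))"
      by (simp add: pochhammer_prod prod_norm atLeast0LessThan del: prod.lessThan_Suc)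
    finally have P: "(1 / 2) ^ Suc N \<le> norm (pochhammer s (Suc N))" .
    have "norm (f s / (s - of_real (- real N))) =
        norm (Gamma (s + of_nat (Suc N))) * norm (of_real x powr (- s)) / norm (pochhammer s (Suc N))"
      by (simp add: f_def pochhammer_Suc norm_mult norm_divide mult_ac add_ac)
    also have "\<dots> \<le> (C / (1 + (Im s)\<^sup>2) * (x powr (- a) + x powr (- b))) / (1 / 2) ^ Suc N"
    proof (rule frac_le[OF _ mult_mono])
      show "norm (Gamma (s + of_nat (Suc N))) \<le> C / (1 + (Im s)\<^sup>2)"
        using C(2)[of "s + of_nat (Suc N)"] s by (auto simp: a_def b_def)
      show "norm (of_real x powr (- s)) \<le> x powr (- a) + x powr (- b)"
        using assms s by (intro norm_powr_minus_le) auto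
    qed (use C P in \<open>auto intro!: mult_nonneg_nonneg divide_nonneg_nonneg\<close>)
    also have "\<dots> = (C * (x powr (- a) + x powr (- b)) / (1 / 2) ^ Suc N) / (1 + (Im s)\<^sup>2)"
      by simp
    finally show "norm (f s / (s - of_real (- real N))) \<le> (C * (x powr (- a) + x powr (- b)) / (1 / 2) ^ Suc N) / (1 + (Im s)\<^sup>2)" .
  qed
  have strip: "a < - real N" "- real N < b" "open S" "convex S" "f holomorphic_on S" "{s. a \<le> Re s \<and> Re s \<le> b} \<subseteq> S"
  proof -
    show "a < - real N" "- real N < b" by (auto simp: a_def b_def)
    show "open S" "convex S" unfolding S_def
      by (auto intro!: open_Int convex_Int simp: open_halfspace_Re_gt open_halfspace_Re_lt convex_halfspace_Re_gt convex_halfspace_Re_lt)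
    show "f holomorphic_on S"
      unfolding f_def[abs_def] using assms poch
      by (intro holomorphic_intros) (auto simp: S_def intro!: notin_nonpos_Ints_Re)
    show "{s. a \<le> Re s \<and> Re s \<le> b} \<subseteq> S" by (auto simp: S_def a_def b_def)
  qed
  note shift = vertical_line_shift_pole[OF strip bound]
  show "integrable lborel (\<lambda>y. Gamma (Complex (- 1 / 2 - real N) y) * of_real x powr (- Complex (- 1 / 2 - real N) y))"
    using shift(2) unfolding F[OF nn(1)] by (simp add: a_def)
  have "f (of_real (- real N)) = of_real ((- x) ^ N / fact N)"
  proof -
    have "pochhammer (- complex_of_nat N) N = (-1) ^ N * fact N"
      by (simp add: pochhammer_same)
    moreover have "complex_of_real x powr of_nat N = of_real x ^ N"
      using assms by (simp add: powr_nat)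
    ultimately show ?thesis
      by (simp add: f_def power_minus[of "complex_of_real x"] divide_simps)
  qed
  then show "Gamma_line x (1 / 2 - real N) = Gamma_line x (- 1 / 2 - real N) + 2 * of_real pi * (of_real ((- x) ^ N / fact N))"
    using shift(1) unfolding F[OF nn(1)] F[OF nn(2)] by (simp add: Gamma_line_def a_def b_def algebra_simps)
qed

text \<open>The factor at i = 0 accounts for the 1/2, and each later factor exceeds i.\<close>

lemma fact_le_prod_half: "fact N / 2 \<le> (\<Prod>i<Suc N. real i + 1 / 2)"
proof (induction N)
  case (Suc N)
  have "fact (Suc N) / 2 = (fact N / 2) * real (Suc N)" by simp
  also have "\<dots> \<le> (\<Prod>i<Suc N. real i + 1 / 2) * (real (Suc N) + 1 / 2)"
    using Suc by (intro mult_mono prod_nonneg) auto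
  finally show ?case by (simp only: prod.lessThan_Suc[of _ "Suc N"])
qed simp

text \<open>Shifting Gamma by N + 1 lands on Re = 1/2 and leaves a product of modulus at least N! /
  2 in the denominator, while the power of x has modulus x ^ N * sqrt x. Hence the integral
  remaining after N + 1 residues tends to 0.\<close>

lemma norm_Gamma_line_le:
  assumes "x > 0"
  shows "norm (Gamma_line x (- 1 / 2 - real N)) \<le>
    (2 * sqrt x * (\<integral>y. norm (Gamma (Complex (1 / 2) y)) \<partial>lborel)) * (x ^ N / fact N)"
proof -
  define c where "c = - 1 / 2 - real N"
  have int: "integrable lborel (\<lambda>y. norm (Gamma (Complex (1 / 2) y)))"
    using Gamma_line_shift(2)[of "1/2" 1 1] by (intro integrable_norm) simp
  have le: "norm (Gamma (Complex c y) * of_real x powr (- Complex c y)) \<le>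
      (2 * sqrt x * (x ^ N / fact N)) * norm (Gamma (Complex (1 / 2) y))" for y
  proof -
    let ?s = "Complex c y"
    have "c \<noteq> - real j" for j
      using half_plus_of_nat_neq[of N j] unfolding c_def by linarith
    then have s: "?s \<notin> \<int>\<^sub>\<le>\<^sub>0" by (intro notin_nonpos_Ints_Re) auto
    have "fact N / 2 \<le> (\<Prod>i<Suc N. real i + 1 / 2)" by (rule fact_le_prod_half)
    \<comment> \<open>Reversing the product matches the factor N - i + 1/2 with |Re (s + i)|, as Re
      s = -1/2 - N.\<close>
    also have "\<dots> = (\<Prod>i<Suc N. real (Suc N - Suc i) + 1 / 2)"
      by (rule prod.nat_diff_reindex[symmetric])
    also have "\<dots> \<le> (\<Prod>i<Suc N. norm (?s + of_nat i))"
    proof (intro prod_mono conjI)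
      fix i assume "i \<in> {..<Suc N}"
      then have "real (Suc N - Suc i) + 1 / 2 = \<bar>Re (?s + of_nat i)\<bar>"
        by (simp add: c_def of_nat_diff)
      also have "\<dots> \<le> norm (?s + of_nat i)" by (rule abs_Re_le_cmod)
      finally show "real (Suc N - Suc i) + 1 / 2 \<le> norm (?s + of_nat i)" .
    qed auto
    also have "\<dots> = norm (pochhammer ?s (Suc N))"
      by (simp add: pochhammer_prod prod_norm atLeast0LessThan del: prod.lessThan_Suc)
    finally have P: "fact N / 2 \<le> norm (pochhammer ?s (Suc N))" .
    have "?s + of_nat (Suc N) = Complex (1 / 2) y"
      by (simp add: complex_eq_iff c_def)
    then have "norm (pochhammer ?s (Suc N)) * norm (Gamma ?s) = norm (Gamma (Complex (1 / 2) y))"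
      using pochhammer_Gamma[OF s, of "Suc N"] s by (simp add: norm_divide Gamma_eq_zero_iff)
    with P have "fact N / 2 * norm (Gamma ?s) \<le> norm (Gamma (Complex (1 / 2) y))"
      by (metis mult_right_mono norm_ge_zero)
    then have 1: "norm (Gamma ?s) \<le> 2 / fact N * norm (Gamma (Complex (1 / 2) y))"
      by (simp add: field_simps)
    have "norm (of_real x powr (- ?s)) = x powr (real N + 1 / 2)"
      using assms by (subst norm_powr_real_powr) (auto simp: c_def add.commute)
    also have "\<dots> = x ^ N * sqrt x"
      using assms by (simp add: powr_add powr_realpow powr_half_sqrt)
    finally have 2: "norm (of_real x powr (- ?s)) = x ^ N * sqrt x" .
    have "norm (Gamma ?s * of_real x powr (- ?s)) \<le> 2 / fact N * norm (Gamma (Complex (1 / 2) y)) * (x ^ N * sqrt x)"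
      unfolding norm_mult 2 using 1 assms by (intro mult_right_mono) auto
    then show ?thesis by (simp add: mult_ac)
  qed
  have "norm (Gamma_line x c) \<le> (\<integral>y. (2 * sqrt x * (x ^ N / fact N)) * norm (Gamma (Complex (1 / 2) y)) \<partial>lborel)"
    unfolding Gamma_line_def
    by (rule Bochner_Integration.integral_norm_bound_integral[OF _ integrable_mult_right[OF int] le])
       (rule Gamma_line_integrable_half[OF assms, where N = N, folded c_def])
  also have "\<dots> = (2 * sqrt x * (x ^ N / fact N)) * (\<integral>y. norm (Gamma (Complex (1 / 2) y)) \<partial>lborel)"
    by (rule integral_mult_right_zero)
  finally show ?thesis by (simp add: c_def mult_ac)
qed

text \<open>Moving the line past the poles at \<open>0, -1, -2, \<dots>\<close> collects the exponential series.\<close>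

theorem Gamma_line_eq_exp:
  assumes "x > 0"
  shows "Gamma_line x 2 = 2 * of_real pi * of_real (exp (- x))"
proof -
  define e where "e N = (of_real ((- x) ^ N / fact N) :: complex)" for N
  have step: "Gamma_line x (1 / 2) = 2 * of_real pi * (\<Sum>k<N. e k) + Gamma_line x (1 / 2 - real N)" for N
  proof (induction N)
    case (Suc N)
    have "Gamma_line x (1 / 2 - real N) = Gamma_line x (1 / 2 - real (Suc N)) + 2 * of_real pi * e N"
    proof -
      have "1 / 2 - real (Suc N) = - 1 / 2 - real N" by simp
      then show ?thesis using Gamma_line_residue[OF assms, of N] by (simp only: e_def)
    qed
    with Suc show ?case by (simp add: algebra_simps)
  qed simp
  have "(\<lambda>N. of_real ((- x) ^ N /\<^sub>R fact N) :: complex) sums of_real (exp (- x))"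
    by (intro sums_of_real exp_converges)
  then have e: "(\<lambda>N. \<Sum>k<N. e k) \<longlonglongrightarrow> of_real (exp (- x))"
    by (simp add: sums_def e_def divide_inverse mult.commute)
  have "(\<lambda>N. Gamma_line x (- 1 / 2 - real N)) \<longlonglongrightarrow> 0"
  proof (rule Lim_null_comparison)
    define A where "A = 2 * sqrt x * (\<integral>y. norm (Gamma (Complex (1 / 2) y)) \<partial>lborel)"
    show "\<forall>\<^sub>F N in sequentially. norm (Gamma_line x (- 1 / 2 - real N)) \<le> A * (x ^ N / fact N)"
      unfolding A_def using norm_Gamma_line_le[OF assms] by (intro always_eventually) auto
    have "(\<lambda>N. A * (x ^ N / fact N)) \<longlonglongrightarrow> A * 0"
      using summable_LIMSEQ_zero[OF summable_exp[of x]]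
      by (intro tendsto_intros) (simp add: field_simps)
    then show "(\<lambda>N. A * (x ^ N / fact N)) \<longlonglongrightarrow> 0" by simp
  qed
  moreover have "1 / 2 - real (Suc N) = - 1 / 2 - real N" for N by simp
  ultimately have "(\<lambda>N. Gamma_line x (1 / 2 - real (Suc N))) \<longlonglongrightarrow> 0" by (simp only:)
  then have "(\<lambda>N. Gamma_line x (1 / 2 - real N)) \<longlonglongrightarrow> 0" by (rule LIMSEQ_imp_Suc)
  then have "(\<lambda>N. 2 * of_real pi * (\<Sum>k<N. e k) + Gamma_line x (1 / 2 - real N)) \<longlonglongrightarrow>
     2 * of_real pi * of_real (exp (- x)) + 0"
    by (intro tendsto_intros e)
  then have "Gamma_line x (1 / 2) = 2 * of_real pi * of_real (exp (- x))"
    unfolding step[symmetric] by (simp add: LIMSEQ_const_iff)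
  then show ?thesis using Gamma_line_shift(1)[of "1/2" 2 x] assms by simp
qed

section \<open>Lower bounds for a zero-free zeta function\<close>

text \<open>The map w / (2 * A - w) sends the half-plane Re w < A into the unit disc and fixes 0.
  The Schwarz lemma applies to its composition with the rescaled \<open>f\<close>, and solving for
  |f z| gives the bound.\<close>

lemma Borel_Caratheodory:
  fixes f :: "complex \<Rightarrow> complex"
  assumes f: "f holomorphic_on ball 0 R" "f 0 = 0" and R: "R > 0" and A: "A > 0"
    and Re: "\<And>z. norm z < R \<Longrightarrow> Re (f z) < A" and z: "norm z < R"
  shows "norm (f z) \<le> 2 * A * norm z / (R - norm z)"
proof -
  define h where "h w = f (of_real R * w) / (2 * of_real A - f (of_real R * w))" for w
  have in_ball: "norm (complex_of_real R * w) < R" if "norm w < 1" for w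
    using that R by (simp add: norm_mult)
  have ne: "2 * of_real A - f u \<noteq> 0" if "norm u < R" for u
  proof
    assume "2 * of_real A - f u = 0"
    then have "Re (f u) = 2 * A" by (simp add: complex_eq_iff)
    with Re[OF that] A show False by simp
  qed
  have lt: "norm (f u) < norm (2 * of_real A - f u)" if "norm u < R" for u
  proof -
    have "4 * A * Re (f u) < 4 * A * A" using Re[OF that] A by (intro mult_strict_left_mono) auto
    then show ?thesis
      unfolding cmod_def by (intro real_sqrt_less_mono) (simp add: power2_eq_square algebra_simps)
  qed
  have "norm (h w) \<le> norm w" if "norm w < 1" for w
  proof (rule Schwarz_Lemma(1)[OF _ _ _ that])
    have "f \<circ> (\<lambda>w. of_real R * w) holomorphic_on ball 0 1"
      by (rule holomorphic_on_compose_gen[OF _ f(1)])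
         (auto intro!: holomorphic_intros simp: in_ball simp del: norm_mult)
    then have "(\<lambda>w. f (of_real R * w)) holomorphic_on ball 0 1" by (simp add: o_def)
    then show "h holomorphic_on ball 0 1"
      unfolding h_def[abs_def] using ne in_ball by (intro holomorphic_intros) auto
    show "h 0 = 0" using f by (simp add: h_def)
    show "norm (h w) < 1" if "norm w < 1" for w
      using lt[OF in_ball[OF that]] ne[OF in_ball[OF that]] by (simp add: h_def norm_divide)
  qed
  from this[of "z / of_real R"] have le: "norm (f z / (2 * of_real A - f z)) \<le> norm z / R"
    using z R by (simp add: h_def norm_divide)
  have "norm (2 * of_real A - f z) \<le> 2 * A + norm (f z)"
    using norm_triangle_ineq4[of "2 * of_real A" "f z"] A by (simp add: norm_mult)
  moreover have "norm (f z) \<le> norm z / R * norm (2 * of_real A - f z)"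
    using le ne[OF z] by (simp add: norm_divide field_simps)
  ultimately have "norm (f z) \<le> norm z / R * (2 * A + norm (f z))"
    using R by (meson divide_nonneg_pos mult_left_mono norm_ge_zero order_trans)
  then have "norm (f z) * (R - norm z) \<le> 2 * A * norm z"
    using R by (simp add: field_simps)
  then show ?thesis using z by (simp add: pos_le_divide_eq)
qed

text \<open>The Moebius series bounds 1/zeta on this line by the sum of 1 / n^2, and |s - 1| \<ge>
  1. The points of the line become centres of discs at which a lower bound for \<open>pzeta\<close>
  is known.\<close>

lemma norm_inverse_pzeta_line_2:
  obtains K where "K > 0" "\<And>y. norm (inverse (pzeta (Complex 2 y))) \<le> K" "\<And>y. pzeta (Complex 2 y) \<noteq> 0"
proof -
  define K where "K = (\<Sum>n. real (Suc n) powr (-2))"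
  have sm: "summable (\<lambda>n. real (Suc n) powr (-2))" by (rule summable_Suc_powr) simp
  have "K > 0" unfolding K_def by (rule suminf_pos[OF sm]) auto
  have nz: "pzeta (Complex 2 y) \<noteq> 0" for y
  proof -
    have "Complex 2 y \<noteq> 1" by (simp add: complex_eq_iff)
    then show ?thesis using moebius_sums_inverse_zeta(1)[of "Complex 2 y"] by (simp add: pzeta_def)
  qed
  have "norm (inverse (pzeta (Complex 2 y))) \<le> K" for y
  proof -
    let ?s = "Complex 2 y"
    have "norm (1 / zeta ?s) = norm (\<Sum>n. of_int (moebius (Suc n)) / of_nat (Suc n) powr ?s)"
      using moebius_sums_inverse_zeta(2)[of ?s] by (simp add: sums_iff del: of_nat_Suc)
    also have "\<dots> \<le> K"
      unfolding K_def
    proof (rule norm_suminf_le[OF _ sm])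
      fix n
      have "real_of_int \<bar>moebius (Suc n)\<bar> \<le> 1" using abs_moebius_le[of "Suc n"] by linarith
      then have "real_of_int \<bar>moebius (Suc n)\<bar> / real (Suc n) powr 2 \<le> 1 / real (Suc n) powr 2"
        by (intro divide_right_mono) auto
      then show "norm (of_int (moebius (Suc n)) / of_nat (Suc n) powr ?s) \<le> real (Suc n) powr (-2)"
        by (simp add: norm_divide norm_Suc_powr powr_minus_divide del: of_nat_Suc)
    qed
    finally have 1: "norm (1 / zeta ?s) \<le> K" .
    have "1 \<le> norm (?s - 1)" using complex_Re_le_cmod[of "?s - 1"] by simp
    then have "norm (?s - 1) > 0" "1 \<le> norm (?s - 1)" by linarith+
    then have 2: "norm (1 / (?s - 1)) \<le> 1" unfolding norm_divide by (subst pos_divide_le_eq) auto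
    have "inverse (pzeta ?s) = (1 / (?s - 1)) * (1 / zeta ?s)"
    proof -
      have "?s \<noteq> 1" by (simp add: complex_eq_iff)
      then show ?thesis by (simp add: pzeta_def inverse_eq_divide)
    qed
    then have "norm (inverse (pzeta ?s)) = norm (1 / (?s - 1)) * norm (1 / zeta ?s)"
      by (simp only: norm_mult)
    also have "\<dots> \<le> 1 * K" using 1 2 by (intro mult_mono) auto
    finally show ?thesis by simp
  qed
  with that \<open>K > 0\<close> nz show thesis by blast
qed

text \<open>The disc of radius 3/2 around c = 2 + i * Im s just fits into the zero-free half-plane.
  On it the logarithm \<open>h\<close> satisfies Re (h - h c) < A with \<open>A\<close> of the size
  of ln (1 + |s|), and Borel-Caratheodory bounds |h s - h c| by a multiple of \<open>A\<close>.
  Exponentiating gives a power of 1 + |s|.\<close>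

lemma norm_inverse_pzeta_le:
  assumes nz: "\<And>s. Re s > 1 / 2 \<Longrightarrow> pzeta s \<noteq> 0" and a: "1 / 2 < a" "a \<le> 2"
  obtains C m where "C > 0" "\<And>s. a \<le> Re s \<Longrightarrow> Re s \<le> 2 \<Longrightarrow> norm (inverse (pzeta s)) \<le> C * (1 + norm s) ^ m"
proof -
  obtain K where K: "K > 0" "\<And>y. norm (inverse (pzeta (Complex 2 y))) \<le> K" "\<And>y. pzeta (Complex 2 y) \<noteq> 0"
    using norm_inverse_pzeta_line_2 by blast
  obtain C where C: "C > 0" "\<And>s. Re s \<ge> 1/4 \<Longrightarrow> norm (pzeta s) \<le> C * (1 + norm s) ^ 2"
    using norm_pzeta_le by blast
  obtain h where h: "h holomorphic_on {s. Re s > 1 / 2}" "\<And>s. s \<in> {s. Re s > 1 / 2} \<Longrightarrow> exp (h s) = pzeta s"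
  proof (rule holomorphic_logarithm_exists[of "{s. Re s > 1 / 2}" pzeta 1])
    show "pzeta s \<noteq> 0" if "s \<in> {s. Re s > 1 / 2}" for s using nz that by auto
    show "convex {s. Re s > 1 / 2}" "open {s. Re s > 1 / 2}"
      by (rule convex_halfspace_Re_gt open_halfspace_Re_gt)+
  qed (auto intro: holomorphic_pzeta)
  \<comment> \<open>The factor 16 is the square of 4 in 1 + |c + u| \<le> 4 * (1 + |s|) on the disc.
    The summand 2 makes the logarithm \<open>A\<close> positive and the bound on the real part
    strict.\<close>
  define M where "M = 2 + 16 * C * K"
  have M: "M > 1" "M > 16 * C * K" using C K by (auto simp: M_def add_pos_pos)
  \<comment> \<open>An integer no smaller than the factor 2 * |s - c| / (3/2 - |s - c|) of
    Borel-Caratheodory, which is largest at Re s = a, where |s - c| = 2 - a.\<close>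
  define q where "q = nat \<lceil>2 * (2 - a) / (a - 1 / 2)\<rceil>"
  have q: "2 * (2 - a) / (a - 1 / 2) \<le> real q" unfolding q_def by linarith
  show thesis
  proof (rule that[of "K * M ^ q" "2 * q"])
    show "K * M ^ q > 0" using K M by auto
    fix s assume s: "a \<le> Re s" "Re s \<le> 2"
    define c where "c = Complex 2 (Im s)"
    define A where "A = ln (M * (1 + norm s) ^ 2)"
    have "1 \<le> (1 + norm s) ^ 2" by (intro one_le_power) auto
    then have "M * 1 \<le> M * (1 + norm s) ^ 2" using M by (intro mult_left_mono) auto
    then have MA: "M * (1 + norm s) ^ 2 > 1" using M by linarith
    then have A: "A > 0" unfolding A_def by simp
    have "s - c = of_real (Re s - 2)" by (simp add: c_def complex_eq_iff)
    then have sc: "norm (s - c) = 2 - Re s" using s by (simp add: norm_of_real del: of_real_diff)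
    have half: "Re (c + u) > 1 / 2" if "norm u < 3 / 2" for u
      using that abs_Re_le_cmod[of u] by (simp add: c_def)
    have re_h: "exp (Re (h u)) = norm (pzeta u)" if "Re u > 1 / 2" for u
      using h(2)[of u] that norm_exp_eq_Re[of "h u"] by simp
    have re_hc: "exp (Re (h c)) = norm (pzeta c)" using re_h[of c] by (simp add: c_def)
    have re_hs: "exp (Re (h s)) = norm (pzeta s)" using re_h[of s] s a by simp
    have pc: "norm (inverse (pzeta c)) \<le> K" "pzeta c \<noteq> 0" using K by (auto simp: c_def)
    have "norm (h (c + (s - c)) - h c) \<le> 2 * A * norm (s - c) / (3 / 2 - norm (s - c))"
    proof (rule Borel_Caratheodory[where f = "\<lambda>u. h (c + u) - h c" and R = "3/2"])
      have "(\<lambda>u. c + u) ` ball 0 (3 / 2) \<subseteq> {s. Re s > 1 / 2}"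
      proof (rule image_subsetI)
        fix u :: complex assume "u \<in> ball 0 (3 / 2)"
        then show "c + u \<in> {s. Re s > 1 / 2}" using half[of u] by simp
      qed
      then have "h \<circ> (\<lambda>u. c + u) holomorphic_on ball 0 (3 / 2)"
        by (intro holomorphic_on_compose_gen[OF _ h(1)] holomorphic_intros)
      then show "(\<lambda>u. h (c + u) - h c) holomorphic_on ball 0 (3 / 2)"
        by (intro holomorphic_intros) (simp add: o_def)
      show "norm (s - c) < 3 / 2" using sc s a by simp
      fix u :: complex assume u: "norm u < 3 / 2"
      have "norm (c + u) \<le> norm s + norm (s - c) + norm u"
        using norm_triangle_ineq[of c u] norm_triangle_sub[of c s] by (simp add: norm_minus_commute)
      moreover have "norm (s - c) \<le> 3 / 2" unfolding sc using s a by linarith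
      moreover have "4 * (1 + norm s) = 4 + 4 * norm s" by simp
      ultimately have "1 + norm (c + u) \<le> 4 * (1 + norm s)" using u norm_ge_zero[of s] by linarith
      then have "(1 + norm (c + u)) ^ 2 \<le> (4 * (1 + norm s)) ^ 2" by (intro power_mono) auto
      then have "C * (1 + norm (c + u)) ^ 2 \<le> C * (4 * (1 + norm s)) ^ 2"
        using C by (intro mult_left_mono) auto
      moreover have "norm (pzeta (c + u)) \<le> C * (1 + norm (c + u)) ^ 2"
        using half[OF u] by (intro C(2)) auto
      moreover have "C * (4 * (1 + norm s)) ^ 2 = 16 * C * (1 + norm s) ^ 2"
        by (simp only: power_mult_distrib) simp
      ultimately have "norm (pzeta (c + u)) \<le> 16 * C * (1 + norm s) ^ 2" by linarith
      then have "norm (pzeta (c + u)) * norm (inverse (pzeta c)) \<le> (16 * C * (1 + norm s) ^ 2) * K"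
        using pc C by (intro mult_mono) auto
      also have "\<dots> = (16 * C * K) * (1 + norm s) ^ 2" by simp
      also have "\<dots> < M * (1 + norm s) ^ 2"
        using M by (intro mult_strict_right_mono zero_less_power) (auto simp: add_pos_nonneg)
      also have "\<dots> = exp A" using MA by (simp add: A_def)
      finally have "norm (pzeta (c + u)) * norm (inverse (pzeta c)) < exp A" .
      then have "exp (Re (h (c + u) - h c)) < exp A"
        by (simp only: minus_complex.sel exp_diff re_h[OF half[OF u]] re_hc norm_inverse divide_inverse)
      then show "Re (h (c + u) - h c) < A" by simp
    qed (use A in auto)
    also have "\<dots> \<le> A * q"
    proof -
      have "2 * norm (s - c) / (3 / 2 - norm (s - c)) \<le> 2 * (2 - a) / (a - 1 / 2)"
        unfolding sc using s a by (intro frac_le) auto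
      then have "A * (2 * norm (s - c) / (3 / 2 - norm (s - c))) \<le> A * q"
        using q A by (intro mult_left_mono) auto
      then show ?thesis by (simp add: mult_ac)
    qed
    finally have "norm (h s - h c) \<le> A * q" by simp
    then have "- Re (h s - h c) \<le> A * q" using abs_Re_le_cmod[of "h s - h c"] by linarith
    then have "exp (- Re (h s - h c)) \<le> exp (A * q)" by simp
    also have "exp (A * q) = (M * (1 + norm s) ^ 2) ^ q"
      using MA by (simp add: exp_of_nat2_mult A_def)
    finally have "exp (Re (h c) - Re (h s)) \<le> (M * (1 + norm s) ^ 2) ^ q"
      by (simp only: minus_complex.sel minus_diff_eq)
    then have "norm (pzeta c) * norm (inverse (pzeta s)) \<le> (M * (1 + norm s) ^ 2) ^ q"
      by (simp only: exp_diff re_hs re_hc norm_inverse divide_inverse)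
    \<comment> \<open>So far the quotient of \<open>pzeta c\<close> by \<open>pzeta s\<close> is
      bounded. The bound \<open>K\<close> on Re = 2 removes the numerator.\<close>
    then have "norm (inverse (pzeta c)) * (norm (pzeta c) * norm (inverse (pzeta s))) \<le> K * (M * (1 + norm s) ^ 2) ^ q"
      using pc K by (intro mult_mono) auto
    moreover have "norm (inverse (pzeta c)) * (norm (pzeta c) * norm (inverse (pzeta s))) = norm (inverse (pzeta s))"
      using pc(2) by (simp add: norm_inverse)
    ultimately have "norm (inverse (pzeta s)) \<le> K * (M * (1 + norm s) ^ 2) ^ q" by simp
    then show "norm (inverse (pzeta s)) \<le> K * M ^ q * (1 + norm s) ^ (2 * q)"
      by (simp only: power_mult_distrib power_mult mult.assoc)
  qed
qed

section \<open>The function Phi\<close>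

text \<open>Both sides of the functional equation vanish at 1, and their derivatives there give \<open>zeta 0\<close>.\<close>

lemma pzeta_0: "pzeta 0 = 1 / 2"
proof -
  define Q where "Q s = rGamma s * of_real pi * of_real (2 * pi) powr (s - 1) * pzeta (1 - s)" for s
  define P where "P s = pzeta s * s" for s
  have "P holomorphic_on UNIV" unfolding P_def[abs_def] by (intro holomorphic_intros)
  then have P: "(P has_field_derivative deriv P 1) (at 1)" by (rule holomorphic_derivI) auto
  have "Q holomorphic_on UNIV" unfolding Q_def[abs_def] by (intro holomorphic_intros)
  then have Q: "(Q has_field_derivative deriv Q 1) (at 1)" by (rule holomorphic_derivI) auto
  have c: "((\<lambda>s. cos (of_real pi * s / 2)) has_field_derivative - (of_real pi / 2)) (at 1)"
    by (auto intro!: derivative_eq_intros simp flip: sin_of_real)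
  have "((\<lambda>s. P s * cos (of_real pi * s / 2)) has_field_derivative - (of_real pi / 2)) (at 1)"
    by (rule derivative_eq_intros P c refl)+ (simp add: P_def flip: cos_of_real)
  moreover have "((\<lambda>s. - (s - 1) * Q s) has_field_derivative - Q 1) (at 1)"
    by (rule derivative_eq_intros Q refl)+ simp
  moreover have "(\<lambda>s. P s * cos (of_real pi * s / 2)) = (\<lambda>s. - (s - 1) * Q s)"
    using pzeta_functional_equation by (simp add: P_def Q_def mult.assoc)
  ultimately have "- (of_real pi / 2) = - Q 1" by (metis DERIV_unique)
  then show ?thesis by (simp add: Q_def field_simps)
qed

text \<open>For a zero with Re s < 1/2 the value \<open>pzeta (1 - s)\<close> is nonzero, so the
  functional equation at 1 - s leaves sin (pi * s / 2) = 0 and s is an even integer at most 0.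
  Negative ones are trivial zeros, and \<open>pzeta_0\<close> excludes 0.\<close>

theorem Riemann_Hypothesis_iff_pzeta:
  "Riemann_Hypothesis \<longleftrightarrow> (\<forall>s. Re s > 1 / 2 \<longrightarrow> pzeta s \<noteq> 0)"
proof safe
  fix s assume RH: Riemann_Hypothesis and s: "Re s > 1 / 2" "pzeta s = 0"
  then have "s \<noteq> 1" "zeta s = 0" by (auto simp: pzeta_def split: if_splits)
  moreover have "\<nexists>k::nat. k \<ge> 1 \<and> s = - 2 * of_nat k" using s(1) by auto
  ultimately show False using RH s(1) unfolding Riemann_Hypothesis_def by fastforce
next
  assume nz: "\<forall>s. Re s > 1 / 2 \<longrightarrow> pzeta s \<noteq> 0"
  show Riemann_Hypothesis
    unfolding Riemann_Hypothesis_def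
  proof safe
    fix s assume s: "zeta s = 0" "s \<noteq> 1" "\<nexists>k::nat. k \<ge> 1 \<and> s = - 2 * of_nat k"
    have ps: "pzeta s = 0" using s by (simp add: pzeta_def)
    show "Re s = 1 / 2"
    proof (rule ccontr)
      assume "Re s \<noteq> 1 / 2"
      then have Re: "Re s < 1 / 2" using nz ps by (meson linorder_neqE_linordered_idom)
      then have "pzeta (1 - s) \<noteq> 0" using nz by auto
      with pzeta_functional_equation[of "1 - s"] ps s(2) have "cos (of_real pi * (1 - s) / 2) = 0"
        by simp
      moreover have "cos (of_real pi * (1 - s) / 2) = sin (of_real pi * s / 2)"
      proof -
        have eq: "of_real pi * (1 - s) / 2 = of_real pi / 2 - of_real pi * s / 2" by (simp add: field_simps)
        show ?thesis unfolding eq by (simp add: cos_diff)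
      qed
      ultimately have "sin (of_real pi * s / 2) = 0" by simp
      then obtain k :: int where "of_real pi * s / 2 = of_real (real_of_int k * pi)"
        unfolding sin_eq_0 by (auto simp: mult.commute)
      then have sk: "s = 2 * of_int k" by (simp add: field_simps)
      then have "k \<le> 0" using Re by auto
      show False
      proof (cases "k = 0")
        case True
        then show False using sk ps pzeta_0 by simp
      next
        case False
        then have "nat (- k) \<ge> 1" "s = - 2 * of_nat (nat (- k))" using \<open>k \<le> 0\<close> sk by auto
        then show False using s(3) by blast
      qed
    qed
  qed
qed

section \<open>Elementary bounds and measurability of \<open>Phi\<close>\<close>

lemma abs_moebius_mult_le: "x \<ge> 0 \<Longrightarrow> \<bar>real_of_int (moebius n) * x\<bar> \<le> x"
proof -
  assume "x \<ge> 0"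
  have "real_of_int \<bar>moebius n\<bar> \<le> 1" using abs_moebius_le[of n] by linarith
  then have "real_of_int \<bar>moebius n\<bar> * x \<le> 1 * x" using \<open>x \<ge> 0\<close> by (intro mult_right_mono) auto
  then show ?thesis using \<open>x \<ge> 0\<close> by (simp add: abs_mult)
qed

lemma Phi_sums:
  assumes "t > 0"
  shows "(\<lambda>n. of_int (moebius (Suc n)) * exp (- real (Suc n) * t)) sums Phi t"
    and "\<bar>Phi t\<bar> \<le> 1 / (exp t - 1)"
proof -
  let ?f = "\<lambda>n. of_int (moebius (Suc n)) * exp (- real (Suc n) * t)"
  have le: "norm (?f n) \<le> exp (- real (Suc n) * t)" for n
    unfolding real_norm_def by (rule abs_moebius_mult_le) simp
  note e = exp_minus_Suc_sums[OF assms]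
  have "summable ?f"
    by (rule summable_comparison_test'[OF sums_summable[OF e], of 0]) (rule le)
  then show "?f sums Phi t" unfolding Phi_def by (rule summable_sums)
  have "norm (suminf ?f) \<le> (\<Sum>n. exp (- real (Suc n) * t))"
    by (rule norm_suminf_le[OF le sums_summable[OF e]])
  then show "\<bar>Phi t\<bar> \<le> 1 / (exp t - 1)"
    using sums_unique[OF e] by (simp add: Phi_def)
qed

lemma abs_Phi_le_exp:
  assumes "t \<ge> 1"
  shows "\<bar>Phi t\<bar> \<le> 2 * exp (- t)"
proof -
  have "2 \<le> exp t" using exp_ge_add_one_self[of t] assms by linarith
  then have "1 / (exp t - 1) \<le> 2 * exp (- t)" using assms by (simp add: exp_minus divide_simps)
  then show ?thesis using Phi_sums(2)[of t] assms by linarith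
qed

lemma borel_measurable_Phi [measurable]: "Phi \<in> borel_measurable borel"
  unfolding Phi_def[abs_def] by measurable

lemma integrable_lebesgue_on_iff:
  fixes f :: "real \<Rightarrow> real"
  assumes "f \<in> borel_measurable borel" "A \<in> sets borel"
  shows "integrable (lebesgue_on A) f \<longleftrightarrow> set_integrable lborel A f"
  using assms unfolding set_integrable_def
  by (subst integrable_restrict_space) (auto intro!: integrable_completion)

lemma mem_Lp_Phi_iff:
  "mem_Lp p {0<..} Phi \<longleftrightarrow> set_integrable lborel {0<..} (\<lambda>t. \<bar>Phi t\<bar> powr p)"
proof -
  have "Phi \<in> borel_measurable (lebesgue_on {0<..})"
    by (intro measurable_restrict_space1 measurable_completion) simp
  moreover have "integrable (lebesgue_on {0<..}) (\<lambda>t. \<bar>Phi t\<bar> powr p) \<longleftrightarrow>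
      set_integrable lborel {0<..} (\<lambda>t. \<bar>Phi t\<bar> powr p)"
    by (rule integrable_lebesgue_on_iff) measurable
  ultimately show ?thesis by (simp add: mem_Lp_def)
qed

section \<open>From integrability of \<open>Phi\<close> to the absence of zeros\<close>

lemma set_integral_Gamma_scaled:
  assumes "s > 0" "a > (0::real)"
  shows "set_integrable lborel {0<..} (\<lambda>t. t powr (s - 1) * exp (- a * t))"
    and "(LBINT t:{0<..}. t powr (s - 1) * exp (- a * t)) = Gamma s * a powr (- s)"
  using assms nn_integral_Gamma_scaled[OF assms]
  by (intro nn_integral_imp_set_integral; auto simp: Gamma_real_pos less_imp_le)+

text \<open>Young's inequality with the conjugate exponent \<open>q\<close> leaves, on (0, 1), a
  power of t with exponent (x - 1) * q, and this exceeds -1 precisely because x > 1/p. From 1 on the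
  exponential bound suffices.\<close>

lemma mellin_conv_Phi:
  assumes p: "1 < p" "1 / p < x" and L: "set_integrable lborel {0<..} (\<lambda>t. \<bar>Phi t\<bar> powr p)"
  shows "mellin_conv Phi x"
proof -
  define q where "q = p / (p - 1)"
  have q: "q > 1" "1 / p + 1 / q = 1" using p by (auto simp: q_def field_simps)
  have "1 / q > - (x - 1)" using q(2) p(2) by linarith
  then have xq: "(x - 1) * q > -1" using q(1) by (simp add: field_simps)
  have x: "x > 0" using p by (meson less_trans zero_less_divide_1_iff zero_less_one)
  let ?u = "\<lambda>t. if t < 1 then t powr ((x - 1) * q) else 0"
  let ?e = "\<lambda>t. 2 * (t powr (x - 1) * exp (- 1 * t))"
  show ?thesis unfolding mellin_conv_def
  proof (rule set_integrable_bound[OF set_integral_add(1)[OF set_integral_add(1)]])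
    show "set_integrable lborel {0<..} (\<lambda>t. \<bar>Phi t\<bar> powr p)" by (rule L)
    show "set_integrable lborel {0<..} ?u" by (rule set_integral_powr_unit(1)[OF xq])
    show "set_integrable lborel {0<..} ?e"
      by (intro set_integrable_mult_right set_integral_Gamma_scaled(1) x) auto
    show "set_borel_measurable lborel {0<..} (\<lambda>t. Phi t * t powr (x - 1))"
      unfolding set_borel_measurable_def by measurable
    show "AE t\<in>{0<..} in lborel. norm (Phi t * t powr (x - 1)) \<le> norm (\<bar>Phi t\<bar> powr p + ?u t + ?e t)"
    proof (intro AE_I2 impI)
      fix t :: real assume t: "t \<in> {0<..}"
      have nonneg: "\<bar>Phi t\<bar> powr p \<ge> 0" "?u t \<ge> 0" "?e t \<ge> 0" by auto
      have "\<bar>Phi t\<bar> * t powr (x - 1) \<le> \<bar>Phi t\<bar> powr p + ?u t + ?e t"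
      proof (cases "t < 1")
        case True
        have "\<bar>Phi t\<bar> * t powr (x - 1) \<le> \<bar>Phi t\<bar> powr p / p + (t powr (x - 1)) powr q / q"
          using p(1) q by (intro Youngs_inequality) auto
        also have "\<bar>Phi t\<bar> powr p / p \<le> \<bar>Phi t\<bar> powr p / 1"
          using p by (intro divide_left_mono) auto
        also have "(t powr (x - 1)) powr q / q \<le> (t powr (x - 1)) powr q / 1"
          using q by (intro divide_left_mono) auto
        also have "(t powr (x - 1)) powr q = ?u t" using True by (simp add: powr_powr)
        finally show ?thesis using nonneg(3) by linarith
      next
        case False
        then have "\<bar>Phi t\<bar> * t powr (x - 1) \<le> (2 * exp (- t)) * t powr (x - 1)"
          by (intro mult_right_mono abs_Phi_le_exp) auto
        also have "\<dots> = ?e t" by simp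
        finally show ?thesis using nonneg by linarith
      qed
      then show "norm (Phi t * t powr (x - 1)) \<le> norm (\<bar>Phi t\<bar> powr p + ?u t + ?e t)"
        using nonneg by (simp add: abs_mult)
    qed
  qed
qed

text \<open>Termwise integration, justified by absolute convergence for x > 1. The product form can
  be continued to points where \<open>pzeta\<close> might vanish.\<close>

lemma mellin_Phi_mult_pzeta_real:
  assumes x: "x > 1"
  shows "mellin Phi (of_real x) * pzeta (of_real x) = (of_real x - 1) * Gamma (of_real x)"
proof -
  define f where "f n t = indicator {0<..} t *\<^sub>R (of_int (moebius (Suc n)) * (t powr (x - 1) * exp (- real (Suc n) * t)))" for n t
  have int0: "integrable lborel (\<lambda>t. indicator {0<..} t *\<^sub>R (t powr (x - 1) * exp (- real (Suc n) * t)))"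
    and val0: "(\<integral>t. indicator {0<..} t *\<^sub>R (t powr (x - 1) * exp (- real (Suc n) * t)) \<partial>lborel) = Gamma x * real (Suc n) powr (- x)" for n
    using set_integral_Gamma_scaled[of x "real (Suc n)"] x by (simp_all add: set_integrable_def set_lebesgue_integral_def)
  have f_eq: "f n = (\<lambda>t. of_int (moebius (Suc n)) * (indicator {0<..} t *\<^sub>R (t powr (x - 1) * exp (- real (Suc n) * t))))" for n
    by (auto simp: f_def indicator_def)
  have int: "integrable lborel (f n)" for n
    unfolding f_eq by (intro integrable_mult_right int0)
  have val: "integral\<^sup>L lborel (f n) = of_int (moebius (Suc n)) * (Gamma x * real (Suc n) powr (- x))" for n
    unfolding f_eq integral_mult_right_zero val0 ..
  have norm_f: "norm (f n t) \<le> indicator {0<..} t *\<^sub>R (t powr (x - 1) * exp (- real (Suc n) * t))" for n t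
    unfolding f_eq real_norm_def by (rule abs_moebius_mult_le) (auto simp: indicator_def)
  have fs: "(\<lambda>n. f n t) sums (indicator {0<..} t *\<^sub>R (Phi t * t powr (x - 1)))" for t
  proof (cases "t > 0")
    case True
    then show ?thesis using sums_mult2[OF Phi_sums(1)[OF True], of "t powr (x - 1)"] by (simp add: f_def mult_ac)
  qed (simp add: f_def)
  have "(\<lambda>n. integral\<^sup>L lborel (f n)) sums (\<integral>t. (\<Sum>n. f n t) \<partial>lborel)"
  proof (rule sums_integral[OF int])
    show "AE t in lborel. summable (\<lambda>n. norm (f n t))"
    proof (intro AE_I2)
      fix t :: real
      show "summable (\<lambda>n. norm (f n t))"
      proof (cases "t > 0")
        case True
        have "summable (\<lambda>n. t powr (x - 1) * exp (- real (Suc n) * t))"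
          by (intro summable_mult sums_summable[OF exp_minus_Suc_sums[OF True]])
        then show ?thesis
          by (rule summable_comparison_test'[of _ 0]) (use norm_f[of _ t] True in simp)
      qed (simp add: f_def)
    qed
    have "summable (\<lambda>n. Gamma x * real (Suc n) powr (- x))"
      using x by (intro summable_mult summable_Suc_powr) auto
    then show "summable (\<lambda>n. \<integral>t. norm (f n t) \<partial>lborel)"
    proof (rule summable_comparison_test'[of _ 0])
      fix n
      have "(\<integral>t. norm (f n t) \<partial>lborel) \<le> Gamma x * real (Suc n) powr (- x)"
        unfolding val0[symmetric] by (intro integral_mono integrable_norm int int0 norm_f)
      then show "norm (\<integral>t. norm (f n t) \<partial>lborel) \<le> Gamma x * real (Suc n) powr (- x)"
        by simp
    qed
  qed
  also have "(\<lambda>t. \<Sum>n. f n t) = (\<lambda>t. indicator {0<..} t *\<^sub>R (Phi t * t powr (x - 1)))"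
    using sums_unique[OF fs] by auto
  finally have "(\<lambda>n. complex_of_real (of_int (moebius (Suc n)) * (Gamma x * real (Suc n) powr (- x)))) sums mellin Phi (of_real x)"
    unfolding val mellin_of_real set_lebesgue_integral_def by (rule sums_of_real)
  moreover have "(\<lambda>n. of_real (Gamma x) * (of_int (moebius (Suc n)) / of_nat (Suc n) powr complex_of_real x)) sums (of_real (Gamma x) * (1 / zeta (of_real x)))"
    using x by (intro sums_mult moebius_sums_inverse_zeta(2)) auto
  moreover have "of_real (Gamma x) * (of_int (moebius (Suc n)) / of_nat (Suc n) powr complex_of_real x) =
     complex_of_real (of_int (moebius (Suc n)) * (Gamma x * real (Suc n) powr (- x)))" for n
    using powr_of_real[of "real (Suc n)" x] by (simp add: powr_minus_divide del: of_nat_Suc)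
  ultimately have "mellin Phi (of_real x) = of_real (Gamma x) * (1 / zeta (of_real x))"
    by (simp only: sums_unique2)
  moreover have "zeta (of_real x) \<noteq> 0" using x by (intro moebius_sums_inverse_zeta(1)) auto
  ultimately show ?thesis using x by (simp add: pzeta_def Gamma_complex_of_real)
qed

text \<open>At a zero of \<open>pzeta\<close> the left side of the continued identity would vanish,
  whereas (s - 1) * Gamma s vanishes only at 1, where \<open>pzeta\<close> is 1.\<close>

lemma pzeta_nonzero_if_Lp:
  assumes L: "\<forall>p. 1 \<le> p \<and> p < 2 \<longrightarrow> mem_Lp p {0<..} Phi" and s: "Re s > 1 / 2"
  shows "pzeta s \<noteq> 0"
proof -
  have conv: "mellin_conv Phi x" if "x > 1 / 2" for x
  proof -
    \<comment> \<open>Here 1 / p is the midpoint of 1/2 and \<open>min x 1\<close>; the cap at 1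
      keeps p above 1.\<close>
    define p where "p = 4 / (1 + 2 * min x 1)"
    have "1 < p" "p < 2" "1 / p < x" using that by (auto simp: p_def min_def field_simps)
    then show ?thesis using L by (intro mellin_conv_Phi[of p]) (auto simp: mem_Lp_Phi_iff)
  qed
  let ?A = "{s. Re s \<in> {1/2<..}}"
  have "mellin Phi s * pzeta s = (s - 1) * Gamma s"
  proof (rule holomorphic_eq_from_real_interval[where A = ?A and a = 1 and b = 2 and
        f = "\<lambda>s. mellin Phi s * pzeta s" and g = "\<lambda>s. (s - 1) * Gamma s"])
    show "(\<lambda>s. mellin Phi s * pzeta s) holomorphic_on ?A"
      by (intro holomorphic_intros holomorphic_mellin conv) auto
    show "(\<lambda>s. (s - 1) * Gamma s) holomorphic_on ?A"
      by (intro holomorphic_intros) (auto elim!: nonpos_Ints_cases)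
    have "?A = {s. Re s > 1/2}" by auto
    then show "open ?A" "connected ?A"
      by (simp_all only: open_halfspace_Re_gt convex_connected convex_halfspace_Re_gt)
    show "mellin Phi (of_real x) * pzeta (of_real x) = (of_real x - 1) * Gamma (of_real x)" if "1 < x" for x
      by (rule mellin_Phi_mult_pzeta_real[OF that])
  qed (use s in auto)
  moreover have "s \<notin> \<int>\<^sub>\<le>\<^sub>0" using s by (auto elim!: nonpos_Ints_cases)
  then have "Gamma s \<noteq> 0" by (simp add: Gamma_eq_zero_iff)
  ultimately show ?thesis by (cases "s = 1") auto
qed

section \<open>From the absence of zeros to integrability of \<open>Phi\<close>\<close>

definition Gamma_div_zeta :: "complex \<Rightarrow> complex" where
  "Gamma_div_zeta s = Gamma s * (s - 1) * inverse (pzeta s)"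

text \<open>Mellin inversion of exp (-n * t) for each n \<ge> 1, summed against
  \<open>moebius\<close>. On Re s = 2 the terms are dominated by 1 / n^2 times an integrable
  function, which allows the exchange.\<close>

lemma Phi_eq_line_integral:
  assumes t: "t > 0"
  shows "(\<integral>y. Gamma_div_zeta (Complex 2 y) * of_real t powr (- Complex 2 y) \<partial>lborel) = 2 * of_real pi * of_real (Phi t)"
proof -
  define f where "f n y = of_int (moebius (Suc n)) * (Gamma (Complex 2 y) * of_real (real (Suc n) * t) powr (- Complex 2 y))" for n y
  have int: "integrable lborel (f n)" for n
    unfolding f_def[abs_def] using t by (intro integrable_mult_right Gamma_line_shift(2)[where b = 3]) auto
  have val: "integral\<^sup>L lborel (f n) = of_int (moebius (Suc n)) * (2 * of_real pi * of_real (exp (- real (Suc n) * t)))" for n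
  proof -
    have "integral\<^sup>L lborel (f n) = of_int (moebius (Suc n)) * Gamma_line (real (Suc n) * t) 2"
      unfolding f_def[abs_def] Gamma_line_def by (rule integral_mult_right_zero)
    also have "Gamma_line (real (Suc n) * t) 2 = 2 * of_real pi * of_real (exp (- (real (Suc n) * t)))"
      using t by (intro Gamma_line_eq_exp) simp
    finally show ?thesis by (simp only: mult_minus_left)
  qed
  have split: "complex_of_real (real (Suc n) * t) powr (- s) = (1 / of_nat (Suc n) powr s) * of_real t powr (- s)" for n s
    using t powr_times_real[of "of_nat (Suc n)" "of_real t" "- s"] by (simp add: powr_minus_divide del: of_nat_Suc)
  have norm_f: "norm (f n y) \<le> (norm (Gamma (Complex 2 y)) * t powr (-2)) * real (Suc n) powr (-2)" for n y
  proof -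
    have "norm (f n y) = \<bar>real_of_int (moebius (Suc n)) *
        ((norm (Gamma (Complex 2 y)) * t powr (-2)) * real (Suc n) powr (-2))\<bar>"
      unfolding f_def split using t
      by (simp add: norm_mult norm_divide norm_Suc_powr norm_powr_real_powr abs_mult powr_minus_divide del: of_nat_Suc)
    also have "\<dots> \<le> (norm (Gamma (Complex 2 y)) * t powr (-2)) * real (Suc n) powr (-2)"
      by (rule abs_moebius_mult_le) simp
    finally show ?thesis .
  qed
  have sm: "summable (\<lambda>n. c * real (Suc n) powr (-2))" for c
    by (intro summable_mult summable_Suc_powr) simp
  have fs: "(\<lambda>n. f n y) sums (Gamma_div_zeta (Complex 2 y) * of_real t powr (- Complex 2 y))" for y
  proof -
    let ?s = "Complex 2 y"
    have "?s \<noteq> 1" by (simp add: complex_eq_iff)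
    then have "Gamma ?s * of_real t powr (- ?s) * (1 / zeta ?s) = Gamma_div_zeta ?s * of_real t powr (- ?s)"
      by (simp add: Gamma_div_zeta_def pzeta_def divide_inverse)
    moreover have "(\<lambda>n. Gamma ?s * of_real t powr (- ?s) * (of_int (moebius (Suc n)) / of_nat (Suc n) powr ?s)) sums
      (Gamma ?s * of_real t powr (- ?s) * (1 / zeta ?s))"
      by (intro sums_mult moebius_sums_inverse_zeta(2)) simp
    moreover have "Gamma ?s * of_real t powr (- ?s) * (of_int (moebius (Suc n)) / of_nat (Suc n) powr ?s) = f n y" for n
      unfolding f_def split by (simp add: mult_ac)
    ultimately show ?thesis by (simp only:)
  qed
  have "(\<lambda>n. integral\<^sup>L lborel (f n)) sums (\<integral>y. (\<Sum>n. f n y) \<partial>lborel)"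
  proof (rule sums_integral[OF int])
    show "AE y in lborel. summable (\<lambda>n. norm (f n y))"
      by (intro AE_I2 summable_comparison_test'[OF sm, of 0]) (use norm_f in simp)
    have intG: "integrable lborel (\<lambda>y. norm (Gamma (Complex 2 y)))"
      using Gamma_line_shift(2)[of 2 3 1] by (intro integrable_norm) simp
    show "summable (\<lambda>n. \<integral>y. norm (f n y) \<partial>lborel)"
    proof (rule summable_comparison_test'[OF sm, of 0])
      fix n
      have "(\<integral>y. norm (f n y) \<partial>lborel) \<le> (\<integral>y. (norm (Gamma (Complex 2 y)) * t powr (-2)) * real (Suc n) powr (-2) \<partial>lborel)"
        by (intro integral_mono integrable_norm int norm_f integrable_mult_left intG)
      also have "\<dots> = ((\<integral>y. norm (Gamma (Complex 2 y)) \<partial>lborel) * t powr (-2)) * real (Suc n) powr (-2)"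
        by (simp only: integral_mult_left_zero)
      finally show "norm (\<integral>y. norm (f n y) \<partial>lborel) \<le>
          ((\<integral>y. norm (Gamma (Complex 2 y)) \<partial>lborel) * t powr (-2)) * real (Suc n) powr (-2)"
        by simp
    qed
  qed
  also have "(\<lambda>y. \<Sum>n. f n y) = (\<lambda>y. Gamma_div_zeta (Complex 2 y) * of_real t powr (- Complex 2 y))"
    using sums_unique[OF fs] by auto
  finally have "(\<lambda>n. integral\<^sup>L lborel (f n)) sums (\<integral>y. Gamma_div_zeta (Complex 2 y) * of_real t powr (- Complex 2 y) \<partial>lborel)" .
  moreover have "(\<lambda>n. integral\<^sup>L lborel (f n)) sums (2 * of_real pi * of_real (Phi t))"
  proof -
    have "(\<lambda>n. complex_of_real (of_int (moebius (Suc n)) * exp (- real (Suc n) * t))) sums of_real (Phi t)"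
      using Phi_sums(1)[OF t] by (rule sums_of_real)
    from sums_mult[OF this, of "2 * of_real pi"] show ?thesis
      unfolding val by (simp add: mult_ac del: of_nat_Suc)
  qed
  ultimately show ?thesis by (rule sums_unique2)
qed

text \<open>Once the line has been moved from 2 to \<open>a\<close>, the variable t enters the
  modulus of the integrand only through the factor \<open>t powr (-a)\<close>.\<close>

lemma abs_Phi_le_powr:
  assumes nz: "\<And>s. Re s > 1 / 2 \<Longrightarrow> pzeta s \<noteq> 0" and a: "1 / 2 < a" "a < 2"
  obtains D where "D > 0" "\<And>t. t > 0 \<Longrightarrow> \<bar>Phi t\<bar> \<le> D * t powr (- a)"
proof -
  obtain C m where C: "C > 0" "\<And>s. a \<le> Re s \<Longrightarrow> Re s \<le> 2 \<Longrightarrow> norm (inverse (pzeta s)) \<le> C * (1 + norm s) ^ m"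
    using norm_inverse_pzeta_le[OF nz, of a] a by auto
  \<comment> \<open>The exponent m + 3 is spent as m on 1 / pzeta, 1 on s - 1, and 2 on the decay 1
    / (1 + (Im s)^2).\<close>
  obtain B where B: "B > 0" "\<And>s. a \<le> Re s \<Longrightarrow> Re s \<le> 2 \<Longrightarrow> norm (Gamma s) * (1 + norm s) ^ (m + 3) \<le> B"
    using norm_Gamma_mult_power_le[of a 2 "m + 3"] a by auto
  have G: "norm (Gamma_div_zeta s) \<le> B * C / (1 + (Im s)\<^sup>2)" if s: "a \<le> Re s" "Re s \<le> 2" for s
  proof -
    define r where "r = 1 + norm s"
    have r: "r > 0" "norm (s - 1) \<le> r" using norm_triangle_ineq4[of s 1] by (simp_all add: r_def add_pos_nonneg)
    have "\<bar>Im s\<bar>\<^sup>2 \<le> (norm s)\<^sup>2" by (intro power_mono abs_Im_le_cmod) auto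
    moreover have "r\<^sup>2 = 1 + (norm s)\<^sup>2 + 2 * norm s"
      by (simp add: r_def power2_eq_square algebra_simps)
    ultimately have r2: "1 + (Im s)\<^sup>2 \<le> r\<^sup>2"
      using norm_ge_zero[of s] unfolding power2_abs by linarith
    have "norm (Gamma_div_zeta s) * (1 + (Im s)\<^sup>2) \<le> (norm (Gamma s) * r * (C * r ^ m)) * r\<^sup>2"
      unfolding Gamma_div_zeta_def norm_mult using r r2 C s
      by (intro mult_mono) (auto simp: r_def)
    also have "\<dots> = C * (norm (Gamma s) * r ^ (m + 3))"
      by (simp add: power_add power2_eq_square power3_eq_cube mult_ac)
    also have "\<dots> \<le> C * B" using B(2)[OF s] C(1) by (intro mult_left_mono) (auto simp: r_def)
    finally show ?thesis by (simp add: pos_le_divide_eq add_pos_nonneg mult.commute)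
  qed
  define I where "I = (\<integral>y. B * C * (1 / (1 + y\<^sup>2)) \<partial>lborel)"
  have intI: "integrable lborel (\<lambda>y. B * C * (1 / (1 + y\<^sup>2)))"
    by (intro integrable_mult_right integrable_inverse_1_plus_square)
  have I: "I \<ge> 0" unfolding I_def using B C by (intro Bochner_Integration.integral_nonneg) auto
  have hol: "(\<lambda>s. Gamma_div_zeta s * of_real t powr (- s)) holomorphic_on {s. Re s > 1 / 2}" if "t > 0" for t
    unfolding Gamma_div_zeta_def using nz that
    by (intro holomorphic_intros) (auto elim!: nonpos_Ints_cases)
  show thesis
  \<comment> \<open>Adding 1 makes the constant positive at once.\<close>
  proof (rule that[of "I + 1"])
    show "I + 1 > 0" using I by simp
    fix t :: real assume t: "t > 0"
    let ?F = "\<lambda>s. Gamma_div_zeta s * of_real t powr (- s)"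
    have bd: "norm (?F s) \<le> B * C * (t powr (- a) + t powr (- 2)) / (1 + (Im s)\<^sup>2)" if s: "a \<le> Re s" "Re s \<le> 2" for s
    proof -
      have "norm (?F s) \<le> B * C / (1 + (Im s)\<^sup>2) * (t powr (- a) + t powr (- 2))"
        unfolding norm_mult using B(1) C(1) t s by (intro mult_mono G norm_powr_minus_le) auto
      then show ?thesis by simp
    qed
    note shift = vertical_line_shift[OF a(2) open_halfspace_Re_gt convex_halfspace_Re_gt hol[OF t] _ bd]
    have "(\<integral>y. ?F (Complex a y) \<partial>lborel) = (\<integral>y. ?F (Complex 2 y) \<partial>lborel)"
      by (rule shift(1)) (use a in auto)
    also have "\<dots> = 2 * of_real pi * of_real (Phi t)" by (rule Phi_eq_line_integral[OF t])
    finally have "2 * pi * \<bar>Phi t\<bar> = norm (\<integral>y. ?F (Complex a y) \<partial>lborel)"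
      by (simp add: norm_mult)
    also have "\<dots> \<le> (\<integral>y. t powr (- a) * (B * C * (1 / (1 + y\<^sup>2))) \<partial>lborel)"
    proof (rule Bochner_Integration.integral_norm_bound_integral)
      show "integrable lborel (\<lambda>y. ?F (Complex a y))" by (rule shift(2)) (use a in auto)
      show "norm (?F (Complex a y)) \<le> t powr (- a) * (B * C * (1 / (1 + y\<^sup>2)))" for y
      proof -
        have "norm (?F (Complex a y)) = norm (Gamma_div_zeta (Complex a y)) * t powr (- a)"
          using t by (simp add: norm_mult norm_powr_real_powr)
        also have "\<dots> \<le> B * C / (1 + y\<^sup>2) * t powr (- a)"
          using G[of "Complex a y"] a by (intro mult_right_mono) auto
        finally show ?thesis by (simp add: mult_ac)
      qed
    qed (intro integrable_mult_right intI)
    also have "\<dots> = t powr (- a) * I" unfolding I_def by (rule integral_mult_right_zero)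
    finally have "2 * pi * \<bar>Phi t\<bar> \<le> t powr (- a) * I" .
    moreover have "1 * \<bar>Phi t\<bar> \<le> 2 * pi * \<bar>Phi t\<bar>" using pi_gt3 by (intro mult_right_mono) auto
    ultimately have "\<bar>Phi t\<bar> \<le> t powr (- a) * I" by linarith
    also have "\<dots> \<le> t powr (- a) * (I + 1)" by (intro mult_left_mono) auto
    finally show "\<bar>Phi t\<bar> \<le> (I + 1) * t powr (- a)" by (simp add: mult.commute)
  qed
qed

lemma mem_Lp_Phi:
  assumes nz: "\<And>s. Re s > 1 / 2 \<Longrightarrow> pzeta s \<noteq> 0" and p: "1 \<le> p" "p < 2"
  shows "mem_Lp p {0<..} Phi"
proof -
  \<comment> \<open>The midpoint of 1/2 and 1 / p. Being below 1 / p, it makes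
    \<open>t powr (- a * p)\<close> integrable at 0.\<close>
  define a where "a = (1 / 2 + 1 / p) / 2"
  have a: "1 / 2 < a" "a < 2" "a * p < 1" using p by (auto simp: a_def field_simps)
  obtain D where D: "D > 0" "\<And>t. t > 0 \<Longrightarrow> \<bar>Phi t\<bar> \<le> D * t powr (- a)"
    using abs_Phi_le_powr[OF nz a(1,2)] by blast
  let ?u = "\<lambda>t. D powr p * (if t < 1 then t powr (- a * p) else 0)"
  \<comment> \<open>For t > 0 the factor \<open>t powr (1 - 1)\<close> equals 1; it brings the term
    into the shape of the scaled Gamma integral.\<close>
  let ?e = "\<lambda>t. 2 powr p * (t powr (1 - 1) * exp (- p * t))"
  show ?thesis unfolding mem_Lp_Phi_iff
  proof (rule set_integrable_bound[OF set_integral_add(1)])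
    show "set_integrable lborel {0<..} ?u"
      using a by (intro set_integrable_mult_right set_integral_powr_unit(1)) auto
    show "set_integrable lborel {0<..} ?e"
      using p by (intro set_integrable_mult_right set_integral_Gamma_scaled(1)) auto
    show "set_borel_measurable lborel {0<..} (\<lambda>t. \<bar>Phi t\<bar> powr p)"
      unfolding set_borel_measurable_def by measurable
    show "AE t\<in>{0<..} in lborel. norm (\<bar>Phi t\<bar> powr p) \<le> norm (?u t + ?e t)"
    proof (intro AE_I2 impI)
      fix t :: real assume "t \<in> {0<..}"
      then have t: "t > 0" by simp
      have nonneg: "?u t \<ge> 0" "?e t \<ge> 0" by auto
      have "\<bar>Phi t\<bar> powr p \<le> ?u t + ?e t"
      proof (cases "t < 1")
        case True
        have "\<bar>Phi t\<bar> powr p \<le> (D * t powr (- a)) powr p"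
          using D t p by (intro powr_mono2) auto
        also have "\<dots> = ?u t" using True D t by (simp add: powr_mult powr_powr)
        finally show ?thesis using nonneg by linarith
      next
        case False
        then have "\<bar>Phi t\<bar> powr p \<le> (2 * exp (- t)) powr p"
          using p by (intro powr_mono2 abs_Phi_le_exp) auto
        also have "\<dots> = ?e t" using t by (simp add: powr_mult exp_powr_real mult.commute)
        finally show ?thesis using nonneg by linarith
      qed
      then show "norm (\<bar>Phi t\<bar> powr p) \<le> norm (?u t + ?e t)" using nonneg by simp
    qed
  qed
qed

theorem theorem3p1:
  shows "(Riemann_Hypothesis \<longleftrightarrow> (\<forall>p::real. 1 \<le> p \<and> p < 2 \<longrightarrow> mem_Lp p {0<..} Phi)) \<and>
    ((\<forall>p::real. 1 \<le> p \<and> p < 2 \<longrightarrow> mem_Lp p {0<..} Phi) \<longleftrightarrow>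
     (\<forall>\<epsilon>::real. 0 < \<epsilon> \<and> \<epsilon> \<le> 1 \<longrightarrow> mem_Lp (2 - \<epsilon>) {0<..} Phi))"
proof (intro conjI)
  show "Riemann_Hypothesis \<longleftrightarrow> (\<forall>p::real. 1 \<le> p \<and> p < 2 \<longrightarrow> mem_Lp p {0<..} Phi)"
    unfolding Riemann_Hypothesis_iff_pzeta using mem_Lp_Phi pzeta_nonzero_if_Lp by blast
  show "(\<forall>p::real. 1 \<le> p \<and> p < 2 \<longrightarrow> mem_Lp p {0<..} Phi) \<longleftrightarrow>
     (\<forall>\<epsilon>::real. 0 < \<epsilon> \<and> \<epsilon> \<le> 1 \<longrightarrow> mem_Lp (2 - \<epsilon>) {0<..} Phi)"
  proof safe
    fix p :: real assume "\<forall>\<epsilon>. 0 < \<epsilon> \<and> \<epsilon> \<le> 1 \<longrightarrow> mem_Lp (2 - \<epsilon>) {0<..} Phi" "1 \<le> p" "p < 2"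
    then show "mem_Lp p {0<..} Phi" by (auto dest: spec[of _ "2 - p"])
  qed auto
qed

end
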